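(* Let $M=(p,r)$ be an MDP instance and $\bar\pi$ a deterministic behavior policy generating the data as in Assumption 2 (from some fixed initial distribution). Suppose there are sets $\overline{\mathcal S},\underline{\mathcal S}\subseteq\mathcal S$ such that $V_h^\pi(s)\ge\frac34(H-h+1)$ for $s\in\overline{\mathcal S}$ and $V_h^\pi(s)\le\frac14(H-h+1)$ for $s\in\underline{\mathcal S}$ (for all $h$), and that for some $c>0$, $$\bar p:=\int_{\overline{\mathcal S}}\min_{s\in\mathcal S}p(s'\mid s,\bar\pi(s))\,ds'\ge c,\qquad \underline p:=\int_{\underline{\mathcal S}}\min_{s\in\mathcal S}p(s'\mid s,\bar\pi(s))\,ds'\ge c.$$ Then there exists $N_0$ such that for all $N=KH\ge N_0$ and all $\varepsilon\ge\sqrt{cC_1d/(32N)}$, $$\inf_{\widehat v}\sup_{M'\in\mathcal N(M)}\mathbb P_{M'}\Bigg(\big|v^\pi_{M'}-\widehat v(\mathcal D)\big|\ge\frac{\sqrt c}{24\sqrt N}\sup_{f\in\mathcal Q\setminus\{0\}}\frac{\mathbb E^\pi_{M'}[\sum_{h=0}^{H-1}(H-h)f(s_h,a_h)\mid s_0\sim\xi_0]}{\sqrt{\mathbb E_{M'}[\frac1H\sum_{h=0}^{H-1}f^2(s_{1,h},a_{1,h})]}}\Bigg)\ge\frac16,$$ where the infimum is over all estimators (measurable functions of the data $\mathcal D$), $\mathcal N(M):=\{M'=(p',r):\sup_{(s,a)\in\mathcal X}\|p'(\cdot\mid s,a)-p(\cdot\mid s,a)\|_{\rm TV}\le\varepsilon\}$,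 and $\mathbb P_{M'},\mathbb E_{M'},v^\pi_{M'}$ denote probability, expectation and policy value under the instance $M'$.
   Context: MDP setting: $\mathcal X=\mathcal S\times\mathcal A$; rewards $r'\in[0,1]$ with mean $r(s,a)$, next state $s'\sim p(\cdot\mid s,a)$. Target policy $\pi$, horizon $H$, initial distribution $\xi_0$; $\mathbb E^\pi$ is expectation along $s_0\sim\xi_0$, $a_h\sim\pi(\cdot\mid s_h)$, $s_{h+1}\sim p(\cdot\mid s_h,a_h)$; $v^\pi=\mathbb E^\pi[\sum_{h=0}^Hr(s_h,a_h)]$, $Q_h^\pi(s,a)=\mathbb E^\pi[\sum_{h'=h}^Hr(s_{h'},a_{h'})\mid s_h=s,a_h=a]$, $V_h^\pi(s)=\int Q_h^\pi(s,a)\pi(a\mid s)da$, $V_{H+1}^\pi=0$. $\phi:\mathcal X\to\mathbb R^d$, $\mathcal Q=\{\phi(\cdot)^\top w:w\in\mathbb R^d\}$. Assumption 2 (data): $K$ i.i.d. episodes $\tau_k=(s_{k,0},a_{k,0},r'_{k,0},s_{k,1},\dots,s_{k,H})$ generated along one sample path by the behavior policy, $N=KH$ transitions. $\Sigma:=\mathbb E[\frac1H\sum_{h=0}^{H-1}\phi(s_{1,h},a_{1,h})\phi(s_{1,h},a_{1,h})^\top]$ (under $M$) is assumed invertible and $C_1>0$ satisfies $\phi(s,a)^\top\Sigma^{-1}\phi(s,a)\le C_1d$ for all $(s,a)$. $\|\cdot\|_{\rm TV}$ is total variation distance. *)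

theory Defs
  imports "HOL-Probability.Probability"
begin

text \<open>Finite-horizon MDP on a measurable state space S and action space A.
  Transition kernels are maps p :: 's \<times> 'a \<Rightarrow> 's measure, policies are kernels
  pol :: 's \<Rightarrow> 'a measure (a deterministic policy pb is the kernel s \<mapsto> return A (pb s)).\<close>

fun sdist :: "'s measure \<Rightarrow> 'a measure \<Rightarrow> ('s \<times> 'a \<Rightarrow> 's measure) \<Rightarrow> ('s \<Rightarrow> 'a measure)
    \<Rightarrow> 's measure \<Rightarrow> nat \<Rightarrow> 's measure" where
  "sdist S A p pol xi 0 = xi"
| "sdist S A p pol xi (Suc h) =
     bind (sdist S A p pol xi h) (\<lambda>s. bind (pol s) (\<lambda>a. p (s, a)))"

definition sadist :: "'s measure \<Rightarrow> 'a measure \<Rightarrow> ('s \<times> 'a \<Rightarrow> 's measure) \<Rightarrow> ('s \<Rightarrow> 'a measure)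
    \<Rightarrow> 's measure \<Rightarrow> nat \<Rightarrow> ('s \<times> 'a) measure" where
  "sadist S A p pol xi h =
     bind (sdist S A p pol xi h) (\<lambda>s. distr (pol s) (S \<Otimes>\<^sub>M A) (\<lambda>a. (s, a)))"

definition mean_reward :: "('s \<times> 'a \<Rightarrow> real measure) \<Rightarrow> 's \<times> 'a \<Rightarrow> real" where
  "mean_reward R x = (\<integral>t. t \<partial>(R x))"

definition pvalue :: "'s measure \<Rightarrow> 'a measure \<Rightarrow> ('s \<times> 'a \<Rightarrow> 's measure) \<Rightarrow> ('s \<times> 'a \<Rightarrow> real measure)
    \<Rightarrow> ('s \<Rightarrow> 'a measure) \<Rightarrow> 's measure \<Rightarrow> nat \<Rightarrow> real" where
  "pvalue S A p R pol xi H = (\<Sum>h\<le>H. \<integral>x. mean_reward R x \<partial>(sadist S A p pol xi h))"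

text \<open>V_h^pi(s) = E^pi[ sum_{h'=h}^H r(s_h',a_h') | s_h = s ] (time-homogeneous dynamics);
  V_{H+1} = 0.\<close>
definition Vfun :: "'s measure \<Rightarrow> 'a measure \<Rightarrow> ('s \<times> 'a \<Rightarrow> 's measure) \<Rightarrow> ('s \<times> 'a \<Rightarrow> real measure)
    \<Rightarrow> ('s \<Rightarrow> 'a measure) \<Rightarrow> nat \<Rightarrow> nat \<Rightarrow> 's \<Rightarrow> real" where
  "Vfun S A p R pol H h s =
     (if h \<le> H then pvalue S A p R pol (return S s) (H - h) else 0)"

definition tv_dist :: "'s measure \<Rightarrow> 's measure \<Rightarrow> real" where
  "tv_dist P Q = Sup {\<bar>measure P B - measure Q B\<bar> | B. B \<in> sets P}"

definition rec_space :: "'s measure \<Rightarrow> 'a measure \<Rightarrow> ('s \<times> 'a \<times> real) measure" where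
  "rec_space S A = S \<Otimes>\<^sub>M (A \<Otimes>\<^sub>M borel)"

text \<open>Space of an episode (s_0,a_0,r'_0,...,s_{H-1},a_{H-1},r'_{H-1}) together with s_H.\<close>
definition episode_space :: "'s measure \<Rightarrow> 'a measure \<Rightarrow> nat
    \<Rightarrow> ((nat \<Rightarrow> 's \<times> 'a \<times> real) \<times> 's) measure" where
  "episode_space S A n = PiM {..<n} (\<lambda>_. rec_space S A) \<Otimes>\<^sub>M S"

fun episode :: "'s measure \<Rightarrow> 'a measure \<Rightarrow> ('s \<times> 'a \<Rightarrow> 's measure) \<Rightarrow> ('s \<times> 'a \<Rightarrow> real measure)
    \<Rightarrow> ('s \<Rightarrow> 'a) \<Rightarrow> 's measure \<Rightarrow> nat \<Rightarrow> ((nat \<Rightarrow> 's \<times> 'a \<times> real) \<times> 's) measure" where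
  "episode S A p R pb xi 0 = distr xi (episode_space S A 0) (\<lambda>s. ((\<lambda>_. undefined), s))"
| "episode S A p R pb xi (Suc n) =
     bind (episode S A p R pb xi n) (\<lambda>(\<tau>, s).
       bind (R (s, pb s)) (\<lambda>r.
         distr (p (s, pb s)) (episode_space S A (Suc n)) (\<lambda>s'. (\<tau>(n := (s, pb s, r)), s'))))"

definition data_space :: "'s measure \<Rightarrow> 'a measure \<Rightarrow> nat \<Rightarrow> nat
    \<Rightarrow> (nat \<Rightarrow> (nat \<Rightarrow> 's \<times> 'a \<times> real) \<times> 's) measure" where
  "data_space S A K H = PiM {..<K} (\<lambda>_. episode_space S A H)"

definition data_law :: "'s measure \<Rightarrow> 'a measure \<Rightarrow> ('s \<times> 'a \<Rightarrow> 's measure) \<Rightarrow> ('s \<times> 'a \<Rightarrow> real measure)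
    \<Rightarrow> ('s \<Rightarrow> 'a) \<Rightarrow> 's measure \<Rightarrow> nat \<Rightarrow> nat
    \<Rightarrow> (nat \<Rightarrow> (nat \<Rightarrow> 's \<times> 'a \<times> real) \<times> 's) measure" where
  "data_law S A p R pb xi K H = PiM {..<K} (\<lambda>_. episode S A p R pb xi H)"

definition cov_matrix :: "'s measure \<Rightarrow> 'a measure \<Rightarrow> ('s \<times> 'a \<Rightarrow> 's measure) \<Rightarrow> ('s \<Rightarrow> 'a)
    \<Rightarrow> 's measure \<Rightarrow> nat \<Rightarrow> ('s \<times> 'a \<Rightarrow> real^'d) \<Rightarrow> real^'d^'d" where
  "cov_matrix S A p pb xi H \<phi> =
     (1 / real H) *\<^sub>R (\<Sum>h<H. \<integral>x. (\<chi> i j. \<phi> x $ i * \<phi> x $ j)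
        \<partial>(sadist S A p (\<lambda>s. return A (pb s)) xi h))"

text \<open>The ratio  E^pi_{M'}[sum_{h<H} (H-h) f(s_h,a_h)] / sqrt(E_{M'}[(1/H) sum_{h<H} f^2(s_{1,h},a_{1,h})])
  for f = phi^T w, in the extended reals (c/0 = +infinity for c > 0).\<close>
definition ratio :: "'s measure \<Rightarrow> 'a measure \<Rightarrow> ('s \<times> 'a \<Rightarrow> 's measure) \<Rightarrow> ('s \<Rightarrow> 'a measure)
    \<Rightarrow> ('s \<Rightarrow> 'a) \<Rightarrow> 's measure \<Rightarrow> 's measure \<Rightarrow> nat \<Rightarrow> ('s \<times> 'a \<Rightarrow> real^'d) \<Rightarrow> real^'d \<Rightarrow> ereal" where
  "ratio S A p pol pb xi0 xib H \<phi> w =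
     ereal (\<Sum>h<H. real (H - h) * (\<integral>x. \<phi> x \<bullet> w \<partial>(sadist S A p pol xi0 h)))
     / ereal (sqrt ((1 / real H) *
         (\<Sum>h<H. \<integral>x. (\<phi> x \<bullet> w)\<^sup>2 \<partial>(sadist S A p (\<lambda>s. return A (pb s)) xib h))))"

end

theory Submission
  imports Defs
begin

text \<open>
  The hypotheses bound \<open>p\<close> from below only along the behavior actions, but \<open>\<N>(M)\<close> is an
  unrestricted total variation ball, so a two-point argument with mixtures works. Let \<open>U\<close> and \<open>D\<close> be
  distributions on the good and the bad set whose densities are at most \<open>2/c\<close> times every
  \<open>p(\<cdot> | s, pb s)\<close>, and put \<open>p\<^sub>U = (1 - k) p + k U\<close> and \<open>p\<^sub>D = (1 - k) p + k D\<close> with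
  \<open>k = \<alpha> |\<phi>\<cdot>w|\<close>, \<open>\<alpha>\<^sup>2 = c/(32N)\<close>, where \<open>w\<close> has unit \<open>\<Sigma>\<close>-norm and nearly maximises
  \<open>\<Sum> (H - h) E |\<phi>\<cdot>w|\<close>. The absolute value matters: the value gaps of \<open>U\<close> and \<open>D\<close> are
  only between \<open>(H - h)/2\<close> and \<open>H - h\<close>, not proportional to \<open>H - h\<close>, so a signed perturbation could
  cancel. To first order the two values differ by at least \<open>\<alpha>/2\<close> times the maximum, and
  \<open>1/(4 \<surd>32) > 1/24\<close> leaves room for the second-order terms once \<open>N\<close> is large. The
  likelihood ratio of an episode has second moment at most \<open>1 + 1/K\<close>, so that of the data is at
  most \<open>exp 1\<close>, and no test separates the two instances.
\<close>

text \<open>The threshold in the event is computed under M', so the ratios of both perturbed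
  instances must stay close to those of M uniformly in \<open>w\<close>. The bound with
  \<open>C1\<close> gives this: by Cauchy-Schwarz |\<phi> . w| \<le> L sqrt(q w), where q w = w .
  \<Sigma> w and L^2 = C1 d, so every error scales with sqrt(q w) and divides out. The same bound
  makes k at most \<alpha> L = sqrt(c C1 d / (32 N)), the smallest \<epsilon> allowed. Second-order
  errors are O(1/N), against a gap of order 1 / sqrt N.

  Half of c is lost because the infimum over states may fail to be measurable; a measurable density
  is chosen below it. A step then adds at most 8 k^2 / c to the second moment of the likelihood
  ratio. A further factor 4 absorbs the earlier likelihood factors and the passage from the state
  law of the D-instance to that of M, where the squares of \<phi> . w sum to H in expectation. Since
  4 * (8 / c) * \<alpha>^2 * H = 1 / K, this is where 32 = 4 * 8 comes from.

  If even the absolute numerator vanishes for all \<open>w\<close>, the threshold is at most zero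
  and M itself is the bad instance.\<close>

section \<open>Integration against probability kernels\<close>

lemma kernelD:
  assumes "K \<in> M \<rightarrow>\<^sub>M prob_algebra N" "x \<in> space M"
  shows "K x \<in> space (prob_algebra N)"
  using assms by (rule measurable_space)

lemma prob_algebraD:
  assumes "P \<in> space (prob_algebra N)"
  shows "prob_space P" "sets P = sets N" "space P = space N"
    "borel_measurable P = borel_measurable N"
  using assms by (auto simp: space_prob_algebra dest: sets_eq_imp_space_eq cong: measurable_cong_sets)

lemma integrable_prob_bounded:
  fixes f :: "'a \<Rightarrow> real"
  assumes "P \<in> space (prob_algebra N)" "f \<in> borel_measurable N" "\<And>x. x \<in> space N \<Longrightarrow> \<bar>f x\<bar> \<le> B"
  shows "integrable P f"
proof -
  interpret prob_space P using prob_algebraD[OF assms(1)] by simp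
  show ?thesis
    using assms prob_algebraD[OF assms(1)] by (intro integrable_const_bound[where B=B]) auto
qed

lemma integral_prob_le:
  fixes f :: "'a \<Rightarrow> real"
  assumes "P \<in> space (prob_algebra N)" "f \<in> borel_measurable N" "\<And>x. x \<in> space N \<Longrightarrow> \<bar>f x\<bar> \<le> B"
    and "\<And>x. x \<in> space N \<Longrightarrow> f x \<le> b"
  shows "integral\<^sup>L P f \<le> b"
proof -
  interpret prob_space P using prob_algebraD[OF assms(1)] by simp
  show ?thesis
    using assms prob_algebraD[OF assms(1)]
    by (intro integral_le_const integrable_prob_bounded[OF assms(1-3)]) auto
qed

lemma integral_prob_ge:
  fixes f :: "'a \<Rightarrow> real"
  assumes "P \<in> space (prob_algebra N)" "f \<in> borel_measurable N" "\<And>x. x \<in> space N \<Longrightarrow> \<bar>f x\<bar> \<le> B"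
    and "\<And>x. x \<in> space N \<Longrightarrow> b \<le> f x"
  shows "b \<le> integral\<^sup>L P f"
proof -
  interpret prob_space P using prob_algebraD[OF assms(1)] by simp
  show ?thesis
    using assms prob_algebraD[OF assms(1)]
    by (intro integral_ge_const integrable_prob_bounded[OF assms(1-3)]) auto
qed

lemma integral_prob_abs_le:
  fixes f :: "'a \<Rightarrow> real"
  assumes "P \<in> space (prob_algebra N)" "f \<in> borel_measurable N" "\<And>x. x \<in> space N \<Longrightarrow> \<bar>f x\<bar> \<le> B"
  shows "\<bar>integral\<^sup>L P f\<bar> \<le> B"
proof -
  have "integral\<^sup>L P f \<le> B" "- B \<le> integral\<^sup>L P f"
    using assms by (intro integral_prob_le[OF assms] integral_prob_ge[OF assms]; force)+
  then show ?thesis by linarith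
qed

lemma integral_prob_mono:
  fixes f g :: "'a \<Rightarrow> real"
  assumes "P \<in> space (prob_algebra N)" "f \<in> borel_measurable N" "\<And>x. x \<in> space N \<Longrightarrow> \<bar>f x\<bar> \<le> B"
    "g \<in> borel_measurable N" "\<And>x. x \<in> space N \<Longrightarrow> \<bar>g x\<bar> \<le> B'"
    "\<And>x. x \<in> space N \<Longrightarrow> f x \<le> g x"
  shows "integral\<^sup>L P f \<le> integral\<^sup>L P g"
  using assms prob_algebraD[OF assms(1)]
  by (intro integral_mono integrable_prob_bounded[OF assms(1-3)] integrable_prob_bounded[OF assms(1,4,5)]) auto

lemma integral_bind_kernel:
  fixes f :: "'b \<Rightarrow> real"
  assumes "P \<in> space (prob_algebra M)" "K \<in> M \<rightarrow>\<^sub>M prob_algebra N"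
    "f \<in> borel_measurable N" "\<And>x. x \<in> space N \<Longrightarrow> \<bar>f x\<bar> \<le> B"
  shows "integral\<^sup>L (P \<bind> K) f = (\<integral>x. integral\<^sup>L (K x) f \<partial>P)"
proof (rule integral_bind[where K=N and B=B and B'=1])
  note P = prob_algebraD[OF assms(1)]
  show "K \<in> P \<rightarrow>\<^sub>M subprob_algebra N"
    using measurable_prob_algebraD[OF assms(2)] P by (simp cong: measurable_cong_sets)
  show "finite_measure P" using P(1) by (simp add: prob_space_def)
  show "AE x in P. emeasure (K x) (space (K x)) \<le> ennreal 1"
    using P(3) prob_algebraD(1)[OF kernelD[OF assms(2)]]
    by (intro AE_I2) (auto simp: prob_space.emeasure_space_1)
qed (use assms in auto)

lemma nn_integral_bind_kernel:
  assumes "P \<in> space (prob_algebra M)" "K \<in> M \<rightarrow>\<^sub>M prob_algebra N" "f \<in> borel_measurable N"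
  shows "integral\<^sup>N (P \<bind> K) f = (\<integral>\<^sup>+x. integral\<^sup>N (K x) f \<partial>P)"
  using measurable_prob_algebraD[OF assms(2)] prob_algebraD[OF assms(1)] assms(3)
  by (intro nn_integral_bind) (auto cong: measurable_cong_sets)

lemma bind_kernel_space:
  assumes "P \<in> space (prob_algebra M)" "K \<in> M \<rightarrow>\<^sub>M prob_algebra N"
  shows "P \<bind> K \<in> space (prob_algebra N)"
  using prob_space_bind'[OF assms] sets_bind'[OF assms] by (simp add: space_prob_algebra)

text \<open>The integrand depends on the parameter as well. Pushing \<open>K x\<close> forward to
  the slice of the product space over \<open>x\<close> turns the family into integrals of one fixed
  function against a measurably varying measure.\<close>

lemma integral_kernel_measurable:
  fixes f :: "'a \<Rightarrow> 'b \<Rightarrow> real"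
  assumes f[measurable]: "case_prod f \<in> borel_measurable (M \<Otimes>\<^sub>M N)" and K: "K \<in> M \<rightarrow>\<^sub>M prob_algebra N"
  shows "(\<lambda>x. integral\<^sup>L (K x) (f x)) \<in> borel_measurable M"
proof -
  note K'[measurable] = measurable_prob_algebraD[OF K]
  have "(\<lambda>x. integral\<^sup>L (distr (K x) (M \<Otimes>\<^sub>M N) (\<lambda>y. (x, y))) (case_prod f)) \<in> borel_measurable M"
    by (rule measurable_compose[OF measurable_distr2[OF _ K'] integral_measurable_subprob_algebra]) auto
  moreover have "integral\<^sup>L (distr (K x) (M \<Otimes>\<^sub>M N) (\<lambda>y. (x, y))) (case_prod f) = integral\<^sup>L (K x) (f x)"
    if "x \<in> space M" for x
    using that prob_algebraD(2)[OF kernelD[OF K that]]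
    by (subst integral_distr) (auto cong: measurable_cong_sets)
  ultimately show ?thesis by (simp cong: measurable_cong)
qed

lemma nn_integral_kernel_measurable:
  assumes "case_prod f \<in> borel_measurable (M \<Otimes>\<^sub>M N)" "K \<in> M \<rightarrow>\<^sub>M prob_algebra N"
  shows "(\<lambda>x. integral\<^sup>N (K x) (f x)) \<in> borel_measurable M"
  using assms nn_integral_measurable_subprob_algebra2[of f M N K] measurable_prob_algebraD[OF assms(2)]
  by auto

lemma integral_kernel_measurable1:
  fixes f :: "'b \<Rightarrow> real"
  assumes [measurable]: "f \<in> borel_measurable N" and "K \<in> M \<rightarrow>\<^sub>M prob_algebra N"
  shows "(\<lambda>x. integral\<^sup>L (K x) f) \<in> borel_measurable M"
  by (rule integral_kernel_measurable[OF _ assms(2)]) auto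

lemma nn_integral_kernel_measurable1:
  assumes [measurable]: "f \<in> borel_measurable N" and "K \<in> M \<rightarrow>\<^sub>M prob_algebra N"
  shows "(\<lambda>x. integral\<^sup>N (K x) f) \<in> borel_measurable M"
  by (rule nn_integral_kernel_measurable[OF _ assms(2)]) auto

section \<open>Markov chains\<close>

text \<open>Actions are averaged out before the chain is formed, so the state laws under target and
  behavior policy, for the original and for the perturbed transitions, are all instances of this one
  recursion.\<close>

primrec kchain :: "('s \<Rightarrow> 's measure) \<Rightarrow> 's measure \<Rightarrow> nat \<Rightarrow> 's measure" where
  "kchain \<kappa> xi 0 = xi"
| "kchain \<kappa> xi (Suc n) = kchain \<kappa> xi n \<bind> \<kappa>"

text \<open>The recursion appends a step at the end; comparison with value functions needs the first
  step split off instead.\<close>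

lemma kchain_Suc_shift: "kchain \<kappa> xi (Suc n) = kchain \<kappa> (xi \<bind> \<kappa>) n"
  by (induction n) auto

text \<open>This is V indexed by the steps still to go, n = H - h, rather than by time. With n steps
  to go there are n + 1 rewards left, which explains the bound \<open>Suc n\<close> below.\<close>

primrec value_fun :: "('s \<Rightarrow> 's measure) \<Rightarrow> ('s \<Rightarrow> real) \<Rightarrow> nat \<Rightarrow> 's \<Rightarrow> real" where
  "value_fun \<kappa> rb 0 = rb"
| "value_fun \<kappa> rb (Suc n) = (\<lambda>s. rb s + (\<integral>s'. value_fun \<kappa> rb n s' \<partial>\<kappa> s))"

context
  fixes S :: "'s measure" and \<kappa> :: "'s \<Rightarrow> 's measure"
  assumes \<kappa>: "\<kappa> \<in> S \<rightarrow>\<^sub>M prob_algebra S"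
begin

lemma kchain_prob:
  "xi \<in> space (prob_algebra S) \<Longrightarrow> kchain \<kappa> xi n \<in> space (prob_algebra S)"
  by (induction n) (auto intro: bind_kernel_space[OF _ \<kappa>])

lemma nn_integral_kchain_Suc:
  assumes "xi \<in> space (prob_algebra S)" "f \<in> borel_measurable S"
  shows "integral\<^sup>N (kchain \<kappa> xi (Suc n)) f = (\<integral>\<^sup>+s. integral\<^sup>N (\<kappa> s) f \<partial>kchain \<kappa> xi n)"
  using nn_integral_bind_kernel[OF kchain_prob[OF assms(1)] \<kappa> assms(2)] by simp

lemma integral_kchain_Suc:
  fixes f :: "'s \<Rightarrow> real"
  assumes "xi \<in> space (prob_algebra S)" "f \<in> borel_measurable S" "\<And>x. x \<in> space S \<Longrightarrow> \<bar>f x\<bar> \<le> B"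
  shows "integral\<^sup>L (kchain \<kappa> xi (Suc n)) f = (\<integral>s. integral\<^sup>L (\<kappa> s) f \<partial>kchain \<kappa> xi n)"
  using integral_bind_kernel[OF kchain_prob[OF assms(1)] \<kappa> assms(2,3)] by simp

lemma value_fun_bounds:
  assumes rb: "rb \<in> borel_measurable S" "\<And>s. s \<in> space S \<Longrightarrow> 0 \<le> rb s \<and> rb s \<le> 1"
  shows "value_fun \<kappa> rb n \<in> borel_measurable S \<and> (\<forall>s\<in>space S. 0 \<le> value_fun \<kappa> rb n s \<and> value_fun \<kappa> rb n s \<le> real (Suc n))"
proof (induction n)
  case 0 then show ?case using rb by auto
next
  case (Suc n)
  then have m[measurable]: "value_fun \<kappa> rb n \<in> borel_measurable S"
    and b: "\<And>s. s \<in> space S \<Longrightarrow> \<bar>value_fun \<kappa> rb n s\<bar> \<le> real (Suc n)"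
      "\<And>s. s \<in> space S \<Longrightarrow> 0 \<le> value_fun \<kappa> rb n s" "\<And>s. s \<in> space S \<Longrightarrow> value_fun \<kappa> rb n s \<le> real (Suc n)"
    by auto
  note [measurable] = rb(1) integral_kernel_measurable1[OF m \<kappa>]
  have "0 \<le> value_fun \<kappa> rb (Suc n) s \<and> value_fun \<kappa> rb (Suc n) s \<le> real (Suc (Suc n))" if s: "s \<in> space S" for s
    using integral_prob_ge[OF kernelD[OF \<kappa> s] m b(1) b(2)]
      integral_prob_le[OF kernelD[OF \<kappa> s] m b(1) b(3)] rb(2)[OF s]
    by simp
  then show ?case by simp
qed

lemma value_fun_measurable:
  assumes "rb \<in> borel_measurable S" "\<And>s. s \<in> space S \<Longrightarrow> 0 \<le> rb s \<and> rb s \<le> 1"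
  shows "value_fun \<kappa> rb n \<in> borel_measurable S"
  using value_fun_bounds[of rb n] assms by blast

lemma value_fun_range:
  assumes "rb \<in> borel_measurable S" "\<And>s. s \<in> space S \<Longrightarrow> 0 \<le> rb s \<and> rb s \<le> 1" "s \<in> space S"
  shows "0 \<le> value_fun \<kappa> rb n s" "value_fun \<kappa> rb n s \<le> real (Suc n)" "\<bar>value_fun \<kappa> rb n s\<bar> \<le> real (Suc n)"
  using value_fun_bounds[of rb n] assms by auto

text \<open>Peeling off the first step moves the start to the law after one step, so the induction
  is over all initial distributions \<open>xi\<close>.\<close>

lemma sum_kchain_eq_vf:
  assumes rb: "rb \<in> borel_measurable S" "\<And>s. s \<in> space S \<Longrightarrow> 0 \<le> rb s \<and> rb s \<le> 1"
    and xi: "xi \<in> space (prob_algebra S)"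
  shows "(\<Sum>j\<le>n. integral\<^sup>L (kchain \<kappa> xi j) rb) = integral\<^sup>L xi (value_fun \<kappa> rb n)"
  using xi
proof (induction n arbitrary: xi)
  case 0 then show ?case by simp
next
  case (Suc n)
  note m = value_fun_measurable[OF rb, of n]
  have "(\<Sum>j\<le>Suc n. integral\<^sup>L (kchain \<kappa> xi j) rb)
      = integral\<^sup>L xi rb + (\<Sum>j\<le>n. integral\<^sup>L (kchain \<kappa> xi (Suc j)) rb)"
    by (subst sum.atMost_Suc_shift) simp
  also have "\<dots> = integral\<^sup>L xi rb + integral\<^sup>L (xi \<bind> \<kappa>) (value_fun \<kappa> rb n)"
    using Suc.IH[OF bind_kernel_space[OF Suc.prems \<kappa>]] by (simp only: kchain_Suc_shift)
  also have "\<dots> = integral\<^sup>L xi rb + (\<integral>s. integral\<^sup>L (\<kappa> s) (value_fun \<kappa> rb n) \<partial>xi)"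
    by (subst integral_bind_kernel[OF Suc.prems \<kappa> m value_fun_range(3)[OF rb]]) auto
  also have "\<dots> = integral\<^sup>L xi (value_fun \<kappa> rb (Suc n))"
    using integrable_prob_bounded[OF Suc.prems rb(1), of 1] rb(2)
      integrable_prob_bounded[OF Suc.prems integral_kernel_measurable1[OF m \<kappa>]
        integral_prob_abs_le[OF kernelD[OF \<kappa>] m value_fun_range(3)[OF rb]]]
    by (subst Bochner_Integration.integral_add[symmetric]) auto
  finally show ?case .
qed

end

context
  fixes S :: "'s measure" and \<kappa> \<kappa>' :: "'s \<Rightarrow> 's measure"
  assumes \<kappa>: "\<kappa> \<in> S \<rightarrow>\<^sub>M prob_algebra S" and \<kappa>': "\<kappa>' \<in> S \<rightarrow>\<^sub>M prob_algebra S"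
begin

text \<open>Telescoping over hybrids that follow the new kernel up to some time and the old one
  afterwards. Neighbouring hybrids differ in a single transition, so each term weighs the one-step
  discrepancy by the value function of the old kernel and averages over the state law of the new
  one.\<close>

lemma performance_difference:
  assumes rb: "rb \<in> borel_measurable S" "\<And>s. s \<in> space S \<Longrightarrow> 0 \<le> rb s \<and> rb s \<le> 1"
    and xi: "xi \<in> space (prob_algebra S)"
  shows "(\<Sum>j\<le>n. integral\<^sup>L (kchain \<kappa>' xi j) rb) - (\<Sum>j\<le>n. integral\<^sup>L (kchain \<kappa> xi j) rb)
    = (\<Sum>h<n. \<integral>s. (integral\<^sup>L (\<kappa>' s) (value_fun \<kappa> rb (n - Suc h)) - integral\<^sup>L (\<kappa> s) (value_fun \<kappa> rb (n - Suc h)))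
        \<partial>kchain \<kappa>' xi h)"
  using xi
proof (induction n arbitrary: xi)
  case 0 then show ?case by simp
next
  case (Suc n)
  note m = value_fun_measurable[OF \<kappa> rb, of n] and b = value_fun_range(3)[OF \<kappa> rb, of _ n]
  define G where "G n s = integral\<^sup>L (\<kappa>' s) (value_fun \<kappa> rb n) - integral\<^sup>L (\<kappa> s) (value_fun \<kappa> rb n)" for n s
  have xi': "xi \<bind> \<kappa>' \<in> space (prob_algebra S)" by (rule bind_kernel_space[OF Suc.prems \<kappa>'])
  have "(\<Sum>j\<le>Suc n. integral\<^sup>L (kchain \<kappa>' xi j) rb)
      = integral\<^sup>L xi rb + (\<Sum>j\<le>n. integral\<^sup>L (kchain \<kappa>' (xi \<bind> \<kappa>') j) rb)"
    by (subst sum.atMost_Suc_shift) (simp add: kchain_Suc_shift del: kchain.simps(2))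
  \<comment> \<open>The induction hypothesis compares both kernels from the same start, the law
    after one new step; the value function then rewrites the part that follows the old
    kernel.\<close>
  also have "(\<Sum>j\<le>n. integral\<^sup>L (kchain \<kappa>' (xi \<bind> \<kappa>') j) rb)
      = integral\<^sup>L (xi \<bind> \<kappa>') (value_fun \<kappa> rb n) + (\<Sum>h<n. \<integral>s. G (n - Suc h) s \<partial>kchain \<kappa>' (xi \<bind> \<kappa>') h)"
    using Suc.IH[OF xi'] sum_kchain_eq_vf[OF \<kappa> rb xi', of n] unfolding G_def by simp
  also have "integral\<^sup>L (xi \<bind> \<kappa>') (value_fun \<kappa> rb n) = (\<integral>s. integral\<^sup>L (\<kappa>' s) (value_fun \<kappa> rb n) \<partial>xi)"
    by (rule integral_bind_kernel[OF Suc.prems \<kappa>' m b])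
  finally have 1: "(\<Sum>j\<le>Suc n. integral\<^sup>L (kchain \<kappa>' xi j) rb)
      = integral\<^sup>L xi rb + ((\<integral>s. integral\<^sup>L (\<kappa>' s) (value_fun \<kappa> rb n) \<partial>xi)
        + (\<Sum>h<n. \<integral>s. G (n - Suc h) s \<partial>kchain \<kappa>' (xi \<bind> \<kappa>') h))" .
  have i: "integrable xi (\<lambda>s. integral\<^sup>L (\<kappa> s) (value_fun \<kappa> rb n))" "integrable xi (\<lambda>s. integral\<^sup>L (\<kappa>' s) (value_fun \<kappa> rb n))"
    "integrable xi rb"
    using integrable_prob_bounded[OF Suc.prems integral_kernel_measurable1[OF m \<kappa>]
        integral_prob_abs_le[OF kernelD[OF \<kappa>] m b]]
     integrable_prob_bounded[OF Suc.prems integral_kernel_measurable1[OF m \<kappa>']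
        integral_prob_abs_le[OF kernelD[OF \<kappa>'] m b]]
     integrable_prob_bounded[OF Suc.prems rb(1), of 1] rb(2)
    by auto
  have 2: "(\<Sum>j\<le>Suc n. integral\<^sup>L (kchain \<kappa> xi j) rb)
      = integral\<^sup>L xi rb + (\<integral>s. integral\<^sup>L (\<kappa> s) (value_fun \<kappa> rb n) \<partial>xi)"
    using sum_kchain_eq_vf[OF \<kappa> rb Suc.prems, of "Suc n"] i by (simp del: kchain.simps sum.atMost_Suc)
  have 3: "(\<integral>s. integral\<^sup>L (\<kappa>' s) (value_fun \<kappa> rb n) \<partial>xi) - (\<integral>s. integral\<^sup>L (\<kappa> s) (value_fun \<kappa> rb n) \<partial>xi)
      = (\<integral>s. G n s \<partial>xi)"
    unfolding G_def using i by simp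
  have "(\<Sum>h<Suc n. \<integral>s. G (Suc n - Suc h) s \<partial>kchain \<kappa>' xi h)
     = (\<integral>s. G n s \<partial>xi) + (\<Sum>h<n. \<integral>s. G (n - Suc h) s \<partial>kchain \<kappa>' (xi \<bind> \<kappa>') h)"
    by (subst sum.lessThan_Suc_shift) (simp add: kchain_Suc_shift del: kchain.simps(2))
  then show ?case using 1 2 3 unfolding G_def by linarith
qed

text \<open>One transition is exchanged at a time at cost \<open>\<delta>\<close>. The induction
  runs over the test function: averaging \<open>F\<close> over one step of the old kernel gives a
  function that again has range in [0, B], so \<open>close\<close> stays applicable.\<close>

lemma kchain_perturbation:
  fixes F :: "'s \<Rightarrow> real"
  assumes close: "\<And>G s. G \<in> borel_measurable S \<Longrightarrow> (\<And>t. t \<in> space S \<Longrightarrow> 0 \<le> G t \<and> G t \<le> B) \<Longrightarrow>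
      s \<in> space S \<Longrightarrow> \<bar>integral\<^sup>L (\<kappa>' s) G - integral\<^sup>L (\<kappa> s) G\<bar> \<le> \<delta>"
    and xi: "xi \<in> space (prob_algebra S)"
    and F: "F \<in> borel_measurable S" "\<And>t. t \<in> space S \<Longrightarrow> 0 \<le> F t \<and> F t \<le> B"
  shows "\<bar>integral\<^sup>L (kchain \<kappa>' xi n) F - integral\<^sup>L (kchain \<kappa> xi n) F\<bar> \<le> real n * \<delta>"
  using F
proof (induction n arbitrary: F)
  case 0 then show ?case by simp
next
  case (Suc n)
  have b: "\<bar>F s\<bar> \<le> B" if "s \<in> space S" for s using Suc.prems(2)[OF that] by auto
  note m = integral_kernel_measurable1[OF Suc.prems(1) \<kappa>] integral_kernel_measurable1[OF Suc.prems(1) \<kappa>']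
  note bb = integral_prob_abs_le[OF kernelD[OF \<kappa>] Suc.prems(1) b] integral_prob_abs_le[OF kernelD[OF \<kappa>'] Suc.prems(1) b]
  note kp = kchain_prob[OF \<kappa>' xi, of n]
  note i = integrable_prob_bounded[OF kp m(1) bb(1)] integrable_prob_bounded[OF kp m(2) bb(2)]
  have "\<bar>(\<integral>s. integral\<^sup>L (\<kappa>' s) F \<partial>kchain \<kappa>' xi n) - (\<integral>s. integral\<^sup>L (\<kappa> s) F \<partial>kchain \<kappa>' xi n)\<bar> \<le> \<delta>"
    using close[OF Suc.prems] m integral_prob_abs_le[OF kp, of "\<lambda>s. integral\<^sup>L (\<kappa>' s) F - integral\<^sup>L (\<kappa> s) F" \<delta>]
    using Bochner_Integration.integral_diff[OF i(2) i(1)] by auto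
  moreover have "\<bar>(\<integral>s. integral\<^sup>L (\<kappa> s) F \<partial>kchain \<kappa>' xi n) - (\<integral>s. integral\<^sup>L (\<kappa> s) F \<partial>kchain \<kappa> xi n)\<bar> \<le> real n * \<delta>"
    using Suc.prems(2) integral_prob_ge[OF kernelD[OF \<kappa>] Suc.prems(1) b, of _ 0]
      integral_prob_le[OF kernelD[OF \<kappa>] Suc.prems(1) b, of _ B]
    by (intro Suc.IH[OF m(1)]) auto
  ultimately show ?case
    using integral_kchain_Suc[OF \<kappa>' xi Suc.prems(1) b] integral_kchain_Suc[OF \<kappa> xi Suc.prems(1) b]
    by (simp add: algebra_simps del: kchain.simps)
qed

text \<open>Multiplicative comparison of state laws, used in both directions: the perturbed chain
  keeps a share 1 - e of the original one per step (for the denominator of the ratio), and the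
  original behavior chain keeps a share 1 / (1 + 2 e / c) of the perturbed one (for the likelihood
  ratio).\<close>

lemma nn_integral_kchain_mono:
  assumes dom: "\<And>G s. G \<in> borel_measurable S \<Longrightarrow> s \<in> space S \<Longrightarrow> C * integral\<^sup>N (\<kappa> s) G \<le> integral\<^sup>N (\<kappa>' s) G"
    and xi: "xi \<in> space (prob_algebra S)" and F: "F \<in> borel_measurable S"
  shows "C ^ n * integral\<^sup>N (kchain \<kappa> xi n) F \<le> integral\<^sup>N (kchain \<kappa>' xi n) F"
  using F
proof (induction n arbitrary: F)
  case 0 then show ?case by simp
next
  case (Suc n)
  note m = nn_integral_kernel_measurable1[OF Suc.prems(1) \<kappa>]
  note kp = kchain_prob[OF \<kappa>' xi, of n]
  have "C ^ Suc n * integral\<^sup>N (kchain \<kappa> xi (Suc n)) F = C * (C ^ n * (\<integral>\<^sup>+s. integral\<^sup>N (\<kappa> s) F \<partial>kchain \<kappa> xi n))"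
    unfolding nn_integral_kchain_Suc[OF \<kappa> xi Suc.prems] by (simp add: mult_ac)
  also have "\<dots> \<le> C * (\<integral>\<^sup>+s. integral\<^sup>N (\<kappa> s) F \<partial>kchain \<kappa>' xi n)"
    by (intro mult_left_mono Suc.IH m) auto
  also have "\<dots> = (\<integral>\<^sup>+s. C * integral\<^sup>N (\<kappa> s) F \<partial>kchain \<kappa>' xi n)"
    using m prob_algebraD[OF kp] by (subst nn_integral_cmult) auto
  also have "\<dots> \<le> (\<integral>\<^sup>+s. integral\<^sup>N (\<kappa>' s) F \<partial>kchain \<kappa>' xi n)"
    using prob_algebraD[OF kp] by (intro nn_integral_mono dom Suc.prems) auto
  finally show ?case unfolding nn_integral_kchain_Suc[OF \<kappa>' xi Suc.prems] .
qed

end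

section \<open>Second moments of product measures and Cauchy-Schwarz for semidefinite forms\<close>

text \<open>\<open>dom\<close> is the dual form of the statement that the density dP/dQ has second
  moment at most \<open>M\<close> under \<open>Q\<close>, and in this form no density on the product
  is required. It must cover functions and not just events, because integrating out one coordinate
  of an indicator leaves a general function.\<close>

lemma PiM_second_moment_bound:
  fixes P Q :: "'a measure" and M :: ennreal
  assumes P: "prob_space P" and Q: "prob_space Q" and sets[measurable_cong]: "sets P = sets Q"
    and dom: "\<And>g. g \<in> borel_measurable Q \<Longrightarrow> (integral\<^sup>N P g)\<^sup>2 \<le> M * (\<integral>\<^sup>+x. (g x)\<^sup>2 \<partial>Q)"
    and g: "g \<in> borel_measurable (PiM {..<K::nat} (\<lambda>_. Q))"
  shows "(integral\<^sup>N (PiM {..<K} (\<lambda>_. P)) g)\<^sup>2 \<le> M ^ K * (\<integral>\<^sup>+x. (g x)\<^sup>2 \<partial>PiM {..<K} (\<lambda>_. Q))"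
  using g
proof (induction K arbitrary: g)
  case 0
  then show ?case by (simp add: PiM_empty nn_integral_count_space_finite)
next
  case (Suc K)
  interpret P: prob_space P by fact
  interpret Q: prob_space Q by fact
  interpret PP: product_sigma_finite "\<lambda>_::nat. P"
    by (simp add: product_sigma_finite_def P.sigma_finite_measure_axioms)
  interpret QQ: product_sigma_finite "\<lambda>_::nat. Q"
    by (simp add: product_sigma_finite_def Q.sigma_finite_measure_axioms)
  have gQ[measurable]: "g \<in> borel_measurable (PiM (insert K {..<K}) (\<lambda>_. Q))"
    using Suc.prems by (simp add: lessThan_Suc)
  have setsPi[measurable_cong]: "sets (PiM I (\<lambda>_::nat. P)) = sets (PiM I (\<lambda>_. Q))" for I
    by (rule sets_PiM_cong) (auto simp: sets)
  have gP[measurable]: "g \<in> borel_measurable (PiM (insert K {..<K}) (\<lambda>_. P))"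
    using gQ by (simp cong: measurable_cong_sets)
  \<comment> \<open>The last coordinate is integrated out under \<open>P\<close>. The induction
    hypothesis handles \<open>G\<close> on the remaining coordinates, and \<open>dom\<close> bounds
    the square of the inner integral pointwise.\<close>
  define G where "G x = (\<integral>\<^sup>+y. g (x(K := y)) \<partial>P)" for x
  have upd[measurable]: "(\<lambda>(x, y). g (x(K := y))) \<in> borel_measurable (PiM {..<K} (\<lambda>_. Q) \<Otimes>\<^sub>M Q)"
    by measurable
  have G: "G \<in> borel_measurable (PiM {..<K} (\<lambda>_. Q))"
    unfolding G_def using upd by (intro P.borel_measurable_nn_integral) simp
  have "(integral\<^sup>N (PiM {..<Suc K} (\<lambda>_. P)) g)\<^sup>2 = (\<integral>\<^sup>+x. G x \<partial>PiM {..<K} (\<lambda>_. P))\<^sup>2"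
    unfolding lessThan_Suc G_def by (subst PP.product_nn_integral_insert) (auto simp: gP)
  also have "\<dots> \<le> M ^ K * (\<integral>\<^sup>+x. (G x)\<^sup>2 \<partial>PiM {..<K} (\<lambda>_. Q))"
    by (rule Suc.IH[OF G])
  also have "\<dots> \<le> M ^ K * (\<integral>\<^sup>+x. M * (\<integral>\<^sup>+y. (g (x(K := y)))\<^sup>2 \<partial>Q) \<partial>PiM {..<K} (\<lambda>_. Q))"
    unfolding G_def by (intro mult_left_mono nn_integral_mono dom) auto
  also have "\<dots> = M ^ Suc K * (\<integral>\<^sup>+x. (\<integral>\<^sup>+y. (g (x(K := y)))\<^sup>2 \<partial>Q) \<partial>PiM {..<K} (\<lambda>_. Q))"
    by (subst nn_integral_cmult) (auto simp: mult_ac)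
  also have "(\<integral>\<^sup>+x. (\<integral>\<^sup>+y. (g (x(K := y)))\<^sup>2 \<partial>Q) \<partial>PiM {..<K} (\<lambda>_. Q))
      = (\<integral>\<^sup>+x. (g x)\<^sup>2 \<partial>PiM {..<Suc K} (\<lambda>_. Q))"
    unfolding lessThan_Suc by (subst QQ.product_nn_integral_insert) auto
  finally show ?case .
qed

text \<open>Nonnegativity of the form at x - t y is a quadratic inequality in t. Since the form is
  only semidefinite at this stage, the leading coefficient \<open>c\<close> may vanish and gets its
  own case.\<close>

lemma psd_cauchy_schwarz:
  fixes M :: "real^'n^'n"
  assumes sym: "\<And>x y. x \<bullet> (M *v y) = y \<bullet> (M *v x)" and psd: "\<And>x. 0 \<le> x \<bullet> (M *v x)"
  shows "(x \<bullet> (M *v y))\<^sup>2 \<le> (x \<bullet> (M *v x)) * (y \<bullet> (M *v y))"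
proof -
  define a b c where abc: "a = x \<bullet> (M *v x)" "b = x \<bullet> (M *v y)" "c = y \<bullet> (M *v y)"
  have q: "0 \<le> a - 2 * t * b + t\<^sup>2 * c" for t
    using psd[of "x - t *\<^sub>R y"] sym[of y x] unfolding abc
    by (simp add: matrix_vector_mult_diff_distrib matrix_vector_mult_scaleR inner_diff_left inner_diff_right
        algebra_simps power2_eq_square)
  have a0: "0 \<le> a" "0 \<le> c" using psd unfolding abc by auto
  have "b\<^sup>2 \<le> a * c"
  proof (cases "c = 0")
    case True
    have "b = 0"
    proof (rule ccontr)
      assume b: "b \<noteq> 0"
      \<comment> \<open>With \<open>c = 0\<close> the inequality is affine in t, and this t makes it
        equal to -1.\<close>
      have "0 \<le> a - 2 * ((a + 1) / (2 * b)) * b" using q[of "(a + 1) / (2 * b)"] True by simp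
      also have "\<dots> = - 1" using b by (simp add: field_simps)
      finally show False by simp
    qed
    then show ?thesis using True by simp
  next
    case False
    then have c: "0 < c" using a0 by simp
    \<comment> \<open>t = b / c minimises the quadratic.\<close>
    have "0 \<le> c * (a - 2 * (b / c) * b + (b / c)\<^sup>2 * c)" using q[of "b/c"] c by (simp add: mult_nonneg_nonneg)
    also have "\<dots> = a * c - b\<^sup>2" using c by (simp add: field_simps power2_eq_square)
    finally show ?thesis by simp
  qed
  then show ?thesis unfolding abc .
qed

section \<open>One-step kernels of a policy\<close>

definition pstep :: "('s \<times> 'a \<Rightarrow> 's measure) \<Rightarrow> ('s \<Rightarrow> 'a measure) \<Rightarrow> 's \<Rightarrow> 's measure" where
  "pstep p pol s = pol s \<bind> (\<lambda>a. p (s, a))"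

lemma sdist_eq_kchain: "sdist S A p pol xi n = kchain (pstep p pol) xi n"
  by (induction n) (simp_all add: pstep_def[abs_def])

context
  fixes S :: "'s measure" and A :: "'a measure" and pol :: "'s \<Rightarrow> 'a measure"
  assumes pol: "pol \<in> S \<rightarrow>\<^sub>M prob_algebra A"
begin

lemma fixed_state_kernel:
  assumes "p \<in> S \<Otimes>\<^sub>M A \<rightarrow>\<^sub>M N" "s \<in> space S"
  shows "(\<lambda>a. p (s, a)) \<in> A \<rightarrow>\<^sub>M N"
  by (rule measurable_compose[OF _ assms(1)]) (use assms(2) in measurable)

lemma pstep_kernel:
  assumes [measurable]: "p \<in> S \<Otimes>\<^sub>M A \<rightarrow>\<^sub>M prob_algebra S"
  shows "pstep p pol \<in> S \<rightarrow>\<^sub>M prob_algebra S"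
  unfolding pstep_def[abs_def] by (rule measurable_bind_prob_space2[OF pol]) measurable

lemma integral_pstep:
  fixes F :: "'s \<Rightarrow> real"
  assumes "p \<in> S \<Otimes>\<^sub>M A \<rightarrow>\<^sub>M prob_algebra S" "s \<in> space S"
    "F \<in> borel_measurable S" "\<And>x. x \<in> space S \<Longrightarrow> \<bar>F x\<bar> \<le> B"
  shows "integral\<^sup>L (pstep p pol s) F = (\<integral>a. integral\<^sup>L (p (s, a)) F \<partial>pol s)"
  unfolding pstep_def
  by (rule integral_bind_kernel[OF kernelD[OF pol assms(2)] fixed_state_kernel[OF assms(1,2)] assms(3,4)])

lemma nn_integral_pstep:
  assumes "p \<in> S \<Otimes>\<^sub>M A \<rightarrow>\<^sub>M prob_algebra S" "s \<in> space S" "F \<in> borel_measurable S"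
  shows "integral\<^sup>N (pstep p pol s) F = (\<integral>\<^sup>+a. integral\<^sup>N (p (s, a)) F \<partial>pol s)"
  unfolding pstep_def
  by (rule nn_integral_bind_kernel[OF kernelD[OF pol assms(2)] fixed_state_kernel[OF assms(1,2)] assms(3)])

lemma graph_kernel: "(\<lambda>s. distr (pol s) (S \<Otimes>\<^sub>M A) (\<lambda>a. (s, a))) \<in> S \<rightarrow>\<^sub>M prob_algebra (S \<Otimes>\<^sub>M A)"
  by (rule measurable_distr_prob_space2[OF pol]) measurable

lemma pair_measurable_pol:
  assumes "s \<in> space S"
  shows "(\<lambda>a. (s, a)) \<in> pol s \<rightarrow>\<^sub>M S \<Otimes>\<^sub>M A"
proof -
  have "(\<lambda>a. (s, a)) \<in> A \<rightarrow>\<^sub>M S \<Otimes>\<^sub>M A" using assms by measurable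
  then show ?thesis using prob_algebraD(2)[OF kernelD[OF pol assms]] by (simp cong: measurable_cong_sets)
qed

context
  fixes p and xi
  assumes p: "p \<in> S \<Otimes>\<^sub>M A \<rightarrow>\<^sub>M prob_algebra S" and xi: "xi \<in> space (prob_algebra S)"
begin

lemma sdist_prob: "sdist S A p pol xi h \<in> space (prob_algebra S)"
  unfolding sdist_eq_kchain by (rule kchain_prob[OF pstep_kernel[OF p] xi])

lemma sadist_prob: "sadist S A p pol xi h \<in> space (prob_algebra (S \<Otimes>\<^sub>M A))"
  unfolding sadist_def by (rule bind_kernel_space[OF sdist_prob graph_kernel])

lemma integral_sadist:
  fixes f :: "'s \<times> 'a \<Rightarrow> real"
  assumes f: "f \<in> borel_measurable (S \<Otimes>\<^sub>M A)" "\<And>x. x \<in> space (S \<Otimes>\<^sub>M A) \<Longrightarrow> \<bar>f x\<bar> \<le> B"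
  shows "integral\<^sup>L (sadist S A p pol xi h) f = (\<integral>s. (\<integral>a. f (s, a) \<partial>pol s) \<partial>sdist S A p pol xi h)"
  unfolding sadist_def integral_bind_kernel[OF sdist_prob graph_kernel assms, simplified]
  using prob_algebraD[OF sdist_prob]
  by (intro Bochner_Integration.integral_cong refl) (simp add: integral_distr[OF pair_measurable_pol f(1)])

lemma nn_integral_sadist:
  assumes f: "f \<in> borel_measurable (S \<Otimes>\<^sub>M A)"
  shows "integral\<^sup>N (sadist S A p pol xi h) f = (\<integral>\<^sup>+s. (\<integral>\<^sup>+a. f (s, a) \<partial>pol s) \<partial>sdist S A p pol xi h)"
  unfolding sadist_def nn_integral_bind_kernel[OF sdist_prob graph_kernel assms]
  using prob_algebraD[OF sdist_prob]
  by (intro nn_integral_cong) (simp add: nn_integral_distr[OF pair_measurable_pol] f)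

end
end

section \<open>Likelihood ratios of episodes\<close>

text \<open>Only transitions enter: the two instances share the initial distribution, the behavior
  actions and the reward kernel, so those factors cancel. The \<open>if\<close> reflects the layout
  of an episode, where the final state is stored outside the records.\<close>

definition episode_lik :: "('s \<Rightarrow> 's \<Rightarrow> ennreal) \<Rightarrow> nat \<Rightarrow> (nat \<Rightarrow> 's \<times> 'a \<times> real) \<times> 's \<Rightarrow> ennreal" where
  "episode_lik l n \<omega> =
     (\<Prod>h<n. l (fst (fst \<omega> h)) (if Suc h = n then snd \<omega> else fst (fst \<omega> (Suc h))))"

text \<open>After the extension the old last state is read from record \<open>n\<close> and no
  longer from the second component; its value is the same, so the old factors do not change.\<close>

lemma episode_lik_Suc:
  "episode_lik l (Suc n) (\<tau>(n := (s, a, r)), s') = episode_lik l n (\<tau>, s) * l s s'"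
proof -
  have "(\<Prod>h<n. l (fst ((\<tau>(n := (s, a, r))) h))
           (if Suc h = Suc n then s' else fst ((\<tau>(n := (s, a, r))) (Suc h))))
      = episode_lik l n (\<tau>, s)"
    unfolding episode_lik_def by (intro prod.cong) auto
  then show ?thesis by (simp add: episode_lik_def)
qed

lemma episode_lik_measurable:
  assumes [measurable]: "case_prod l \<in> borel_measurable (S \<Otimes>\<^sub>M S)"
  shows "episode_lik l n \<in> borel_measurable (episode_space S A n)"
proof -
  have c: "(\<lambda>\<omega>. fst (fst \<omega> h)) \<in> episode_space S A n \<rightarrow>\<^sub>M S" if "h < n" for h
  proof -
    have [measurable]: "(\<lambda>\<omega>. fst \<omega> h) \<in> PiM {..<n} (\<lambda>_. rec_space S A) \<Otimes>\<^sub>M S \<rightarrow>\<^sub>M S \<Otimes>\<^sub>M (A \<Otimes>\<^sub>M borel)"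
      using that measurable_component_singleton[of h "{..<n}" "\<lambda>_. rec_space S A"]
      unfolding rec_space_def by (intro measurable_compose[OF measurable_fst]) auto
    show ?thesis unfolding episode_space_def by measurable
  qed
  have d: "(\<lambda>\<omega>. if Suc h = n then snd \<omega> else fst (fst \<omega> (Suc h))) \<in> episode_space S A n \<rightarrow>\<^sub>M S" if "h < n" for h
  proof (cases "Suc h = n")
    case True
    then show ?thesis by (simp add: episode_space_def)
  next
    case False
    then show ?thesis using c[of "Suc h"] that by simp
  qed
  have "(\<lambda>\<omega>. case_prod l (fst (fst \<omega> h), if Suc h = n then snd \<omega> else fst (fst \<omega> (Suc h))))
      \<in> borel_measurable (episode_space S A n)" if "h < n" for h
    using measurable_compose[OF measurable_Pair[OF c d] assms, OF that that] .
  then show ?thesis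
    unfolding episode_lik_def[abs_def] by (intro borel_measurable_prod_ennreal) auto
qed

context
  fixes S :: "'s measure" and A :: "'a measure" and pb :: "'s \<Rightarrow> 'a"
  assumes pb: "pb \<in> S \<rightarrow>\<^sub>M A"
begin

lemma behavior_kernel: "(\<lambda>s. return A (pb s)) \<in> S \<rightarrow>\<^sub>M prob_algebra A"
  by (rule measurable_compose[OF pb measurable_return_prob_space])

lemma behavior_in_space: "s \<in> space S \<Longrightarrow> (s, pb s) \<in> space (S \<Otimes>\<^sub>M A)"
  using measurable_space[OF pb] by (simp add: space_pair_measure)

lemma pstep_behavior:
  assumes "p \<in> S \<Otimes>\<^sub>M A \<rightarrow>\<^sub>M prob_algebra S" "s \<in> space S"
  shows "pstep p (\<lambda>s. return A (pb s)) s = p (s, pb s)"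
  unfolding pstep_def
  using fixed_state_kernel[OF behavior_kernel measurable_prob_algebraD[OF assms(1)] assms(2)]
    measurable_space[OF pb assms(2)]
  by (rule bind_return)

end

context
  fixes S :: "'s measure" and A :: "'a measure" and R :: "'s \<times> 'a \<Rightarrow> real measure"
    and pb :: "'s \<Rightarrow> 'a" and xi :: "'s measure"
  assumes R[measurable]: "R \<in> S \<Otimes>\<^sub>M A \<rightarrow>\<^sub>M prob_algebra borel" and pb[measurable]: "pb \<in> S \<rightarrow>\<^sub>M A"
    and xi: "xi \<in> space (prob_algebra S)"
begin

lemma episode_extend_measurable:
  "(\<lambda>(x, s'). ((fst (fst x))(n := (snd (fst x), pb (snd (fst x)), snd x)), s'))
    \<in> (episode_space S A n \<Otimes>\<^sub>M borel) \<Otimes>\<^sub>M S \<rightarrow>\<^sub>M episode_space S A (Suc n)"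
proof -
  have "(\<lambda>z. (fst (fst (fst z)))(n := (snd (fst (fst z)), pb (snd (fst (fst z))), snd (fst z))))
     \<in> ((PiM {..<n} (\<lambda>_. rec_space S A) \<Otimes>\<^sub>M S) \<Otimes>\<^sub>M borel) \<Otimes>\<^sub>M S \<rightarrow>\<^sub>M PiM {..<Suc n} (\<lambda>_. rec_space S A)"
    by (rule measurable_fun_upd[where J="{..<n}"]) (auto simp: rec_space_def)
  then show ?thesis
    unfolding episode_space_def split_beta by (intro measurable_Pair) auto
qed

context
  fixes p assumes p[measurable]: "p \<in> S \<Otimes>\<^sub>M A \<rightarrow>\<^sub>M prob_algebra S"
begin

lemma last_state_kernel:
  "(\<lambda>x. p (snd (fst x), pb (snd (fst x)))) \<in> episode_space S A n \<Otimes>\<^sub>M borel \<rightarrow>\<^sub>M prob_algebra S"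
  unfolding episode_space_def by measurable

lemma episode_extend_kernel:
  "(\<lambda>x. distr (p (snd (fst x), pb (snd (fst x)))) (episode_space S A (Suc n))
         (\<lambda>s'. ((fst (fst x))(n := (snd (fst x), pb (snd (fst x)), snd x)), s')))
   \<in> episode_space S A n \<Otimes>\<^sub>M borel \<rightarrow>\<^sub>M prob_algebra (episode_space S A (Suc n))"
  by (rule measurable_distr_prob_space2[OF last_state_kernel episode_extend_measurable])

lemma episode_step_kernel:
  "(\<lambda>(\<tau>, s). bind (R (s, pb s)) (\<lambda>r. distr (p (s, pb s)) (episode_space S A (Suc n)) (\<lambda>s'. (\<tau>(n := (s, pb s, r)), s'))))
   \<in> episode_space S A n \<rightarrow>\<^sub>M prob_algebra (episode_space S A (Suc n))"
proof -
  have "(\<lambda>x. R (snd x, pb (snd x))) \<in> episode_space S A n \<rightarrow>\<^sub>M prob_algebra borel"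
    unfolding episode_space_def by measurable
  then show ?thesis
    unfolding split_beta
    by (rule measurable_bind_prob_space2) (use episode_extend_kernel[of n] in \<open>simp add: split_beta\<close>)
qed

lemma episode_prob: "episode S A p R pb xi n \<in> space (prob_algebra (episode_space S A n))"
proof (induction n)
  case 0
  have "(\<lambda>s. ((\<lambda>_. undefined), s)) \<in> S \<rightarrow>\<^sub>M episode_space S A 0"
    unfolding episode_space_def by (intro measurable_Pair) (auto intro!: measurable_const simp: space_PiM)
  then show ?case
    using measurable_space[OF measurable_distr_prob_space xi] by simp
next
  case (Suc n)
  then show ?case by (simp add: bind_kernel_space[OF _ episode_step_kernel])
qed

lemma nn_integral_episode_0:
  assumes "g \<in> borel_measurable (episode_space S A 0)"
  shows "integral\<^sup>N (episode S A p R pb xi 0) g = (\<integral>\<^sup>+s. g ((\<lambda>_. undefined), s) \<partial>xi)"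
proof -
  have "(\<lambda>s. ((\<lambda>_. undefined), s)) \<in> S \<rightarrow>\<^sub>M episode_space S A 0"
    unfolding episode_space_def by (intro measurable_Pair) (auto intro!: measurable_const simp: space_PiM)
  then have "(\<lambda>s. ((\<lambda>_. undefined), s)) \<in> xi \<rightarrow>\<^sub>M episode_space S A 0"
    using prob_algebraD(2)[OF xi] by (simp cong: measurable_cong_sets)
  then show ?thesis using assms by (simp add: nn_integral_distr)
qed

lemma nn_integral_episode_Suc:
  assumes g: "g \<in> borel_measurable (episode_space S A (Suc n))"
  shows "integral\<^sup>N (episode S A p R pb xi (Suc n)) g =
    (\<integral>\<^sup>+\<omega>. (\<integral>\<^sup>+r. (\<integral>\<^sup>+s'. g ((fst \<omega>)(n := (snd \<omega>, pb (snd \<omega>), r)), s') \<partial>p (snd \<omega>, pb (snd \<omega>)))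
        \<partial>R (snd \<omega>, pb (snd \<omega>))) \<partial>episode S A p R pb xi n)"
proof -
  have "integral\<^sup>N (episode S A p R pb xi (Suc n)) g =
    (\<integral>\<^sup>+\<omega>. integral\<^sup>N (bind (R (snd \<omega>, pb (snd \<omega>))) (\<lambda>r. distr (p (snd \<omega>, pb (snd \<omega>))) (episode_space S A (Suc n))
       (\<lambda>s'. ((fst \<omega>)(n := (snd \<omega>, pb (snd \<omega>), r)), s')))) g \<partial>episode S A p R pb xi n)"
    by (simp add: nn_integral_bind_kernel[OF episode_prob episode_step_kernel g] split_beta)
  also have "\<dots> = (\<integral>\<^sup>+\<omega>. (\<integral>\<^sup>+r. (\<integral>\<^sup>+s'. g ((fst \<omega>)(n := (snd \<omega>, pb (snd \<omega>), r)), s') \<partial>p (snd \<omega>, pb (snd \<omega>)))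
        \<partial>R (snd \<omega>, pb (snd \<omega>))) \<partial>episode S A p R pb xi n)"
  proof (rule nn_integral_cong)
    fix \<omega> assume "\<omega> \<in> space (episode S A p R pb xi n)"
    then have w: "\<omega> \<in> space (episode_space S A n)" using prob_algebraD[OF episode_prob] by simp
    then have s: "snd \<omega> \<in> space S" by (auto simp: episode_space_def space_pair_measure)
    have pr: "(\<lambda>r. (\<omega>, r)) \<in> borel \<rightarrow>\<^sub>M episode_space S A n \<Otimes>\<^sub>M borel" using w by measurable
    have k: "(\<lambda>r. distr (p (snd \<omega>, pb (snd \<omega>))) (episode_space S A (Suc n))
       (\<lambda>s'. ((fst \<omega>)(n := (snd \<omega>, pb (snd \<omega>), r)), s'))) \<in> borel \<rightarrow>\<^sub>M prob_algebra (episode_space S A (Suc n))"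
      using measurable_compose[OF pr episode_extend_kernel] by simp
    have e: "(\<lambda>s'. ((fst \<omega>)(n := (snd \<omega>, pb (snd \<omega>), r)), s')) \<in> p (snd \<omega>, pb (snd \<omega>)) \<rightarrow>\<^sub>M episode_space S A (Suc n)" for r
    proof -
      have "(\<lambda>s'. ((\<omega>, r), s')) \<in> S \<rightarrow>\<^sub>M (episode_space S A n \<Otimes>\<^sub>M borel) \<Otimes>\<^sub>M S"
        using w by (intro measurable_Pair) (auto simp: space_pair_measure)
      from measurable_compose[OF this episode_extend_measurable]
      show ?thesis using prob_algebraD(2)[OF kernelD[OF p behavior_in_space[OF pb s]]] by (simp cong: measurable_cong_sets)
    qed
    show "integral\<^sup>N (bind (R (snd \<omega>, pb (snd \<omega>))) (\<lambda>r. distr (p (snd \<omega>, pb (snd \<omega>))) (episode_space S A (Suc n))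
       (\<lambda>s'. ((fst \<omega>)(n := (snd \<omega>, pb (snd \<omega>), r)), s')))) g
      = (\<integral>\<^sup>+r. (\<integral>\<^sup>+s'. g ((fst \<omega>)(n := (snd \<omega>, pb (snd \<omega>), r)), s') \<partial>p (snd \<omega>, pb (snd \<omega>))) \<partial>R (snd \<omega>, pb (snd \<omega>)))"
      unfolding nn_integral_bind_kernel[OF kernelD[OF R behavior_in_space[OF pb s]] k g]
      by (simp add: nn_integral_distr[OF e] g)
  qed
  finally show ?thesis .
qed

lemma nn_integral_episode_last:
  assumes F[measurable]: "F \<in> borel_measurable S"
  shows "(\<integral>\<^sup>+\<omega>. F (snd \<omega>) \<partial>episode S A p R pb xi n)
    = integral\<^sup>N (kchain (pstep p (\<lambda>s. return A (pb s))) xi n) F"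
  using F
proof (induction n arbitrary: F)
  case 0
  have "(\<lambda>\<omega>. F (snd \<omega>)) \<in> borel_measurable (episode_space S A 0)"
    using 0 unfolding episode_space_def by measurable
  from nn_integral_episode_0[OF this] show ?case by simp
next
  case (Suc n)
  have m: "(\<lambda>\<omega>. F (snd \<omega>)) \<in> borel_measurable (episode_space S A (Suc n))"
    using Suc.prems unfolding episode_space_def by measurable
  note kb = pstep_kernel[OF behavior_kernel[OF pb] p]
  have "(\<integral>\<^sup>+\<omega>. F (snd \<omega>) \<partial>episode S A p R pb xi (Suc n))
      = (\<integral>\<^sup>+\<omega>. integral\<^sup>N (pstep p (\<lambda>s. return A (pb s)) (snd \<omega>)) F \<partial>episode S A p R pb xi n)"
    unfolding nn_integral_episode_Suc[OF m]
  proof (rule nn_integral_cong)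
    fix \<omega> assume "\<omega> \<in> space (episode S A p R pb xi n)"
    then have s: "snd \<omega> \<in> space S"
      using prob_algebraD[OF episode_prob] by (auto simp: episode_space_def space_pair_measure)
    interpret Rp: prob_space "R (snd \<omega>, pb (snd \<omega>))"
      using prob_algebraD(1)[OF kernelD[OF R behavior_in_space[OF pb s]]] .
    show "(\<integral>\<^sup>+r. (\<integral>\<^sup>+s'. F (snd ((fst \<omega>)(n := (snd \<omega>, pb (snd \<omega>), r)), s')) \<partial>p (snd \<omega>, pb (snd \<omega>))) \<partial>R (snd \<omega>, pb (snd \<omega>)))
        = integral\<^sup>N (pstep p (\<lambda>s. return A (pb s)) (snd \<omega>)) F"
      by (simp add: pstep_behavior[OF pb p s] Rp.emeasure_space_1)
  qed
  also have "\<dots> = integral\<^sup>N (kchain (pstep p (\<lambda>s. return A (pb s))) xi (Suc n)) F"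
    unfolding Suc.IH[OF nn_integral_kernel_measurable1[OF Suc.prems kb]]
    by (rule nn_integral_kchain_Suc[OF kb xi Suc.prems, symmetric])
  finally show ?case .
qed

end

section \<open>Change of measure along an episode between two transition kernels\<close>

context
  fixes p1 p2 :: "'s \<times> 'a \<Rightarrow> 's measure" and l :: "'s \<Rightarrow> 's \<Rightarrow> ennreal" and v :: "'s \<Rightarrow> ennreal" and b :: ennreal
  assumes p1: "p1 \<in> S \<Otimes>\<^sub>M A \<rightarrow>\<^sub>M prob_algebra S" and p2: "p2 \<in> S \<Otimes>\<^sub>M A \<rightarrow>\<^sub>M prob_algebra S"
    and l[measurable]: "case_prod l \<in> borel_measurable (S \<Otimes>\<^sub>M S)"
    and v[measurable]: "v \<in> borel_measurable S"
    and lb: "\<And>s s'. s \<in> space S \<Longrightarrow> s' \<in> space S \<Longrightarrow> l s s' \<le> b"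
    and ratio: "\<And>s F. s \<in> space S \<Longrightarrow> F \<in> borel_measurable S \<Longrightarrow>
        integral\<^sup>N (p1 (s, pb s)) F = (\<integral>\<^sup>+s'. l s s' * F s' \<partial>p2 (s, pb s))"
    and lv: "\<And>s. s \<in> space S \<Longrightarrow> (\<integral>\<^sup>+s'. (l s s')\<^sup>2 \<partial>p2 (s, pb s)) \<le> 1 + v s"
begin

text \<open>Induction on the length: the reward kernel is common to both laws, so changing the
  measure of the last step costs only the factor \<open>l\<close> of the last transition, and the
  induction hypothesis accounts for the others.\<close>

lemma episode_density:
  assumes "g \<in> borel_measurable (episode_space S A n)"
  shows "integral\<^sup>N (episode S A p1 R pb xi n) g = (\<integral>\<^sup>+\<omega>. episode_lik l n \<omega> * g \<omega> \<partial>episode S A p2 R pb xi n)"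
  using assms
proof (induction n arbitrary: g)
  case 0
  then show ?case
    unfolding nn_integral_episode_0[OF p1 0] by (simp add: nn_integral_episode_0[OF p2 0] episode_lik_def del: episode.simps)
next
  case (Suc n)
  note g = Suc.prems
  define ext where "ext \<omega> r s' = ((fst \<omega>)(n := (snd \<omega>, pb (snd \<omega>), r)), s')" for \<omega> :: "(nat \<Rightarrow> 's \<times> 'a \<times> real) \<times> 's" and r and s' :: 's
  have em: "(\<lambda>(x, s'). ext (fst x) (snd x) s') \<in> (episode_space S A n \<Otimes>\<^sub>M borel) \<Otimes>\<^sub>M S \<rightarrow>\<^sub>M episode_space S A (Suc n)"
    using episode_extend_measurable[of n] unfolding ext_def split_beta .
  have snd_m[measurable]: "snd \<in> episode_space S A n \<rightarrow>\<^sub>M S" by (simp add: episode_space_def)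
  have rk: "(\<lambda>s. R (s, pb s)) \<in> S \<rightarrow>\<^sub>M prob_algebra borel" by measurable
  have gm: "(\<lambda>(x, s'). g (ext (fst x) (snd x) s')) \<in> borel_measurable ((episode_space S A n \<Otimes>\<^sub>M borel) \<Otimes>\<^sub>M S)"
    using measurable_compose[OF em g] by (simp add: split_beta)
  \<comment> \<open>The conditional expectation of \<open>g\<close> given the first n steps, under
    \<open>p1\<close>.\<close>
  define G where "G \<omega> = (\<integral>\<^sup>+r. (\<integral>\<^sup>+s'. g (ext \<omega> r s') \<partial>p1 (snd \<omega>, pb (snd \<omega>))) \<partial>R (snd \<omega>, pb (snd \<omega>)))" for \<omega>
  have Gm: "G \<in> borel_measurable (episode_space S A n)"
  proof -
    have "(\<lambda>x. \<integral>\<^sup>+s'. g (ext (fst x) (snd x) s') \<partial>p1 (snd (fst x), pb (snd (fst x)))) \<in> borel_measurable (episode_space S A n \<Otimes>\<^sub>M borel)"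
      by (rule nn_integral_kernel_measurable[OF gm last_state_kernel[OF p1]])
    then have *: "(\<lambda>(\<omega>, r). \<integral>\<^sup>+s'. g (ext \<omega> r s') \<partial>p1 (snd \<omega>, pb (snd \<omega>))) \<in> borel_measurable (episode_space S A n \<Otimes>\<^sub>M borel)"
      by (simp add: split_beta)
    show ?thesis unfolding G_def[abs_def]
      by (rule nn_integral_kernel_measurable[OF * measurable_compose[OF snd_m rk]])
  qed
  have lm: "(\<lambda>\<omega>. episode_lik l (Suc n) \<omega> * g \<omega>) \<in> borel_measurable (episode_space S A (Suc n))"
    using g episode_lik_measurable[OF l] by (intro borel_measurable_times_ennreal)
  have "integral\<^sup>N (episode S A p1 R pb xi (Suc n)) g = integral\<^sup>N (episode S A p1 R pb xi n) G"
    unfolding nn_integral_episode_Suc[OF p1 g] G_def ext_def ..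
  also have "\<dots> = (\<integral>\<^sup>+\<omega>. episode_lik l n \<omega> * G \<omega> \<partial>episode S A p2 R pb xi n)" by (rule Suc.IH[OF Gm])
  also have "\<dots> = (\<integral>\<^sup>+\<omega>. (\<integral>\<^sup>+r. (\<integral>\<^sup>+s'. episode_lik l (Suc n) (ext \<omega> r s') * g (ext \<omega> r s') \<partial>p2 (snd \<omega>, pb (snd \<omega>)))
        \<partial>R (snd \<omega>, pb (snd \<omega>))) \<partial>episode S A p2 R pb xi n)"
  proof (rule nn_integral_cong)
    fix \<omega> assume "\<omega> \<in> space (episode S A p2 R pb xi n)"
    then have w: "\<omega> \<in> space (episode_space S A n)" using prob_algebraD[OF episode_prob[OF p2]] by simp
    then have s: "snd \<omega> \<in> space S" by (auto simp: episode_space_def space_pair_measure)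
    note sp = prob_algebraD(4)[OF kernelD[OF p2 behavior_in_space[OF pb s]]]
      and sR = prob_algebraD(4)[OF kernelD[OF R behavior_in_space[OF pb s]]]
    have g1: "(\<lambda>s'. g (ext \<omega> r s')) \<in> borel_measurable S" for r
    proof -
      have "(\<lambda>s'. ((\<omega>, r), s')) \<in> S \<rightarrow>\<^sub>M (episode_space S A n \<Otimes>\<^sub>M borel) \<Otimes>\<^sub>M S"
        using w by (intro measurable_Pair) (auto simp: space_pair_measure)
      from measurable_compose[OF this gm] show ?thesis by simp
    qed
    have l1: "(\<lambda>s'. l (snd \<omega>) s') \<in> borel_measurable S" using s by measurable
    have sw: "(\<lambda>r. \<integral>\<^sup>+s'. g (ext \<omega> r s') \<partial>p1 (snd \<omega>, pb (snd \<omega>))) \<in> borel_measurable (R (snd \<omega>, pb (snd \<omega>)))"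
    proof -
      have "(\<lambda>r. (\<omega>, r)) \<in> borel \<rightarrow>\<^sub>M episode_space S A n \<Otimes>\<^sub>M borel" using w by measurable
      from measurable_compose[OF this nn_integral_kernel_measurable[OF gm last_state_kernel[OF p1]]]
      show ?thesis unfolding sR by simp
    qed
    have "episode_lik l n \<omega> * G \<omega> = (\<integral>\<^sup>+r. episode_lik l n \<omega> * (\<integral>\<^sup>+s'. g (ext \<omega> r s') \<partial>p1 (snd \<omega>, pb (snd \<omega>))) \<partial>R (snd \<omega>, pb (snd \<omega>)))"
      unfolding G_def by (rule nn_integral_cmult[OF sw, symmetric])
    also have "\<dots> = (\<integral>\<^sup>+r. (\<integral>\<^sup>+s'. episode_lik l (Suc n) (ext \<omega> r s') * g (ext \<omega> r s') \<partial>p2 (snd \<omega>, pb (snd \<omega>)))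
        \<partial>R (snd \<omega>, pb (snd \<omega>)))"
    proof (rule nn_integral_cong)
      fix r
      have "(\<lambda>s'. l (snd \<omega>) s' * g (ext \<omega> r s')) \<in> borel_measurable (p2 (snd \<omega>, pb (snd \<omega>)))"
        unfolding sp by (intro borel_measurable_times_ennreal l1 g1)
      from nn_integral_cmult[OF this, of "episode_lik l n \<omega>"]
      show "episode_lik l n \<omega> * (\<integral>\<^sup>+s'. g (ext \<omega> r s') \<partial>p1 (snd \<omega>, pb (snd \<omega>)))
        = (\<integral>\<^sup>+s'. episode_lik l (Suc n) (ext \<omega> r s') * g (ext \<omega> r s') \<partial>p2 (snd \<omega>, pb (snd \<omega>)))"
        using ratio[OF s g1[of r]] unfolding ext_def episode_lik_Suc by (simp add: mult.assoc)
    qed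
    finally show "episode_lik l n \<omega> * G \<omega> = (\<integral>\<^sup>+r. (\<integral>\<^sup>+s'. episode_lik l (Suc n) (ext \<omega> r s') * g (ext \<omega> r s') \<partial>p2 (snd \<omega>, pb (snd \<omega>)))
        \<partial>R (snd \<omega>, pb (snd \<omega>)))" .
  qed
  also have "\<dots> = (\<integral>\<^sup>+\<omega>. episode_lik l (Suc n) \<omega> * g \<omega> \<partial>episode S A p2 R pb xi (Suc n))"
    unfolding nn_integral_episode_Suc[OF p2 lm] ext_def ..
  finally show ?case .
qed

lemma episode_lik_le:
  assumes "\<omega> \<in> space (episode_space S A n)"
  shows "episode_lik l n \<omega> \<le> b ^ n"
proof -
  have f: "fst (fst \<omega> h) \<in> space S" if "h < n" for h
  proof -
    have "fst \<omega> h \<in> space (rec_space S A)"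
      using assms that PiE_mem[of "fst \<omega>" "{..<n}" "\<lambda>_. space (rec_space S A)" h]
      by (simp add: episode_space_def space_pair_measure space_PiM mem_Times_iff)
    then show ?thesis by (simp add: rec_space_def space_pair_measure mem_Times_iff)
  qed
  have s: "snd \<omega> \<in> space S" using assms by (auto simp: episode_space_def space_pair_measure)
  have "episode_lik l n \<omega> \<le> (\<Prod>h<n. b)"
    unfolding episode_lik_def
  proof (rule prod_mono_ennreal)
    fix h assume "h \<in> {..<n}"
    then have "fst (fst \<omega> h) \<in> space S" "(if Suc h = n then snd \<omega> else fst (fst \<omega> (Suc h))) \<in> space S"
      using f[of h] f[of "Suc h"] s by auto
    then show "l (fst (fst \<omega> h)) (if Suc h = n then snd \<omega> else fst (fst \<omega> (Suc h))) \<le> b" by (rule lb)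
  qed
  then show ?thesis by simp
qed

text \<open>Given the past, a step multiplies the squared ratio by at most 1 + v at the current
  state. The squared ratio and v are correlated, so the product with v is split by the crude bound
  b^n. What remains is a sum of expectations of v. Keeping expectations is essential, since it is
  the average of v over an episode, not its supremum, that the normalisation of the direction
  controls.\<close>

lemma episode_lik_second_moment:
  "(\<integral>\<^sup>+\<omega>. (episode_lik l n \<omega>)\<^sup>2 \<partial>episode S A p2 R pb xi n)
    \<le> 1 + (\<Sum>h<n. (b ^ h)\<^sup>2 * integral\<^sup>N (kchain (pstep p2 (\<lambda>s. return A (pb s))) xi h) v)"
proof (induction n)
  case 0
  then show ?case
    using prob_space.emeasure_space_1[OF prob_algebraD(1)[OF episode_prob[OF p2, of 0]]]
    by (simp add: episode_lik_def)
next
  case (Suc n)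
  note [measurable] = episode_lik_measurable[OF l]
  have snd_m[measurable]: "snd \<in> episode_space S A n \<rightarrow>\<^sub>M S" by (simp add: episode_space_def)
  let ?E = "episode S A p2 R pb xi"
  note ep = prob_algebraD[OF episode_prob[OF p2]]
  have mE: "(\<lambda>\<omega>. (episode_lik l n \<omega>)\<^sup>2) \<in> borel_measurable (?E n)" "(\<lambda>\<omega>. v (snd \<omega>)) \<in> borel_measurable (?E n)"
    unfolding ep(4) by measurable
  have m: "(\<lambda>\<omega>. (episode_lik l (Suc n) \<omega>)\<^sup>2) \<in> borel_measurable (episode_space S A (Suc n))" by measurable
  have "(\<integral>\<^sup>+\<omega>. (episode_lik l (Suc n) \<omega>)\<^sup>2 \<partial>?E (Suc n)) \<le>
    (\<integral>\<^sup>+\<omega>. (episode_lik l n \<omega>)\<^sup>2 + (b ^ n)\<^sup>2 * v (snd \<omega>) \<partial>?E n)"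
    unfolding nn_integral_episode_Suc[OF p2 m]
  proof (rule nn_integral_mono)
    fix \<omega> assume "\<omega> \<in> space (?E n)"
    then have w: "\<omega> \<in> space (episode_space S A n)" using ep by simp
    then have s: "snd \<omega> \<in> space S" by (auto simp: episode_space_def space_pair_measure)
    interpret Rp: prob_space "R (snd \<omega>, pb (snd \<omega>))"
      using prob_algebraD(1)[OF kernelD[OF R behavior_in_space[OF pb s]]] .
    have l1: "(\<lambda>s'. (l (snd \<omega>) s')\<^sup>2) \<in> borel_measurable (p2 (snd \<omega>, pb (snd \<omega>)))"
      unfolding prob_algebraD(4)[OF kernelD[OF p2 behavior_in_space[OF pb s]]] using s by measurable
    have "(\<integral>\<^sup>+r. (\<integral>\<^sup>+s'. (episode_lik l (Suc n) ((fst \<omega>)(n := (snd \<omega>, pb (snd \<omega>), r)), s'))\<^sup>2 \<partial>p2 (snd \<omega>, pb (snd \<omega>))) \<partial>R (snd \<omega>, pb (snd \<omega>)))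
      = (\<integral>\<^sup>+s'. (episode_lik l n \<omega>)\<^sup>2 * (l (snd \<omega>) s')\<^sup>2 \<partial>p2 (snd \<omega>, pb (snd \<omega>)))"
      by (simp add: episode_lik_Suc power_mult_distrib Rp.emeasure_space_1)
    also have "\<dots> = (episode_lik l n \<omega>)\<^sup>2 * (\<integral>\<^sup>+s'. (l (snd \<omega>) s')\<^sup>2 \<partial>p2 (snd \<omega>, pb (snd \<omega>)))"
      by (rule nn_integral_cmult[OF l1])
    also have "\<dots> \<le> (episode_lik l n \<omega>)\<^sup>2 * (1 + v (snd \<omega>))"
      by (intro mult_left_mono lv s) auto
    also have "\<dots> = (episode_lik l n \<omega>)\<^sup>2 + (episode_lik l n \<omega>)\<^sup>2 * v (snd \<omega>)"
      by (simp add: distrib_left)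
    \<comment> \<open>Only the cross term uses the uniform bound; the leading term keeps coefficient
      one, so the recursion stays additive.\<close>
    also have "\<dots> \<le> (episode_lik l n \<omega>)\<^sup>2 + (b ^ n)\<^sup>2 * v (snd \<omega>)"
      by (intro add_left_mono mult_right_mono power_mono episode_lik_le w) auto
    finally show "(\<integral>\<^sup>+r. (\<integral>\<^sup>+s'. (episode_lik l (Suc n) ((fst \<omega>)(n := (snd \<omega>, pb (snd \<omega>), r)), s'))\<^sup>2 \<partial>p2 (snd \<omega>, pb (snd \<omega>))) \<partial>R (snd \<omega>, pb (snd \<omega>)))
      \<le> (episode_lik l n \<omega>)\<^sup>2 + (b ^ n)\<^sup>2 * v (snd \<omega>)" .
  qed
  also have "\<dots> = (\<integral>\<^sup>+\<omega>. (episode_lik l n \<omega>)\<^sup>2 \<partial>?E n) + (b ^ n)\<^sup>2 * (\<integral>\<^sup>+\<omega>. v (snd \<omega>) \<partial>?E n)"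
    using mE by (simp add: nn_integral_add nn_integral_cmult)
  also have "\<dots> \<le> (1 + (\<Sum>h<n. (b ^ h)\<^sup>2 * integral\<^sup>N (kchain (pstep p2 (\<lambda>s. return A (pb s))) xi h) v))
      + (b ^ n)\<^sup>2 * integral\<^sup>N (kchain (pstep p2 (\<lambda>s. return A (pb s))) xi n) v"
    unfolding nn_integral_episode_last[OF p2 v] by (intro add_right_mono Suc.IH)
  finally show ?case by (simp add: add.assoc)
qed

text \<open>Change of measure followed by Cauchy-Schwarz. The result has the shape that
  \<open>PiM_second_moment_bound\<close> demands of one episode.\<close>

lemma episode_second_moment_bound:
  assumes "g \<in> borel_measurable (episode_space S A n)"
    and "1 + (\<Sum>h<n. (b ^ h)\<^sup>2 * integral\<^sup>N (kchain (pstep p2 (\<lambda>s. return A (pb s))) xi h) v) \<le> M"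
  shows "(integral\<^sup>N (episode S A p1 R pb xi n) g)\<^sup>2 \<le> M * (\<integral>\<^sup>+\<omega>. (g \<omega>)\<^sup>2 \<partial>episode S A p2 R pb xi n)"
proof -
  note ep = prob_algebraD[OF episode_prob[OF p2, of n]]
  have "(integral\<^sup>N (episode S A p1 R pb xi n) g)\<^sup>2
      \<le> (\<integral>\<^sup>+\<omega>. (episode_lik l n \<omega>)\<^sup>2 \<partial>episode S A p2 R pb xi n) * (\<integral>\<^sup>+\<omega>. (g \<omega>)\<^sup>2 \<partial>episode S A p2 R pb xi n)"
    unfolding episode_density[OF assms(1)]
    by (rule Cauchy_Schwarz_nn_integral; unfold ep(4)) (rule episode_lik_measurable[OF l] assms(1))+
  also have "\<dots> \<le> M * (\<integral>\<^sup>+\<omega>. (g \<omega>)\<^sup>2 \<partial>episode S A p2 R pb xi n)"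
    by (intro mult_right_mono order_trans[OF episode_lik_second_moment assms(2)]) auto
  finally show ?thesis .
qed

end
end

section \<open>Mixing a kernel with a fixed distribution\<close>

text \<open>Written through densities with respect to the base measure, so that two mixtures have an
  explicit pointwise likelihood ratio. The weight may depend on the state-action pair.\<close>

definition mixk :: "'s measure \<Rightarrow> ('x \<Rightarrow> 's \<Rightarrow> real) \<Rightarrow> ('x \<Rightarrow> real) \<Rightarrow> ('s \<Rightarrow> real) \<Rightarrow> 'x \<Rightarrow> 's measure" where
  "mixk \<mu> pd k u x = density \<mu> (\<lambda>s'. ennreal ((1 - k x) * pd x s' + k x * u s'))"

lemma density_prob_algebra:
  assumes "sets \<mu> = sets S" "u \<in> borel_measurable S" "(\<integral>\<^sup>+s. ennreal (u s) \<partial>\<mu>) = 1"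
  shows "density \<mu> (\<lambda>s. ennreal (u s)) \<in> space (prob_algebra S)"
proof -
  have [measurable]: "u \<in> borel_measurable \<mu>" using assms(1,2) by (simp cong: measurable_cong_sets)
  have "prob_space (density \<mu> (\<lambda>s. ennreal (u s)))"
    by (rule prob_spaceI) (simp add: emeasure_density assms(3) cong: nn_integral_cong)
  then show ?thesis using assms(1) by (simp add: space_prob_algebra)
qed

context
  fixes S :: "'s measure" and X :: "'x measure" and \<mu> :: "'s measure" and p pd and k :: "'x \<Rightarrow> real" and u :: "'s \<Rightarrow> real"
  assumes \<mu>: "sets \<mu> = sets S"
    and p: "p \<in> X \<rightarrow>\<^sub>M prob_algebra S"
    and pd_meas: "(\<lambda>(x, s'). pd x s') \<in> borel_measurable (X \<Otimes>\<^sub>M S)"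
    and pd_nonneg: "\<And>x s'. x \<in> space X \<Longrightarrow> s' \<in> space S \<Longrightarrow> 0 \<le> pd x s'"
    and p_density: "\<And>x. x \<in> space X \<Longrightarrow> p x = density \<mu> (\<lambda>s'. ennreal (pd x s'))"
    and k_meas: "k \<in> borel_measurable X" and k: "\<And>x. x \<in> space X \<Longrightarrow> 0 \<le> k x \<and> k x \<le> 1"
    and u_meas: "u \<in> borel_measurable S" and u_nonneg: "\<And>s. s \<in> space S \<Longrightarrow> 0 \<le> u s"
    and u_int: "(\<integral>\<^sup>+s. ennreal (u s) \<partial>\<mu>) = 1"
begin

lemma nn_integral_mixk:
  assumes x: "x \<in> space X" and F[measurable]: "F \<in> borel_measurable S"
  shows "integral\<^sup>N (mixk \<mu> pd k u x) F
    = ennreal (1 - k x) * integral\<^sup>N (p x) F + ennreal (k x) * integral\<^sup>N (density \<mu> (\<lambda>s. ennreal (u s))) F"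
proof -
  note [measurable_cong] = \<mu>
  note [measurable] = u_meas
  have [measurable]: "pd x \<in> borel_measurable S"
    using measurable_compose[OF measurable_Pair1'[OF x] pd_meas] by simp
  have sp: "space \<mu> = space S" using \<mu> by (rule sets_eq_imp_space_eq)
  have "integral\<^sup>N (mixk \<mu> pd k u x) F = (\<integral>\<^sup>+s. ennreal ((1 - k x) * pd x s + k x * u s) * F s \<partial>\<mu>)"
    unfolding mixk_def by (rule nn_integral_density) measurable
  also have "\<dots> = (\<integral>\<^sup>+s. ennreal (1 - k x) * (ennreal (pd x s) * F s) + ennreal (k x) * (ennreal (u s) * F s) \<partial>\<mu>)"
    using k[OF x] pd_nonneg[OF x] u_nonneg sp
    by (intro nn_integral_cong) (simp add: ennreal_plus ennreal_mult distrib_right mult.assoc)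
  also have "\<dots> = ennreal (1 - k x) * (\<integral>\<^sup>+s. ennreal (pd x s) * F s \<partial>\<mu>) + ennreal (k x) * (\<integral>\<^sup>+s. ennreal (u s) * F s \<partial>\<mu>)"
    by (simp add: nn_integral_add nn_integral_cmult)
  also have "\<dots> = ennreal (1 - k x) * integral\<^sup>N (p x) F + ennreal (k x) * integral\<^sup>N (density \<mu> (\<lambda>s. ennreal (u s))) F"
    unfolding p_density[OF x] by (simp add: nn_integral_density)
  finally show ?thesis .
qed

lemma sets_mixk: "sets (mixk \<mu> pd k u x) = sets S"
  by (simp add: mixk_def \<mu>)

lemma emeasure_mixk:
  assumes x: "x \<in> space X" and B: "B \<in> sets S"
  shows "emeasure (mixk \<mu> pd k u x) B
    = ennreal (1 - k x) * emeasure (p x) B + ennreal (k x) * emeasure (density \<mu> (\<lambda>s. ennreal (u s))) B"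
  using nn_integral_mixk[OF x, of "indicator B"] B prob_algebraD(2)[OF kernelD[OF p x]] by (simp add: sets_mixk \<mu>)

lemma mixk_kernel: "mixk \<mu> pd k u \<in> X \<rightarrow>\<^sub>M prob_algebra S"
proof (rule measurable_prob_algebraI)
  note U = density_prob_algebra[OF \<mu> u_meas u_int]
  show pr: "prob_space (mixk \<mu> pd k u x)" if x: "x \<in> space X" for x
  proof (rule prob_spaceI)
    have "emeasure (mixk \<mu> pd k u x) (space S) = ennreal (1 - k x) + ennreal (k x)"
      using emeasure_mixk[OF x, of "space S"] in_space_prob_algebra[OF U] in_space_prob_algebra[OF kernelD[OF p x]] by simp
    also have "\<dots> = 1" using k[OF x] by (subst ennreal_plus[symmetric]) auto
    finally show "emeasure (mixk \<mu> pd k u x) (space (mixk \<mu> pd k u x)) = 1"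
      using sets_eq_imp_space_eq[OF sets_mixk] by simp
  qed
  show "mixk \<mu> pd k u \<in> X \<rightarrow>\<^sub>M subprob_algebra S"
  proof (rule measurable_subprob_algebra)
    fix B assume B: "B \<in> sets S"
    note [measurable] = k_meas
    have [measurable]: "(\<lambda>x. emeasure (p x) B) \<in> borel_measurable X"
      using measurable_compose[OF measurable_prob_algebraD[OF p] measurable_emeasure_subprob_algebra[OF B]] .
    show "(\<lambda>x. emeasure (mixk \<mu> pd k u x) B) \<in> borel_measurable X"
      by (subst measurable_cong[OF emeasure_mixk[OF _ B]]) measurable
  qed (auto simp: sets_mixk intro: prob_space_imp_subprob_space pr)
qed

lemma integral_mixk:
  fixes F :: "'s \<Rightarrow> real"
  assumes x: "x \<in> space X" and F: "F \<in> borel_measurable S" "\<And>s. s \<in> space S \<Longrightarrow> \<bar>F s\<bar> \<le> B"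
  shows "integral\<^sup>L (mixk \<mu> pd k u x) F
    = (1 - k x) * integral\<^sup>L (p x) F + k x * integral\<^sup>L (density \<mu> (\<lambda>s. ennreal (u s))) F"
proof -
  note [measurable_cong] = \<mu>
  note [measurable] = u_meas F(1)
  have [measurable]: "pd x \<in> borel_measurable S"
    using measurable_compose[OF measurable_Pair1'[OF x] pd_meas] by simp
  have sp: "space \<mu> = space S" using \<mu> by (rule sets_eq_imp_space_eq)
  note U = density_prob_algebra[OF \<mu> u_meas u_int]
  have i1: "integrable \<mu> (\<lambda>s. pd x s * F s)"
    using integrable_prob_bounded[OF kernelD[OF p x] F] pd_nonneg[OF x] sp unfolding p_density[OF x]
    by (subst integrable_real_density[symmetric]) auto
  have i2: "integrable \<mu> (\<lambda>s. u s * F s)"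
    using integrable_prob_bounded[OF U F] u_nonneg sp
    by (subst integrable_real_density[symmetric]) auto
  have "integral\<^sup>L (mixk \<mu> pd k u x) F = (\<integral>s. ((1 - k x) * pd x s + k x * u s) * F s \<partial>\<mu>)"
    unfolding mixk_def using k[OF x] pd_nonneg[OF x] u_nonneg sp
    by (intro integral_real_density AE_I2) auto
  also have "\<dots> = (\<integral>s. (1 - k x) * (pd x s * F s) + k x * (u s * F s) \<partial>\<mu>)"
    by (simp add: algebra_simps)
  also have "\<dots> = (1 - k x) * (\<integral>s. pd x s * F s \<partial>\<mu>) + k x * (\<integral>s. u s * F s \<partial>\<mu>)"
    using i1 i2 by simp
  also have "(\<integral>s. pd x s * F s \<partial>\<mu>) = integral\<^sup>L (p x) F"
    unfolding p_density[OF x] using pd_nonneg[OF x] sp by (subst integral_real_density) auto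
  also have "(\<integral>s. u s * F s \<partial>\<mu>) = integral\<^sup>L (density \<mu> (\<lambda>s. ennreal (u s))) F"
    using u_nonneg sp by (subst integral_real_density) auto
  finally show ?thesis .
qed

lemma integral_mixk_close:
  fixes F :: "'s \<Rightarrow> real"
  assumes x: "x \<in> space X" and F: "F \<in> borel_measurable S" "\<And>s. s \<in> space S \<Longrightarrow> 0 \<le> F s \<and> F s \<le> B"
  shows "\<bar>integral\<^sup>L (mixk \<mu> pd k u x) F - integral\<^sup>L (p x) F\<bar> \<le> k x * B"
proof -
  have b: "\<bar>F s\<bar> \<le> B" if "s \<in> space S" for s using F(2)[OF that] by auto
  note U = density_prob_algebra[OF \<mu> u_meas u_int]
  let ?a = "integral\<^sup>L (p x) F" and ?b = "integral\<^sup>L (density \<mu> (\<lambda>s. ennreal (u s))) F"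
  have "0 \<le> ?a" "?a \<le> B" "0 \<le> ?b" "?b \<le> B"
    using F by (intro integral_prob_ge[OF kernelD[OF p x] F(1) b] integral_prob_le[OF kernelD[OF p x] F(1) b]
        integral_prob_ge[OF U F(1) b] integral_prob_le[OF U F(1) b]; simp)+
  then have "\<bar>?b - ?a\<bar> \<le> B" by linarith
  moreover have "integral\<^sup>L (mixk \<mu> pd k u x) F - ?a = k x * (?b - ?a)"
    using integral_mixk[OF x F(1) b] by (simp add: algebra_simps)
  ultimately show ?thesis using k[OF x] by (simp add: abs_mult mult_left_mono)
qed

lemma tv_dist_mixk:
  assumes x: "x \<in> space X"
  shows "tv_dist (mixk \<mu> pd k u x) (p x) \<le> k x"
  unfolding tv_dist_def
proof (rule cSup_least)
  show "{\<bar>measure (mixk \<mu> pd k u x) B - measure (p x) B\<bar> | B. B \<in> sets (mixk \<mu> pd k u x)} \<noteq> {}" by auto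
next
  fix t assume "t \<in> {\<bar>measure (mixk \<mu> pd k u x) B - measure (p x) B\<bar> | B. B \<in> sets (mixk \<mu> pd k u x)}"
  then obtain B where t: "t = \<bar>measure (mixk \<mu> pd k u x) B - measure (p x) B\<bar>" and B: "B \<in> sets S"
    by (auto simp: sets_mixk)
  have "\<bar>integral\<^sup>L (mixk \<mu> pd k u x) (indicator B) - integral\<^sup>L (p x) (indicator B)\<bar> \<le> k x * 1"
    using B by (intro integral_mixk_close[OF x]) (auto simp: indicator_def)
  then show "t \<le> k x"
    using B sets_mixk[of x] prob_algebraD(2)[OF kernelD[OF p x]] unfolding t by (simp add: sets.Int_space_eq2)
qed

end

section \<open>Likelihood ratio of two mixtures\<close>

text \<open>As k \<le> 1/2, m is at least q / 2, hence u / m and d / m are at most 2 / c. Then r^2 m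
  = m + 2 k (u - d) + k^2 (u - d)^2 / m, and (u - d)^2 \<le> u^2 + d^2 bounds the last term by 2 k^2
  (u + d) / c. In the final inequality 2 k d stands on the left so that every term is nonnegative
  and can be integrated in \<open>ennreal\<close>.\<close>

lemma mixture_ratio_pointwise:
  fixes q u d k c :: real
  assumes nn: "0 \<le> q" "0 \<le> u" "0 \<le> d" and k: "0 \<le> k" "k \<le> 1/2" and c: "0 < c" "c * u \<le> q" "c * d \<le> q"
  defines "m \<equiv> (1 - k) * q + k * d"
  defines "r \<equiv> 1 + k * (u - d) / m"
  shows "r * m = (1 - k) * q + k * u" "0 \<le> r" "r \<le> 1 + 2 * k / c"
    "r\<^sup>2 * m + 2 * k * d \<le> m + 2 * k * u + 2 * k\<^sup>2 / c * (u + d)"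
proof -
  have "r * m = (1 - k) * q + k * u \<and> 0 \<le> r \<and> r \<le> 1 + 2 * k / c
    \<and> r\<^sup>2 * m + 2 * k * d \<le> m + 2 * k * u + 2 * k\<^sup>2 / c * (u + d)"
  proof (cases "q = 0")
    \<comment> \<open>Here u, d and m vanish too, and division by zero makes r equal to 1.\<close>
    case True
    then have "u = 0" "d = 0" using c nn by (auto simp: mult_le_0_iff)
    then show ?thesis using True k c by (simp add: m_def r_def)
  next
    case False
    then have q: "0 < q" using nn by simp
    have mq: "q / 2 \<le> m" 
    proof -
      have "1 / 2 * q \<le> (1 - k) * q" using k q by (intro mult_right_mono) auto
      moreover have "0 \<le> k * d" using k nn by simp
      ultimately show ?thesis by (simp add: m_def)
    qed
    then have m: "0 < m" using q by linarith
    have rm: "r * m = (1 - k) * q + k * u"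
      using m unfolding r_def m_def by (simp add: field_simps)
    have "0 \<le> r * m" unfolding rm using k q nn by simp
    then have r0: "0 \<le> r" using m by (simp add: zero_le_mult_iff)
    have uq: "u / m \<le> 2 / c" "d / m \<le> 2 / c"
    proof -
      have "c * u \<le> 2 * m" "c * d \<le> 2 * m" using c mq by linarith+
      then show "u / m \<le> 2 / c" "d / m \<le> 2 / c" using c m by (simp_all add: field_simps)
    qed
    have "k * (u - d) / m \<le> k * (u / m)"
      using k nn m by (simp add: field_simps)
    also have "\<dots> \<le> k * (2 / c)" using uq k by (intro mult_left_mono) auto
    finally have r1: "r \<le> 1 + 2 * k / c" by (simp add: r_def mult.commute)
    have "(u - d)\<^sup>2 / m \<le> (u\<^sup>2 + d\<^sup>2) / m"
      using nn m by (intro divide_right_mono) (auto simp: power2_diff)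
    also have "\<dots> = u * (u / m) + d * (d / m)" by (simp add: power2_eq_square add_divide_distrib)
    also have "\<dots> \<le> u * (2 / c) + d * (2 / c)" using uq nn by (intro add_mono mult_left_mono) auto
    finally have *: "k\<^sup>2 * ((u - d)\<^sup>2 / m) \<le> k\<^sup>2 * (2 / c * (u + d))"
      by (intro mult_left_mono) (auto simp: algebra_simps add_divide_distrib)
    have "r\<^sup>2 * m = m + 2 * k * (u - d) + k\<^sup>2 * ((u - d)\<^sup>2 / m)"
      using m unfolding r_def by (simp add: field_simps power2_eq_square)
    then have "r\<^sup>2 * m + 2 * k * d \<le> m + 2 * k * u + 2 * k\<^sup>2 / c * (u + d)"
      using * by (simp add: algebra_simps)
    then show ?thesis using rm r0 r1 by blast
  qed
  then show "r * m = (1 - k) * q + k * u" "0 \<le> r" "r \<le> 1 + 2 * k / c"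
    "r\<^sup>2 * m + 2 * k * d \<le> m + 2 * k * u + 2 * k\<^sup>2 / c * (u + d)" by blast+
qed

text \<open>Written as \<open>1 + \<dots>\<close> so that the value is \<open>1\<close>, not \<open>0\<close>, where both densities vanish.\<close>
definition mix_ratio :: "('x \<Rightarrow> 's \<Rightarrow> real) \<Rightarrow> ('x \<Rightarrow> real) \<Rightarrow> ('s \<Rightarrow> real) \<Rightarrow> ('s \<Rightarrow> real) \<Rightarrow> 'x \<Rightarrow> 's \<Rightarrow> real" where
  "mix_ratio pd k u d x s' = 1 + k x * (u s' - d s') / ((1 - k x) * pd x s' + k x * d s')"

context
  fixes S :: "'s measure" and X :: "'x measure" and \<mu> :: "'s measure" and pd and k :: "'x \<Rightarrow> real" and u d :: "'s \<Rightarrow> real"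
    and x :: 'x and c :: real
  assumes \<mu>[measurable_cong]: "sets \<mu> = sets S"
    and pd_meas: "(\<lambda>(x, s'). pd x s') \<in> borel_measurable (X \<Otimes>\<^sub>M S)"
    and x: "x \<in> space X"
    and pd_nonneg: "\<And>s'. s' \<in> space S \<Longrightarrow> 0 \<le> pd x s'"
    and pd_int: "(\<integral>\<^sup>+s. ennreal (pd x s) \<partial>\<mu>) = 1"
    and k: "0 \<le> k x" "k x \<le> 1/2"
    and u[measurable]: "u \<in> borel_measurable S" and u_nonneg: "\<And>s. s \<in> space S \<Longrightarrow> 0 \<le> u s"
    and d[measurable]: "d \<in> borel_measurable S" and d_nonneg: "\<And>s. s \<in> space S \<Longrightarrow> 0 \<le> d s"
    and ud_int: "(\<integral>\<^sup>+s. ennreal (u s) \<partial>\<mu>) = 1" "(\<integral>\<^sup>+s. ennreal (d s) \<partial>\<mu>) = 1"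
    and c: "0 < c" and cu: "\<And>s. s \<in> space S \<Longrightarrow> c * u s \<le> pd x s" and cd: "\<And>s. s \<in> space S \<Longrightarrow> c * d s \<le> pd x s"
begin

lemma pd_x_measurable: "pd x \<in> borel_measurable S"
  using measurable_compose[OF measurable_Pair1'[OF x] pd_meas] by simp

lemma mix_ratio_measurable: "mix_ratio pd k u d x \<in> borel_measurable S"
proof -
  note [measurable] = pd_x_measurable
  show ?thesis unfolding mix_ratio_def[abs_def] by measurable
qed

lemma mix_ratio_bounds:
  assumes "s \<in> space S"
  shows "0 \<le> mix_ratio pd k u d x s" "mix_ratio pd k u d x s \<le> 1 + 2 * k x / c"
  using mixture_ratio_pointwise(2,3)[OF pd_nonneg u_nonneg d_nonneg k c cu cd] assms
  unfolding mix_ratio_def by auto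

lemma nn_integral_mix_ratio:
  assumes F[measurable]: "F \<in> borel_measurable S"
  shows "integral\<^sup>N (mixk \<mu> pd k u x) F = (\<integral>\<^sup>+s. ennreal (mix_ratio pd k u d x s) * F s \<partial>mixk \<mu> pd k d x)"
proof -
  note [measurable] = pd_x_measurable mix_ratio_measurable
  have sp: "space \<mu> = space S" using \<mu> by (rule sets_eq_imp_space_eq)
  have "integral\<^sup>N (mixk \<mu> pd k u x) F = (\<integral>\<^sup>+s. ennreal ((1 - k x) * pd x s + k x * u s) * F s \<partial>\<mu>)"
    unfolding mixk_def by (rule nn_integral_density) measurable
  also have "\<dots> = (\<integral>\<^sup>+s. ennreal ((1 - k x) * pd x s + k x * d s) * (ennreal (mix_ratio pd k u d x s) * F s) \<partial>\<mu>)"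
  proof (rule nn_integral_cong)
    fix s assume "s \<in> space \<mu>"
    then have s: "s \<in> space S" using sp by simp
    have "(1 - k x) * pd x s + k x * u s = mix_ratio pd k u d x s * ((1 - k x) * pd x s + k x * d s)"
      using mixture_ratio_pointwise(1)[OF pd_nonneg u_nonneg d_nonneg k c cu cd, OF s s s s s]
      unfolding mix_ratio_def by simp
    then show "ennreal ((1 - k x) * pd x s + k x * u s) * F s
      = ennreal ((1 - k x) * pd x s + k x * d s) * (ennreal (mix_ratio pd k u d x s) * F s)"
      using mix_ratio_bounds(1)[OF s] pd_nonneg[OF s] d_nonneg[OF s] k
      by (simp add: ennreal_mult mult_ac)
  qed
  also have "\<dots> = (\<integral>\<^sup>+s. ennreal (mix_ratio pd k u d x s) * F s \<partial>mixk \<mu> pd k d x)"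
    unfolding mixk_def by (rule nn_integral_density[symmetric]) measurable
  finally show ?thesis .
qed

text \<open>Integrating the pointwise bound: the first-order terms with u and d both integrate to 2
  k and cancel, as u and d are probability densities. The two second-order terms give 2 k^2 / c
  each. The summand 2 k is carried on both sides and cancelled at the end, which avoids subtraction
  in \<open>ennreal\<close>.\<close>

lemma mix_ratio_second_moment:
  "(\<integral>\<^sup>+s. (ennreal (mix_ratio pd k u d x s))\<^sup>2 \<partial>mixk \<mu> pd k d x) \<le> 1 + ennreal (4 / c * (k x)\<^sup>2)"
proof -
  note [measurable] = pd_x_measurable mix_ratio_measurable
  have sp: "space \<mu> = space S" using \<mu> by (rule sets_eq_imp_space_eq)
  define K where "K = 2 * (k x)\<^sup>2 / c"
  have K: "0 \<le> K" using c by (simp add: K_def)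
  let ?m = "\<lambda>s. (1 - k x) * pd x s + k x * d s" and ?r = "mix_ratio pd k u d x"
  have "(\<integral>\<^sup>+s. (ennreal (?r s))\<^sup>2 \<partial>mixk \<mu> pd k d x) + ennreal (2 * k x)
      = (\<integral>\<^sup>+s. ennreal (?m s) * (ennreal (?r s))\<^sup>2 \<partial>\<mu>) + ennreal (2 * k x) * (\<integral>\<^sup>+s. ennreal (d s) \<partial>\<mu>)"
    unfolding ud_int mixk_def by (subst nn_integral_density) auto
  also have "\<dots> = (\<integral>\<^sup>+s. ennreal (?m s) * (ennreal (?r s))\<^sup>2 + ennreal (2 * k x) * ennreal (d s) \<partial>\<mu>)"
    by (simp add: nn_integral_add nn_integral_cmult)
  also have "\<dots> \<le> (\<integral>\<^sup>+s. ennreal (1 - k x) * ennreal (pd x s) + ennreal (k x) * ennreal (d s)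
      + ennreal (2 * k x) * ennreal (u s) + (ennreal K * ennreal (u s) + ennreal K * ennreal (d s)) \<partial>\<mu>)"
  proof (rule nn_integral_mono)
    fix s assume "s \<in> space \<mu>"
    then have s: "s \<in> space S" using sp by simp
    note nn = pd_nonneg[OF s] d_nonneg[OF s] u_nonneg[OF s] mix_ratio_bounds(1)[OF s]
    have "(?r s)\<^sup>2 * ?m s + 2 * k x * d s \<le> ?m s + 2 * k x * u s + K * (u s + d s)"
      using mixture_ratio_pointwise(4)[OF pd_nonneg u_nonneg d_nonneg k c cu cd, OF s s s s s]
      unfolding mix_ratio_def K_def .
    then have "?m s * (?r s)\<^sup>2 + 2 * k x * d s \<le> (1 - k x) * pd x s + k x * d s + 2 * k x * u s + (K * u s + K * d s)"
      by (simp add: algebra_simps)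
    then have "ennreal (?m s * (?r s)\<^sup>2 + 2 * k x * d s) \<le> ennreal ((1 - k x) * pd x s + k x * d s + 2 * k x * u s + (K * u s + K * d s))"
      by (rule ennreal_leI)
    then show "ennreal (?m s) * (ennreal (?r s))\<^sup>2 + ennreal (2 * k x) * ennreal (d s)
      \<le> ennreal (1 - k x) * ennreal (pd x s) + ennreal (k x) * ennreal (d s)
      + ennreal (2 * k x) * ennreal (u s) + (ennreal K * ennreal (u s) + ennreal K * ennreal (d s))"
      using nn k K by (simp add: ennreal_plus ennreal_mult ennreal_power[symmetric] del: ennreal_power)
  qed
  also have "\<dots> = ennreal (1 - k x) + ennreal (k x) + ennreal (2 * k x) + (ennreal K + ennreal K)"
    using pd_int ud_int by (simp add: nn_integral_add nn_integral_cmult)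
  also have "\<dots> = (1 + ennreal (4 / c * (k x)\<^sup>2)) + ennreal (2 * k x)"
  proof -
    have "ennreal (1 - k x) + ennreal (k x) + ennreal (2 * k x) + (ennreal K + ennreal K)
       = ennreal (1 - k x + k x + 2 * k x + (K + K))"
    proof -
      have "ennreal (1 - k x) + ennreal (k x) = ennreal (1 - k x + k x)" using k by (intro ennreal_plus[symmetric]) auto
      moreover have "\<dots> + ennreal (2 * k x) = ennreal (1 - k x + k x + 2 * k x)" using k by (intro ennreal_plus[symmetric]) auto
      moreover have "ennreal K + ennreal K = ennreal (K + K)" using K by (intro ennreal_plus[symmetric]) auto
      moreover have "ennreal (1 - k x + k x + 2 * k x) + ennreal (K + K) = ennreal (1 - k x + k x + 2 * k x + (K + K))"
        using k K by (intro ennreal_plus[symmetric]) auto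
      ultimately show ?thesis by metis
    qed
    also have "\<dots> = ennreal (1 + 4 / c * (k x)\<^sup>2 + 2 * k x)" 
      by (rule arg_cong[where f=ennreal]) (simp add: K_def)
    also have "\<dots> = ennreal (1 + 4 / c * (k x)\<^sup>2) + ennreal (2 * k x)"
      using k c by (intro ennreal_plus) auto
    also have "ennreal (1 + 4 / c * (k x)\<^sup>2) = ennreal 1 + ennreal (4 / c * (k x)\<^sup>2)"
      using c by (intro ennreal_plus) auto
    also have "ennreal 1 = 1" by simp
    finally show ?thesis .
  qed
  finally have "ennreal (2 * k x) + (\<integral>\<^sup>+s. (ennreal (?r s))\<^sup>2 \<partial>mixk \<mu> pd k d x)
      \<le> ennreal (2 * k x) + (1 + ennreal (4 / c * (k x)\<^sup>2))" by (subst (1 2) add.commute)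
  then show ?thesis by (subst (asm) ennreal_add_left_cancel_le) auto
qed

end

section \<open>Value of mixtures\<close>

lemma mean_reward_measurable:
  assumes "R \<in> X \<rightarrow>\<^sub>M prob_algebra borel"
  shows "mean_reward R \<in> borel_measurable X"
  unfolding mean_reward_def[abs_def] by (rule integral_kernel_measurable1[OF _ assms]) simp

lemma mean_reward_range:
  assumes R: "R \<in> X \<rightarrow>\<^sub>M prob_algebra borel" and x: "x \<in> space X" and m: "measure (R x) {0..1} = 1"
  shows "0 \<le> mean_reward R x" "mean_reward R x \<le> 1"
proof -
  note Rx = prob_algebraD[OF kernelD[OF R x]]
  interpret prob_space "R x" by (rule Rx(1))
  have ae: "AE t in R x. t \<in> {0..1}"
    using m prob_eq_1[of "{0..1}"] Rx(2) by simp
  have i: "integrable (R x) (\<lambda>t. t)"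
  proof (rule integrable_const_bound[where B=1])
    show "AE t in R x. norm t \<le> 1" using ae by (rule AE_mp) (intro AE_I2 impI, auto)
    show "(\<lambda>t. t) \<in> borel_measurable (R x)" unfolding Rx(4) by simp
  qed
  show "0 \<le> mean_reward R x" unfolding mean_reward_def using ae by (intro integral_nonneg_AE) auto
  show "mean_reward R x \<le> 1" unfolding mean_reward_def using ae by (intro integral_le_const[OF i]) auto
qed

text \<open>The policy is a parameter because the same perturbed transitions are followed by the
  target policy, for values and numerators, and by the behavior policy, for denominators.\<close>

locale mixture_mdp =
  fixes S :: "'s measure" and A :: "'a measure" and \<mu> :: "'s measure"
    and p :: "'s \<times> 'a \<Rightarrow> 's measure" and pd :: "'s \<times> 'a \<Rightarrow> 's \<Rightarrow> real"
    and pol :: "'s \<Rightarrow> 'a measure" and k :: "'s \<times> 'a \<Rightarrow> real" and e :: real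
  assumes \<mu>: "sets \<mu> = sets S"
    and p: "p \<in> S \<Otimes>\<^sub>M A \<rightarrow>\<^sub>M prob_algebra S"
    and pd_meas: "(\<lambda>(x, s'). pd x s') \<in> borel_measurable ((S \<Otimes>\<^sub>M A) \<Otimes>\<^sub>M S)"
    and pd_nonneg: "\<And>x s'. x \<in> space (S \<Otimes>\<^sub>M A) \<Longrightarrow> s' \<in> space S \<Longrightarrow> 0 \<le> pd x s'"
    and p_density: "\<And>x. x \<in> space (S \<Otimes>\<^sub>M A) \<Longrightarrow> p x = density \<mu> (\<lambda>s'. ennreal (pd x s'))"
    and pol: "pol \<in> S \<rightarrow>\<^sub>M prob_algebra A"
    and k_meas: "k \<in> borel_measurable (S \<Otimes>\<^sub>M A)"
    and k_range: "\<And>x. x \<in> space (S \<Otimes>\<^sub>M A) \<Longrightarrow> 0 \<le> k x \<and> k x \<le> e"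
    and e: "0 \<le> e" "e \<le> 1"
begin

definition is_density :: "('s \<Rightarrow> real) \<Rightarrow> bool" where
  "is_density u \<longleftrightarrow> u \<in> borel_measurable S \<and> (\<forall>s\<in>space S. 0 \<le> u s) \<and> (\<integral>\<^sup>+s. ennreal (u s) \<partial>\<mu>) = 1"

abbreviation "mix u \<equiv> mixk \<mu> pd k u"
abbreviation "dens u \<equiv> density \<mu> (\<lambda>s. ennreal (u s))"

lemma is_densityD:
  assumes "is_density u"
  shows "u \<in> borel_measurable S" "\<And>s. s \<in> space S \<Longrightarrow> 0 \<le> u s" "(\<integral>\<^sup>+s. ennreal (u s) \<partial>\<mu>) = 1"
    "dens u \<in> space (prob_algebra S)"
  using assms density_prob_algebra[OF \<mu>] unfolding is_density_def by auto

lemma k_le_1: "x \<in> space (S \<Otimes>\<^sub>M A) \<Longrightarrow> 0 \<le> k x \<and> k x \<le> 1"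
  using k_range[of x] e by auto

lemmas mix_facts = \<mu> p pd_meas pd_nonneg p_density k_meas k_le_1

lemma mix_kernel: "is_density u \<Longrightarrow> mix u \<in> S \<Otimes>\<^sub>M A \<rightarrow>\<^sub>M prob_algebra S"
  by (rule mixk_kernel[where p=p]) (rule mix_facts is_densityD | assumption)+

lemma mix_tv:
  assumes "is_density u" "x \<in> space (S \<Otimes>\<^sub>M A)"
  shows "tv_dist (mix u x) (p x) \<le> e"
proof -
  have "tv_dist (mix u x) (p x) \<le> k x"
    by (rule tv_dist_mixk[where X="S \<Otimes>\<^sub>M A"]) (rule mix_facts is_densityD[OF assms(1)] assms | assumption)+
  then show ?thesis using k_range[OF assms(2)] by simp
qed

lemma nn_integral_mix:
  assumes "is_density u" "x \<in> space (S \<Otimes>\<^sub>M A)" "F \<in> borel_measurable S"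
  shows "integral\<^sup>N (mix u x) F = ennreal (1 - k x) * integral\<^sup>N (p x) F + ennreal (k x) * integral\<^sup>N (dens u) F"
  by (rule nn_integral_mixk[where X="S \<Otimes>\<^sub>M A"]) (rule mix_facts is_densityD[OF assms(1)] assms | assumption)+

lemma integral_mix:
  fixes F :: "'s \<Rightarrow> real"
  assumes "is_density u" "x \<in> space (S \<Otimes>\<^sub>M A)" "F \<in> borel_measurable S" "\<And>s. s \<in> space S \<Longrightarrow> \<bar>F s\<bar> \<le> B"
  shows "integral\<^sup>L (mix u x) F = (1 - k x) * integral\<^sup>L (p x) F + k x * integral\<^sup>L (dens u) F"
  by (rule integral_mixk[where X="S \<Otimes>\<^sub>M A" and B=B]) (rule mix_facts is_densityD[OF assms(1)] assms | assumption)+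

lemma nn_integral_mix_ge:
  assumes "is_density u" "x \<in> space (S \<Otimes>\<^sub>M A)" "F \<in> borel_measurable S"
  shows "ennreal (1 - e) * integral\<^sup>N (p x) F \<le> integral\<^sup>N (mix u x) F"
proof -
  have "ennreal (1 - e) * integral\<^sup>N (p x) F \<le> ennreal (1 - k x) * integral\<^sup>N (p x) F"
    using k_range[OF assms(2)] by (intro mult_right_mono ennreal_leI) auto
  also have "\<dots> \<le> integral\<^sup>N (mix u x) F" unfolding nn_integral_mix[OF assms] by simp
  finally show ?thesis .
qed

lemma pair_space: "s \<in> space S \<Longrightarrow> a \<in> space A \<Longrightarrow> (s, a) \<in> space (S \<Otimes>\<^sub>M A)"
  by (simp add: space_pair_measure)

lemma section_measurable: "f \<in> borel_measurable (S \<Otimes>\<^sub>M A) \<Longrightarrow> s \<in> space S \<Longrightarrow> (\<lambda>a. f (s, a)) \<in> borel_measurable A"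
  by (rule measurable_compose[OF measurable_Pair1'])

text \<open>At a state, mixing in a distribution adds its mean of F times \<open>kb\<close> and
  removes \<open>wF F\<close>. The removed part has the same integrand for either mixed-in
  distribution, so to first order it drops out of the difference of the two values.\<close>

definition kb :: "'s \<Rightarrow> real" where "kb s = (\<integral>a. k (s, a) \<partial>pol s)"
definition wF :: "('s \<Rightarrow> real) \<Rightarrow> 's \<Rightarrow> real" where "wF F s = (\<integral>a. k (s, a) * integral\<^sup>L (p (s, a)) F \<partial>pol s)"

lemma kb_measurable: "kb \<in> borel_measurable S"
  unfolding kb_def[abs_def] by (rule integral_kernel_measurable[OF _ pol]) (use k_meas in simp)

lemma kb_range: "s \<in> space S \<Longrightarrow> 0 \<le> kb s \<and> kb s \<le> e"
  unfolding kb_def using k_range pair_space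
  by (intro conjI integral_prob_ge[OF kernelD[OF pol] section_measurable[OF k_meas], of _ _ e]
      integral_prob_le[OF kernelD[OF pol] section_measurable[OF k_meas], of _ _ e]) auto

context
  fixes F :: "'s \<Rightarrow> real" and B :: real
  assumes F: "F \<in> borel_measurable S" "\<And>s. s \<in> space S \<Longrightarrow> 0 \<le> F s \<and> F s \<le> B"
begin

lemma F_abs: "s \<in> space S \<Longrightarrow> \<bar>F s\<bar> \<le> B"
  using F(2)[of s] by auto

lemma pF_measurable: "(\<lambda>x. integral\<^sup>L (p x) F) \<in> borel_measurable (S \<Otimes>\<^sub>M A)"
  by (rule integral_kernel_measurable1[OF F(1) p])

lemma pF_range:
  assumes x: "x \<in> space (S \<Otimes>\<^sub>M A)" shows "0 \<le> integral\<^sup>L (p x) F \<and> integral\<^sup>L (p x) F \<le> B"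
  using integral_prob_ge[OF kernelD[OF p x] F(1) F_abs, of 0] integral_prob_le[OF kernelD[OF p x] F(1) F_abs, of B] F(2)
  by auto

lemma kpF_range:
  assumes x: "x \<in> space (S \<Otimes>\<^sub>M A)"
  shows "0 \<le> k x * integral\<^sup>L (p x) F \<and> k x * integral\<^sup>L (p x) F \<le> e * B"
  using pF_range[OF x] k_range[OF x] e by (auto intro!: mult_mono)

lemma kpF_measurable: "(\<lambda>x. k x * integral\<^sup>L (p x) F) \<in> borel_measurable (S \<Otimes>\<^sub>M A)"
  using k_meas pF_measurable by measurable

lemma wF_measurable: "wF F \<in> borel_measurable S"
  unfolding wF_def[abs_def] by (rule integral_kernel_measurable[OF _ pol]) (use kpF_measurable in simp)

lemma wF_range: "s \<in> space S \<Longrightarrow> 0 \<le> wF F s \<and> wF F s \<le> e * B"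
  unfolding wF_def using kpF_range pair_space
  by (intro conjI integral_prob_ge[OF kernelD[OF pol] section_measurable[OF kpF_measurable], of _ _ "e * B"]
      integral_prob_le[OF kernelD[OF pol] section_measurable[OF kpF_measurable], of _ _ "e * B"]) auto

lemma integral_pstep_mix:
  assumes u: "is_density u" and s: "s \<in> space S"
  shows "integral\<^sup>L (pstep (mix u) pol s) F = integral\<^sup>L (pstep p pol s) F + integral\<^sup>L (dens u) F * kb s - wF F s"
proof -
  note P = kernelD[OF pol s]
  have sp: "a \<in> space (pol s) \<Longrightarrow> (s, a) \<in> space (S \<Otimes>\<^sub>M A)" for a
    using prob_algebraD(3)[OF P] pair_space[OF s] by simp
  have i1: "integrable (pol s) (\<lambda>a. integral\<^sup>L (p (s, a)) F)"
    using pF_range pair_space[OF s] by (intro integrable_prob_bounded[OF P section_measurable[OF pF_measurable s], of B]) auto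
  have i2: "integrable (pol s) (\<lambda>a. k (s, a))"
    using k_range pair_space[OF s] by (intro integrable_prob_bounded[OF P section_measurable[OF k_meas s], of e]) auto
  have i3: "integrable (pol s) (\<lambda>a. k (s, a) * integral\<^sup>L (p (s, a)) F)"
    using kpF_range pair_space[OF s] by (intro integrable_prob_bounded[OF P section_measurable[OF kpF_measurable s], of "e * B"]) auto
  have "integral\<^sup>L (pstep (mix u) pol s) F = (\<integral>a. integral\<^sup>L (mix u (s, a)) F \<partial>pol s)"
    by (rule integral_pstep[OF pol mix_kernel[OF u] s F(1) F_abs])
  also have "\<dots> = (\<integral>a. integral\<^sup>L (p (s, a)) F + integral\<^sup>L (dens u) F * k (s, a) - k (s, a) * integral\<^sup>L (p (s, a)) F \<partial>pol s)"
    using integral_mix[OF u sp F(1) F_abs]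
    by (intro Bochner_Integration.integral_cong refl) (simp add: algebra_simps)
  also have "\<dots> = (\<integral>a. integral\<^sup>L (p (s, a)) F \<partial>pol s) + integral\<^sup>L (dens u) F * kb s - wF F s"
    using i1 i2 i3 unfolding kb_def wF_def by simp
  also have "(\<integral>a. integral\<^sup>L (p (s, a)) F \<partial>pol s) = integral\<^sup>L (pstep p pol s) F"
    using integral_pstep[OF pol p s F(1) F_abs] by simp
  finally show ?thesis .
qed

lemma pstep_mix_close:
  assumes u: "is_density u" and s: "s \<in> space S"
  shows "\<bar>integral\<^sup>L (pstep (mix u) pol s) F - integral\<^sup>L (pstep p pol s) F\<bar> \<le> e * B"
proof -
  have "0 \<le> integral\<^sup>L (dens u) F" "integral\<^sup>L (dens u) F \<le> B"
    using integral_prob_ge[OF is_densityD(4)[OF u] F(1) F_abs, of 0]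
      integral_prob_le[OF is_densityD(4)[OF u] F(1) F_abs, of B] F(2) by auto
  then have "0 \<le> integral\<^sup>L (dens u) F * kb s" "integral\<^sup>L (dens u) F * kb s \<le> B * e"
    using kb_range[OF s] by (auto intro!: mult_mono)
  then show ?thesis using integral_pstep_mix[OF u s] wF_range[OF s] unfolding mult.commute[of B e] by linarith
qed

lemma kchain_mix_close:
  assumes u: "is_density u" and xi: "xi \<in> space (prob_algebra S)"
  shows "\<bar>integral\<^sup>L (kchain (pstep (mix u) pol) xi n) F - integral\<^sup>L (kchain (pstep p pol) xi n) F\<bar> \<le> real n * (e * B)"
  by (rule kchain_perturbation[OF pstep_kernel[OF pol p] pstep_kernel[OF pol mix_kernel[OF u]] _ xi F])
    (rule mixture_mdp.pstep_mix_close[OF mixture_mdp_axioms _ _ u]; auto)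

end

lemma nn_integral_kchain_mix_ge:
  assumes u: "is_density u" and xi: "xi \<in> space (prob_algebra S)" and F: "F \<in> borel_measurable S"
  shows "ennreal (1 - e) ^ n * integral\<^sup>N (kchain (pstep p pol) xi n) F \<le> integral\<^sup>N (kchain (pstep (mix u) pol) xi n) F"
proof (rule nn_integral_kchain_mono[OF pstep_kernel[OF pol p] pstep_kernel[OF pol mix_kernel[OF u]] _ xi F])
  fix G :: "'s \<Rightarrow> ennreal" and s assume G: "G \<in> borel_measurable S" and s: "s \<in> space S"
  note P = prob_algebraD[OF kernelD[OF pol s]]
  have m: "(\<lambda>a. integral\<^sup>N (p (s, a)) G) \<in> borel_measurable (pol s)"
    unfolding P(4) by (rule measurable_compose[OF measurable_Pair1'[OF s] nn_integral_kernel_measurable1[OF G p]])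
  have "ennreal (1 - e) * integral\<^sup>N (pstep p pol s) G = (\<integral>\<^sup>+a. ennreal (1 - e) * integral\<^sup>N (p (s, a)) G \<partial>pol s)"
    unfolding nn_integral_pstep[OF pol p s G] by (rule nn_integral_cmult[OF m, symmetric])
  also have "\<dots> \<le> (\<integral>\<^sup>+a. integral\<^sup>N (mix u (s, a)) G \<partial>pol s)"
    using P(3) by (intro nn_integral_mono nn_integral_mix_ge[OF u _ G]) (auto intro: pair_space s)
  finally show "ennreal (1 - e) * integral\<^sup>N (pstep p pol s) G \<le> integral\<^sup>N (pstep (mix u) pol s) G"
    unfolding nn_integral_pstep[OF pol mix_kernel[OF u] s G] .
qed

context
  fixes rb :: "'s \<Rightarrow> real" and xi :: "'s measure"
  assumes rb: "rb \<in> borel_measurable S" "\<And>s. s \<in> space S \<Longrightarrow> 0 \<le> rb s \<and> rb s \<le> 1"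
    and xi: "xi \<in> space (prob_algebra S)"
begin

abbreviation "V \<equiv> value_fun (pstep p pol) rb"

lemma V_measurable: "V j \<in> borel_measurable S"
  by (rule value_fun_measurable[OF pstep_kernel[OF pol p] rb])

lemma V_range: "s \<in> space S \<Longrightarrow> 0 \<le> V j s \<and> V j s \<le> real (Suc j)"
  using value_fun_range[OF pstep_kernel[OF pol p] rb] by blast

lemma value_mix_diff:
  assumes u: "is_density u"
  shows "(\<Sum>j\<le>n. integral\<^sup>L (kchain (pstep (mix u) pol) xi j) rb) - (\<Sum>j\<le>n. integral\<^sup>L (kchain (pstep p pol) xi j) rb)
    = (\<Sum>h<n. integral\<^sup>L (dens u) (V (n - Suc h)) * integral\<^sup>L (kchain (pstep (mix u) pol) xi h) kb
        - integral\<^sup>L (kchain (pstep (mix u) pol) xi h) (wF (V (n - Suc h))))"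
proof (rule trans[OF performance_difference[OF pstep_kernel[OF pol p] pstep_kernel[OF pol mix_kernel[OF u]] rb xi]
      sum.cong[OF refl]], assumption)
  fix h
  let ?D = "kchain (pstep (mix u) pol) xi h" and ?V = "V (n - Suc h)"
  note D = kchain_prob[OF pstep_kernel[OF pol mix_kernel[OF u]] xi, of h]
  note V = V_measurable[of "n - Suc h"] V_range[of _ "n - Suc h"]
  have i: "integrable ?D kb" "integrable ?D (wF ?V)"
    using kb_range integrable_prob_bounded[OF D kb_measurable, of e] integrable_prob_bounded[OF D wF_measurable[OF V], of "e * real (Suc (n - Suc h))"]
      wF_range[OF V] by auto
  have "(\<integral>s. (integral\<^sup>L (pstep (mix u) pol s) ?V - integral\<^sup>L (pstep p pol s) ?V) \<partial>?D)
     = (\<integral>s. (integral\<^sup>L (dens u) ?V * kb s - wF ?V s) \<partial>?D)"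
    using integral_pstep_mix[OF V u] prob_algebraD(3)[OF D]
    by (intro Bochner_Integration.integral_cong refl) simp
  also have "\<dots> = integral\<^sup>L (dens u) ?V * integral\<^sup>L ?D kb - integral\<^sup>L ?D (wF ?V)"
    using i by simp
  finally show "(\<integral>s. (integral\<^sup>L (pstep (mix u) pol s) ?V - integral\<^sup>L (pstep p pol s) ?V) \<partial>?D)
    = integral\<^sup>L (dens u) ?V * integral\<^sup>L ?D kb - integral\<^sup>L ?D (wF ?V)" .
qed

text \<open>To first order, step h contributes the difference of the two means of V, at least (3/4 -
  1/4)(n - h), times the mean of \<open>kb\<close>. The error comes from replacing the perturbed
  chains by the original one: \<open>kb\<close> is at most e and costs T = h e^2, with weights 3/4
  and 1/4 times N = n - h; the two \<open>wF\<close> terms cost T N each. Together this is 3 T N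
  \<le> 3 n^2 e^2 per step.\<close>

lemma value_gap:
  assumes u: "is_density u" and d: "is_density d"
    and up: "\<And>j. j < n \<Longrightarrow> integral\<^sup>L (dens u) (V j) \<ge> 3/4 * real (Suc j)"
    and down: "\<And>j. j < n \<Longrightarrow> integral\<^sup>L (dens d) (V j) \<le> 1/4 * real (Suc j)"
  shows "(\<Sum>h<n. real (n - h) * integral\<^sup>L (kchain (pstep p pol) xi h) kb) / 2 - 3 * real n ^ 3 * e\<^sup>2
    \<le> (\<Sum>j\<le>n. integral\<^sup>L (kchain (pstep (mix u) pol) xi j) rb) - (\<Sum>j\<le>n. integral\<^sup>L (kchain (pstep (mix d) pol) xi j) rb)"
proof -
  let ?Eu = "\<lambda>h. integral\<^sup>L (kchain (pstep (mix u) pol) xi h)" and ?Ed = "\<lambda>h. integral\<^sup>L (kchain (pstep (mix d) pol) xi h)"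
  let ?E = "\<lambda>h. integral\<^sup>L (kchain (pstep p pol) xi h)"
  have step: "real (n - h) * ?E h kb / 2 - 3 * real n ^ 2 * e\<^sup>2
    \<le> (integral\<^sup>L (dens u) (V (n - Suc h)) * ?Eu h kb - ?Eu h (wF (V (n - Suc h))))
      - (integral\<^sup>L (dens d) (V (n - Suc h)) * ?Ed h kb - ?Ed h (wF (V (n - Suc h))))" if h: "h < n" for h
  proof -
    define j where "j = n - Suc h"
    have j: "j < n" "real (Suc j) = real (n - h)" using h by (auto simp: j_def)
    note V = V_measurable[of j] V_range[of _ j]
    note ku = kchain_mix_close[OF kb_measurable kb_range u xi, of h] and kd = kchain_mix_close[OF kb_measurable kb_range d xi, of h]
    note wu = kchain_mix_close[OF wF_measurable[OF V] wF_range[OF V] u xi, of h]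
      and wd = kchain_mix_close[OF wF_measurable[OF V] wF_range[OF V] d xi, of h]
    define T where "T = real h * (e * e)"
    define N where "N = real (n - h)"
    have T0: "0 \<le> T" by (simp add: T_def)
    have N: "0 \<le> N" "N \<le> real n" by (auto simp: N_def)
    have nonneg: "0 \<le> ?Eu h kb" "0 \<le> ?Ed h kb"
      using kb_range by (intro Bochner_Integration.integral_nonneg_AE AE_I2;
        simp add: prob_algebraD(3)[OF kchain_prob[OF pstep_kernel[OF pol mix_kernel[OF u]] xi]]
          prob_algebraD(3)[OF kchain_prob[OF pstep_kernel[OF pol mix_kernel[OF d]] xi]])+
    have a: "3/4 * N * ?Eu h kb \<le> integral\<^sup>L (dens u) (V j) * ?Eu h kb"
      using up[OF j(1)] j(2) nonneg by (intro mult_right_mono) (auto simp: N_def)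
    have b: "integral\<^sup>L (dens d) (V j) * ?Ed h kb \<le> 1/4 * N * ?Ed h kb"
      using down[OF j(1)] j(2) nonneg by (intro mult_right_mono) (auto simp: N_def)
    have "?E h kb - T \<le> ?Eu h kb" "?Ed h kb \<le> ?E h kb + T" using ku kd unfolding T_def by linarith+
    then have c: "3/4 * N * (?E h kb - T) \<le> 3/4 * N * ?Eu h kb" "1/4 * N * ?Ed h kb \<le> 1/4 * N * (?E h kb + T)"
      using N by (intro mult_left_mono; simp)+
    have w: "?Eu h (wF (V j)) - ?Ed h (wF (V j)) \<le> 2 * (T * N)"
      using wu wd unfolding T_def N_def j(2) by (simp add: algebra_simps abs_le_iff)
    have "T * N \<le> (real n * (e * e)) * real n"
      unfolding T_def using h N e by (intro mult_mono) auto
    then have t: "T * N \<le> real n ^ 2 * e\<^sup>2" by (simp add: power2_eq_square mult_ac)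
    have "N * ?E h kb / 2 - 3 * (T * N) \<le> 3/4 * N * (?E h kb - T) - 1/4 * N * (?E h kb + T) - 2 * (T * N)"
      by (simp add: algebra_simps)
    then show ?thesis using a b c w t unfolding j_def[symmetric] N_def[symmetric] by linarith
  qed
  have "(\<Sum>h<n. real (n - h) * ?E h kb) / 2 - 3 * real n ^ 3 * e\<^sup>2 = (\<Sum>h<n. real (n - h) * ?E h kb / 2 - 3 * real n ^ 2 * e\<^sup>2)"
    by (simp add: sum_subtractf sum_divide_distrib power3_eq_cube power2_eq_square mult_ac)
  also have "\<dots> \<le> (\<Sum>h<n. (integral\<^sup>L (dens u) (V (n - Suc h)) * ?Eu h kb - ?Eu h (wF (V (n - Suc h))))
      - (integral\<^sup>L (dens d) (V (n - Suc h)) * ?Ed h kb - ?Ed h (wF (V (n - Suc h)))))"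
    by (intro sum_mono step) simp
  also have "\<dots> = (\<Sum>j\<le>n. ?Eu j rb) - (\<Sum>j\<le>n. ?Ed j rb)"
    using value_mix_diff[OF u, of n] value_mix_diff[OF d, of n] by (simp add: sum_subtractf)
  finally show ?thesis .
qed

end
end

section \<open>Ingredients of the two-point argument\<close>

text \<open>The infimum over states may fail to be measurable, so it cannot simply be normalised.
  Its integral is a supremum over simple functions below it, one of which has mass above c / 2; that
  function, normalised, is \<open>u\<close>. Its mass exceeding c / 2 is what keeps c / 2 times
  \<open>u\<close> below every \<open>f y\<close>.\<close>

lemma density_below_infimum:
  fixes f :: "'y \<Rightarrow> 's \<Rightarrow> real" and S \<mu> :: "'s measure"
  assumes \<mu>: "sets \<mu> = sets S" and B: "B \<in> sets S" and c: "0 < c"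
    and int: "(\<integral>\<^sup>+ s'\<in>B. ennreal (INF y\<in>Y. f y s') \<partial>\<mu>) \<ge> ennreal c"
    and nonneg: "\<And>y s'. y \<in> Y \<Longrightarrow> s' \<in> space S \<Longrightarrow> 0 \<le> f y s'"
    and y0: "y0 \<in> Y" and prob: "(\<integral>\<^sup>+s'. ennreal (f y0 s') \<partial>\<mu>) = 1"
  obtains u where "u \<in> borel_measurable S" "\<And>s. s \<in> space S \<Longrightarrow> 0 \<le> u s" "(\<integral>\<^sup>+s. ennreal (u s) \<partial>\<mu>) = 1"
    "\<And>y s. y \<in> Y \<Longrightarrow> s \<in> space S \<Longrightarrow> c / 2 * u s \<le> f y s" "\<And>s. s \<in> space S \<Longrightarrow> s \<notin> B \<Longrightarrow> u s = 0"
proof -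
  have sp: "space \<mu> = space S" using \<mu> by (rule sets_eq_imp_space_eq)
  let ?F = "\<lambda>s'. ennreal (INF y\<in>Y. f y s') * indicator B s'"
  have "ennreal (c / 2) < ennreal c" using c by (simp add: ennreal_less_iff)
  also have "\<dots> \<le> integral\<^sup>N \<mu> ?F" by (rule int)
  finally obtain g where g: "simple_function \<mu> g" "g \<le> ?F" and cg: "ennreal (c / 2) < integral\<^sup>S \<mu> g"
    unfolding nn_integral_def less_SUP_iff by blast
  have gm[measurable]: "g \<in> borel_measurable \<mu>" using g(1) by (rule borel_measurable_simple_function)
  define I where "I = integral\<^sup>N \<mu> g"
  have I: "ennreal (c / 2) < I" using cg nn_integral_eq_simple_integral[OF g(1)] by (simp add: I_def)
  have gf: "g s \<le> ennreal (f y s)" if "y \<in> Y" "s \<in> space S" for y s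
  proof -
    have "(INF y\<in>Y. f y s) \<le> f y s"
      using nonneg that by (intro cINF_lower bdd_belowI2[where m=0]) auto
    then have "?F s \<le> ennreal (f y s)" by (auto intro: ennreal_leI split: split_indicator)
    then show ?thesis using g(2) by (auto simp: le_fun_def intro: order_trans)
  qed
  \<comment> \<open>The mass is finite because \<open>g\<close> lies below the probability density
    \<open>f y0\<close>; this makes the normalisation legitimate.\<close>
  have "I \<le> 1"
    unfolding I_def prob[symmetric] using gf[OF y0] sp by (intro nn_integral_mono) auto
  then have Ifin: "I \<noteq> top" by (rule neq_top_trans[rotated]) simp
  then have Ir: "ennreal (enn2real I) = I" by (simp add: ennreal_enn2real_if)
  have "ennreal (c / 2) < ennreal (enn2real I)" using I by (simp add: Ir)
  then have Ipos: "c / 2 < enn2real I" using c by (subst (asm) ennreal_less_iff) auto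
  then have I0: "0 < enn2real I" using c by linarith
  have gfin: "g s \<noteq> top" if "s \<in> space S" for s using gf[OF y0 that] by (rule neq_top_trans[rotated]) simp
  define u where "u s = enn2real (g s) / enn2real I" for s
  show thesis
  proof
    have "u \<in> borel_measurable \<mu>" unfolding u_def[abs_def] by measurable
    then show "u \<in> borel_measurable S" unfolding measurable_cong_sets[OF \<mu> refl] .
    show "0 \<le> u s" for s by (simp add: u_def)
    have "(\<integral>\<^sup>+s. ennreal (u s) \<partial>\<mu>) = (\<integral>\<^sup>+s. g s / I \<partial>\<mu>)"
    proof (rule nn_integral_cong)
      fix s assume "s \<in> space \<mu>"
      then have "ennreal (enn2real (g s)) = g s" using gfin[of s] sp by (simp add: ennreal_enn2real_if)
      then show "ennreal (u s) = g s / I"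
        using I0 Ir by (simp add: u_def divide_ennreal[symmetric])
    qed
    also have "\<dots> = I / I" unfolding I_def by (rule nn_integral_divide) measurable
    also have "\<dots> = 1" using I Ifin by (intro ennreal_divide_self) (auto simp: top.not_eq_extremum)
    finally show "(\<integral>\<^sup>+s. ennreal (u s) \<partial>\<mu>) = 1" .
    show "c / 2 * u s \<le> f y s" if y: "y \<in> Y" and s: "s \<in> space S" for y s
    proof -
      have "enn2real (g s) \<le> f y s"
        using enn2real_mono[OF gf[OF y s]] nonneg[OF y s] by simp
      have "c / 2 * u s \<le> enn2real I * u s" using Ipos by (intro mult_right_mono) (auto simp: u_def)
      also have "\<dots> = enn2real (g s)" using I0 by (simp add: u_def)
      finally show ?thesis using \<open>enn2real (g s) \<le> f y s\<close> by simp
    qed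
    show "u s = 0" if "s \<notin> B" for s
    proof -
      have "g s \<le> 0" using g(2) that by (auto simp: le_fun_def dest!: spec[of _ s])
      then show ?thesis by (simp add: u_def)
    qed
  qed
qed

text \<open>The estimator becomes a test by comparing it with the midpoint of the two values: on the
  wrong side it errs by at least half the gap. If both errors had probability below 1/6, the event
  \<open>B\<close> would have probability above 5/6 under \<open>P1\<close> and below 1/6 under
  \<open>P2\<close>, against 25/36 > 3 * 1/6.\<close>

lemma two_point_lower_bound:
  fixes v1 v2 t :: real
  assumes P1: "prob_space P1" and P2: "prob_space P2" and sets: "sets P1 = sets M" "sets P2 = sets M"
    and v[measurable]: "v \<in> borel_measurable M"
    and dom: "\<And>B. B \<in> sets M \<Longrightarrow> (emeasure P1 B)\<^sup>2 \<le> 3 * emeasure P2 B"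
    and gap: "2 * t \<le> v1 - v2"
  shows "1/6 \<le> emeasure P1 {D \<in> space M. t \<le> \<bar>v1 - v D\<bar>} \<or> 1/6 \<le> emeasure P2 {D \<in> space M. t \<le> \<bar>v2 - v D\<bar>}"
proof -
  interpret P1: prob_space P1 by fact
  interpret P2: prob_space P2 by fact
  define B where "B = {D \<in> space M. (v1 + v2) / 2 \<le> v D}"
  have B[measurable]: "B \<in> sets M" unfolding B_def by measurable
  have sp: "space P1 = space M" "space P2 = space M" using sets by (auto dest: sets_eq_imp_space_eq)
  have "emeasure P1 (space M - B) \<le> emeasure P1 {D \<in> space M. t \<le> \<bar>v1 - v D\<bar>}"
    using gap by (intro emeasure_mono) (auto simp: B_def sets abs_if field_simps)
  then have 1: "ennreal (1 - P1.prob B) \<le> emeasure P1 {D \<in> space M. t \<le> \<bar>v1 - v D\<bar>}"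
    using P1.prob_compl[of B] B sets sp by (simp add: P1.emeasure_eq_measure)
  have "emeasure P2 B \<le> emeasure P2 {D \<in> space M. t \<le> \<bar>v2 - v D\<bar>}"
    using gap by (intro emeasure_mono) (auto simp: B_def sets abs_if field_simps)
  then have 2: "ennreal (P2.prob B) \<le> emeasure P2 {D \<in> space M. t \<le> \<bar>v2 - v D\<bar>}"
    by (simp add: P2.emeasure_eq_measure)
  have "ennreal ((P1.prob B)\<^sup>2) \<le> ennreal (3 * P2.prob B)"
    using dom[OF B] by (simp add: P1.emeasure_eq_measure P2.emeasure_eq_measure ennreal_power ennreal_mult)
  then have 3: "(P1.prob B)\<^sup>2 \<le> 3 * P2.prob B" by (subst (asm) ennreal_le_iff) auto
  have "1/6 \<le> 1 - P1.prob B \<or> 1/6 \<le> P2.prob B"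
  proof (rule ccontr)
    assume "\<not> ?thesis"
    then have a: "5/6 < P1.prob B" "P2.prob B < 1/6" by auto
    have "(5/6)\<^sup>2 \<le> (P1.prob B)\<^sup>2" using a by (intro power_mono) auto
    then show False using 3 a by (simp add: power2_eq_square)
  qed
  moreover have "ennreal (1/6) = 1/6" by (simp add: divide_ennreal[symmetric])
  ultimately have "1/6 \<le> ennreal (1 - P1.prob B) \<or> 1/6 \<le> ennreal (P2.prob B)"
    using ennreal_leI by metis
  then show ?thesis using order_trans[OF _ 1] order_trans[OF _ 2] by blast
qed

text \<open>All conditions hold strictly at e = 0 and are continuous there. The last one is the gap
  condition with sqrt(c / N) divided out: 12 is half of 24, and 495/1000 is half of the 99/100 by
  which the direction attains the maximum. At e = 0 it reduces to sqrt 32 < 5.94. The power 3 H and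
  the bound 4 serve the second moment of the likelihood ratio.\<close>

lemma small_perturbation:
  fixes \<rho> c L :: real
  assumes "0 < \<rho>" "0 < c"
  obtains e0 where "0 < e0" "\<And>e. 0 \<le> e \<Longrightarrow> e \<le> e0 \<Longrightarrow> e \<le> 1/2 \<and> (1 + 4 * e / c) ^ (3 * H) \<le> 4
    \<and> (\<rho> + real H ^ 3 * e * L) / sqrt ((1 - e) ^ H) / 12 \<le> 495/1000 * \<rho> / sqrt 32 - 3 * real H ^ 3 * e * L / sqrt 32"
proof -
  let ?f = "\<lambda>e. 495/1000 * \<rho> / sqrt 32 - 3 * real H ^ 3 * e * L / sqrt 32
       - (\<rho> + real H ^ 3 * e * L) / sqrt ((1 - e) ^ H) / 12"
  have "(?f \<longlongrightarrow> 495/1000 * \<rho> / sqrt 32 - 3 * real H ^ 3 * 0 * L / sqrt 32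
       - (\<rho> + real H ^ 3 * 0 * L) / sqrt ((1 - 0) ^ H) / 12) (at (0::real))"
    by (intro tendsto_intros) auto
  moreover have "sqrt 32 < 495/1000 * 12" by (rule real_less_lsqrt) (auto simp: power2_eq_square)
  then have "0 < 495/1000 * \<rho> / sqrt 32 - \<rho> / 12" using assms by (simp add: field_simps)
  ultimately have 1: "\<forall>\<^sub>F e in at 0. 0 < ?f e"
    by (intro order_tendstoD(1)) auto
  have "((\<lambda>e. (1 + 4 * e / c) ^ (3 * H)) \<longlongrightarrow> (1 + 4 * 0 / c) ^ (3 * H)) (at (0::real))"
    using assms by (intro tendsto_intros) auto
  then have 2: "\<forall>\<^sub>F e in at 0. (1 + 4 * e / c) ^ (3 * H) < 4"
    by (intro order_tendstoD(2)) auto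
  from eventually_conj[OF 1 2] obtain \<delta> where \<delta>: "0 < \<delta>"
    "\<And>e. e \<noteq> 0 \<Longrightarrow> \<bar>e\<bar> < \<delta> \<Longrightarrow> 0 < ?f e \<and> (1 + 4 * e / c) ^ (3 * H) < 4"
    unfolding eventually_at by (auto simp: dist_real_def)
  \<comment> \<open>The punctured limit says nothing about e = 0 itself.\<close>
  have z: "0 < ?f 0 \<and> (1 + 4 * 0 / c) ^ (3 * H) < 4"
    using \<open>0 < 495/1000 * \<rho> / sqrt 32 - \<rho> / 12\<close> by simp
  show thesis
  proof
    show "0 < min (1/2) (\<delta> / 2)" using \<delta> by simp
    fix e :: real assume e: "0 \<le> e" "e \<le> min (1/2) (\<delta> / 2)"
    have "0 < ?f e \<and> (1 + 4 * e / c) ^ (3 * H) < 4"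
      using z \<delta>(2)[of e] e \<delta>(1) by (cases "e = 0") auto
    then show "e \<le> 1/2 \<and> (1 + 4 * e / c) ^ (3 * H) \<le> 4
      \<and> (\<rho> + real H ^ 3 * e * L) / sqrt ((1 - e) ^ H) / 12 \<le> 495/1000 * \<rho> / sqrt 32 - 3 * real H ^ 3 * e * L / sqrt 32"
      using e by auto
  qed
qed

section \<open>The covariance matrix as a quadratic form\<close>

lemma matrix_inv_inverse:
  assumes "invertible M"
  shows "M ** matrix_inv M = mat 1" "matrix_inv M ** M = mat 1"
  using someI_ex[OF assms[unfolded invertible_def]] unfolding matrix_inv_def by auto

lemma matrix_form_integral:
  fixes \<phi> :: "'x \<Rightarrow> real^'d"
  assumes "integrable M (\<lambda>x. (\<chi> i j. \<phi> x $ i * \<phi> x $ j))"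
  shows "y \<bullet> ((\<integral>x. (\<chi> i j. \<phi> x $ i * \<phi> x $ j) \<partial>M) *v w) = (\<integral>x. (\<phi> x \<bullet> y) * (\<phi> x \<bullet> w) \<partial>M)"
proof -
  have "linear (\<lambda>M::real^'d^'d. y \<bullet> (M *v w))"
    by (rule linearI) (simp_all add: matrix_vector_mult_add_rdistrib inner_add_right scaleR_matrix_vector_assoc[symmetric])
  then have "bounded_linear (\<lambda>M::real^'d^'d. y \<bullet> (M *v w))" by (simp add: linear_conv_bounded_linear)
  from integral_bounded_linear[OF this assms]
  have "y \<bullet> ((\<integral>x. (\<chi> i j. \<phi> x $ i * \<phi> x $ j) \<partial>M) *v w) = (\<integral>x. y \<bullet> ((\<chi> i j. \<phi> x $ i * \<phi> x $ j) *v w) \<partial>M)" by simp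
  moreover have "y \<bullet> ((\<chi> i j. \<phi> x $ i * \<phi> x $ j) *v w) = (\<phi> x \<bullet> y) * (\<phi> x \<bullet> w)" for x
  proof -
    have "(\<chi> i j. \<phi> x $ i * \<phi> x $ j) *v w = (\<phi> x \<bullet> w) *\<^sub>R \<phi> x"
      by (simp add: vec_eq_iff matrix_vector_mult_def inner_vec_def sum_distrib_left sum_distrib_right mult_ac)
    then show ?thesis by (simp add: inner_commute)
  qed
  ultimately show ?thesis by simp
qed

lemma integrable_outer:
  fixes \<phi> :: "'x \<Rightarrow> real^'d"
  assumes M: "M \<in> space (prob_algebra X)" and \<phi>[measurable]: "\<phi> \<in> borel_measurable X"
    and b: "\<And>x. x \<in> space X \<Longrightarrow> norm (\<phi> x) \<le> B"
  shows "integrable M (\<lambda>x. (\<chi> i j. \<phi> x $ i * \<phi> x $ j))"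
proof -
  interpret prob_space M using prob_algebraD[OF M] by simp
  have nb: "norm (\<chi> i j. \<phi> x $ i * \<phi> x $ j) \<le> real CARD('d) * B\<^sup>2" if x: "x \<in> space X" for x
  proof -
    have "norm (\<chi> i j. \<phi> x $ i * \<phi> x $ j) \<le> (\<Sum>i\<in>UNIV. norm ((\<chi> i j. \<phi> x $ i * \<phi> x $ j) $ i))"
      unfolding norm_vec_def[of "\<chi> i j. \<phi> x $ i * \<phi> x $ j"] by (rule L2_set_le_sum) simp
    also have "\<dots> = (\<Sum>i\<in>UNIV. \<bar>\<phi> x $ i\<bar> * norm (\<phi> x))"
    proof (rule sum.cong[OF refl])
      fix i
      have "(\<chi> i j. \<phi> x $ i * \<phi> x $ j) $ i = (\<phi> x $ i) *\<^sub>R \<phi> x" by (simp add: vec_eq_iff)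
      then show "norm ((\<chi> i j. \<phi> x $ i * \<phi> x $ j) $ i) = \<bar>\<phi> x $ i\<bar> * norm (\<phi> x)" by simp
    qed
    also have "\<dots> \<le> (\<Sum>i\<in>(UNIV::'d set). B * B)"
      using b[OF x] component_le_norm_cart[of "\<phi> x"] norm_ge_zero[of "\<phi> x"]
        order_trans[OF norm_ge_zero b[OF x]]
      by (intro sum_mono mult_mono) (auto intro: order_trans)
    finally show ?thesis by (simp add: power2_eq_square)
  qed
  have c: "(\<lambda>x. \<phi> x $ i) \<in> borel_measurable X" for i
  proof -
    have "(\<lambda>x. \<phi> x \<bullet> axis i 1) \<in> borel_measurable X" by measurable
    then show ?thesis by (simp add: inner_axis)
  qed
  have "(\<lambda>x. (\<chi> i j. \<phi> x $ i * \<phi> x $ j)) \<in> borel_measurable X"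
    unfolding borel_measurable_euclidean_space[where f="\<lambda>x. (\<chi> i j. \<phi> x $ i * \<phi> x $ j)"]
    using c by (auto simp: Basis_vec_def inner_axis)
  then show ?thesis
    using nb prob_algebraD[OF M] by (intro integrable_const_bound[where B="real CARD('d) * B\<^sup>2"]) auto
qed

context
  fixes \<phi> :: "'x \<Rightarrow> real^'d" and X :: "'x measure" and D :: "nat \<Rightarrow> 'x measure" and H :: nat and \<Sigma> :: "real^'d^'d" and C :: real
  assumes D: "\<And>h. D h \<in> space (prob_algebra X)" and \<phi>: "\<phi> \<in> borel_measurable X"
    and \<Sigma>: "\<Sigma> = (1 / real H) *\<^sub>R (\<Sum>h<H. \<integral>x. (\<chi> i j. \<phi> x $ i * \<phi> x $ j) \<partial>D h)"
    and inv: "invertible \<Sigma>"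
    and bound: "\<And>x. x \<in> space X \<Longrightarrow> \<phi> x \<bullet> (matrix_inv \<Sigma> *v \<phi> x) \<le> C"
begin

lemma covariance_form_aux:
  "y \<bullet> (\<Sigma> *v w) = 1 / real H * (\<Sum>h<H. y \<bullet> ((\<integral>x. (\<chi> i j. \<phi> x $ i * \<phi> x $ j) \<partial>D h) *v w))"
proof -
  have "(\<Sum>h\<in>I. G h) *v w = (\<Sum>h\<in>I. G h *v w)" if "finite I" for I :: "nat set" and G :: "nat \<Rightarrow> real^'d^'d"
    using that by induction (auto simp: matrix_vector_mult_add_rdistrib)
  then show ?thesis unfolding \<Sigma>
    by (simp add: scaleR_matrix_vector_assoc[symmetric] inner_sum_right)
qed

text \<open>A non-integrable outer product contributes the junk value \<open>0\<close>, which is still a positive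
  semidefinite form; so boundedness of \<open>\<phi>\<close> can be derived before integrability is known.\<close>
lemma covariance_psd:
  "x \<bullet> (\<Sigma> *v y) = y \<bullet> (\<Sigma> *v x)" "0 \<le> x \<bullet> (\<Sigma> *v x)"
proof -
  let ?T = "\<lambda>h. \<integral>x. (\<chi> i j. \<phi> x $ i * \<phi> x $ j) \<partial>D h"
  have 1: "x \<bullet> (?T h *v y) = y \<bullet> (?T h *v x) \<and> 0 \<le> x \<bullet> (?T h *v x)" for h
  proof (cases "integrable (D h) (\<lambda>x. (\<chi> i j. \<phi> x $ i * \<phi> x $ j))")
    case True
    then show ?thesis by (simp add: matrix_form_integral mult.commute)
  next
    case False
    then show ?thesis by (simp add: not_integrable_integral_eq)
  qed
  show "x \<bullet> (\<Sigma> *v y) = y \<bullet> (\<Sigma> *v x)" unfolding covariance_form_aux using 1 by simp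
  show "0 \<le> x \<bullet> (\<Sigma> *v x)" unfolding covariance_form_aux using 1 by (simp add: sum_nonneg)
qed

text \<open>Cauchy-Schwarz for the form of \<Sigma>, applied to \<open>w\<close> and to the inverse
  image of \<open>\<phi> x\<close> under \<Sigma>, whose own form value is the quantity bounded by
  \<open>C\<close>.\<close>

lemma feature_bound_aux:
  assumes x: "x \<in> space X"
  shows "(\<phi> x \<bullet> w)\<^sup>2 \<le> C * (w \<bullet> (\<Sigma> *v w))"
proof -
  let ?y = "matrix_inv \<Sigma> *v \<phi> x"
  have "\<Sigma> ** matrix_inv \<Sigma> = mat 1" using inv by (rule matrix_inv_inverse)
  then have y: "\<Sigma> *v ?y = \<phi> x" by (simp add: matrix_vector_mul_assoc)
  have "(\<phi> x \<bullet> w)\<^sup>2 = (w \<bullet> (\<Sigma> *v ?y))\<^sup>2" by (simp add: y inner_commute)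
  also have "\<dots> \<le> (w \<bullet> (\<Sigma> *v w)) * (?y \<bullet> (\<Sigma> *v ?y))"
    by (rule psd_cauchy_schwarz) (rule covariance_psd)+
  also have "?y \<bullet> (\<Sigma> *v ?y) = \<phi> x \<bullet> ?y" by (simp add: y inner_commute)
  also have "(w \<bullet> (\<Sigma> *v w)) * (\<phi> x \<bullet> ?y) \<le> (w \<bullet> (\<Sigma> *v w)) * C"
    using bound[OF x] covariance_psd(2) by (rule mult_left_mono)
  finally show ?thesis by (simp add: mult.commute)
qed

text \<open>Integrability of the outer products has to be earned first: the feature bound at the
  unit vectors bounds every coordinate of \<phi>, and then the integral commutes with the quadratic
  form.\<close>

lemma covariance_form: "w \<bullet> (\<Sigma> *v w) = 1 / real H * (\<Sum>h<H. \<integral>x. (\<phi> x \<bullet> w)\<^sup>2 \<partial>D h)"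
proof -
  define B where "B = (\<Sum>i\<in>(UNIV::'d set). sqrt (C * (axis i 1 \<bullet> (\<Sigma> *v axis i 1))))"
  have "norm (\<phi> x) \<le> B" if x: "x \<in> space X" for x
  proof -
    have "\<bar>\<phi> x $ i\<bar> \<le> sqrt (C * (axis i 1 \<bullet> (\<Sigma> *v axis i 1)))" for i
      using feature_bound_aux[OF x, of "axis i 1"] by (intro real_le_rsqrt) (simp add: inner_axis)
    then show ?thesis
      unfolding B_def by (intro order_trans[OF norm_le_l1_cart] sum_mono)
  qed
  from integrable_outer[OF D \<phi> this] show ?thesis
    unfolding covariance_form_aux by (simp add: matrix_form_integral power2_eq_square)
qed

text \<open>With no steps the sum is empty and \<Sigma> is zero, contradicting
  invertibility.\<close>

lemma covariance_H_pos: "0 < H"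
proof (rule ccontr)
  assume "\<not> 0 < H"
  then have "\<Sigma> = 0" by (simp add: \<Sigma>)
  moreover have "\<Sigma> ** matrix_inv \<Sigma> = mat 1" using inv by (rule matrix_inv_inverse)
  ultimately have "(mat 1 :: real^'d^'d) = 0" by (simp add: matrix_matrix_mult_def vec_eq_iff)
  then have "(mat 1 :: real^'d^'d) $ undefined $ undefined = 0" by simp
  then show False by (simp add: mat_def)
qed

text \<open>For a semidefinite form, Cauchy-Schwarz against \<Sigma> w shows that a vector of form
  value zero lies in the kernel, which invertibility makes trivial.\<close>

lemma covariance_pos: "w \<noteq> 0 \<Longrightarrow> 0 < w \<bullet> (\<Sigma> *v w)"
proof (rule ccontr)
  assume w: "w \<noteq> 0" and "\<not> 0 < w \<bullet> (\<Sigma> *v w)"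
  then have z: "w \<bullet> (\<Sigma> *v w) = 0" using covariance_psd(2)[of w] by linarith
  have "((\<Sigma> *v w) \<bullet> (\<Sigma> *v w))\<^sup>2 \<le> ((\<Sigma> *v w) \<bullet> (\<Sigma> *v (\<Sigma> *v w))) * (w \<bullet> (\<Sigma> *v w))"
    by (rule psd_cauchy_schwarz) (rule covariance_psd)+
  then have "\<Sigma> *v w = 0" by (simp add: z)
  moreover have "matrix_inv \<Sigma> ** \<Sigma> = mat 1" using inv by (rule matrix_inv_inverse)
  ultimately have "w = 0" by (metis matrix_vector_mul_assoc matrix_vector_mul_lid matrix_vector_mult_0_right)
  then show False using w by simp
qed

end

section \<open>The lower bound\<close>

locale ope_instance =
  fixes S :: "'s measure" and A :: "'a measure" and \<mu> :: "'s measure"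
    and p :: "'s \<times> 'a \<Rightarrow> 's measure" and pd :: "'s \<times> 'a \<Rightarrow> 's \<Rightarrow> real"
    and R :: "'s \<times> 'a \<Rightarrow> real measure"
    and pol :: "'s \<Rightarrow> 'a measure" and pb :: "'s \<Rightarrow> 'a"
    and xi0 xib :: "'s measure" and H :: nat
    and \<phi> :: "'s \<times> 'a \<Rightarrow> real^'d" and C1 :: real
    and Sup_set Sdown :: "'s set" and c :: real
  assumes sets_base: "sets \<mu> = sets S"
    and p_kernel: "p \<in> S \<Otimes>\<^sub>M A \<rightarrow>\<^sub>M prob_algebra S"
    and pd_meas: "(\<lambda>(x, s'). pd x s') \<in> borel_measurable ((S \<Otimes>\<^sub>M A) \<Otimes>\<^sub>M S)"
    and pd_nonneg: "\<And>x s'. x \<in> space (S \<Otimes>\<^sub>M A) \<Longrightarrow> s' \<in> space S \<Longrightarrow> 0 \<le> pd x s'"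
    and p_density: "\<And>x. x \<in> space (S \<Otimes>\<^sub>M A) \<Longrightarrow> p x = density \<mu> (\<lambda>s'. ennreal (pd x s'))"
    and R_kernel: "R \<in> S \<Otimes>\<^sub>M A \<rightarrow>\<^sub>M prob_algebra borel"
    and R_range: "\<And>x. x \<in> space (S \<Otimes>\<^sub>M A) \<Longrightarrow> measure (R x) {0..1} = 1"
    and pol_kernel: "pol \<in> S \<rightarrow>\<^sub>M prob_algebra A"
    and pb_meas: "pb \<in> S \<rightarrow>\<^sub>M A"
    and xi0_prob: "xi0 \<in> space (prob_algebra S)"
    and xib_prob: "xib \<in> space (prob_algebra S)"
    and phi_meas: "\<phi> \<in> borel_measurable (S \<Otimes>\<^sub>M A)"
    and Sigma_inv: "invertible (cov_matrix S A p pb xib H \<phi>)"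
    and C1_pos: "C1 > 0"
    and C1_bound: "\<And>x. x \<in> space (S \<Otimes>\<^sub>M A) \<Longrightarrow>
        \<phi> x \<bullet> (matrix_inv (cov_matrix S A p pb xib H \<phi>) *v \<phi> x) \<le> C1 * real CARD('d)"
    and sets_meas: "Sup_set \<in> sets S" "Sdown \<in> sets S"
    and V_up: "\<And>h s. h \<le> H \<Longrightarrow> s \<in> Sup_set \<Longrightarrow>
        Vfun S A p R pol H h s \<ge> 3 / 4 * real (H - h + 1)"
    and V_down: "\<And>h s. h \<le> H \<Longrightarrow> s \<in> Sdown \<Longrightarrow>
        Vfun S A p R pol H h s \<le> 1 / 4 * real (H - h + 1)"
    and c_pos: "c > 0"
    and pbar: "(\<integral>\<^sup>+ s'\<in>Sup_set. ennreal (INF s\<in>space S. pd (s, pb s) s') \<partial>\<mu>) \<ge> ennreal c"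
    and pbar': "(\<integral>\<^sup>+ s'\<in>Sdown. ennreal (INF s\<in>space S. pd (s, pb s) s') \<partial>\<mu>) \<ge> ennreal c"
begin

abbreviation "X \<equiv> S \<Otimes>\<^sub>M A"
abbreviation "beh \<equiv> (\<lambda>s. return A (pb s))"
abbreviation "\<Sigma> \<equiv> cov_matrix S A p pb xib H \<phi>"

text \<open>By \<open>q_eq\<close> below, this is the square of the denominator of the ratio under
  M. It is the scale in which all features are measured.\<close>

definition "q w = w \<bullet> (\<Sigma> *v w)"
definition "L = sqrt (C1 * real CARD('d))"
definition "rb s = (\<integral>a. mean_reward R (s, a) \<partial>pol s)"
definition "fb w s = (\<integral>a. \<bar>\<phi> (s, a) \<bullet> w\<bar> \<partial>pol s)"
text \<open>The numerator of the ratio under M with |f| in place of f. It dominates the signed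
  numerator, and it is exactly what a perturbation with weight proportional to |f| moves.\<close>

definition "Num w = (\<Sum>h<H. real (H - h) * integral\<^sup>L (kchain (pstep p pol) xi0 h) (fb w))"

lemma beh_kernel: "beh \<in> S \<rightarrow>\<^sub>M prob_algebra A"
  by (rule behavior_kernel[OF pb_meas])

lemma beh_space: "s \<in> space S \<Longrightarrow> (s, pb s) \<in> space X"
  by (rule behavior_in_space[OF pb_meas])

lemma beh_measurable: "(\<lambda>s. (s, pb s)) \<in> S \<rightarrow>\<^sub>M X"
  using pb_meas by measurable

lemma pd_int: "x \<in> space X \<Longrightarrow> (\<integral>\<^sup>+s. ennreal (pd x s) \<partial>\<mu>) = 1"
proof -
  assume x: "x \<in> space X"
  have "pd x \<in> borel_measurable S"
    using measurable_compose[OF measurable_Pair1'[OF x] pd_meas] by simp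
  then have m: "pd x \<in> borel_measurable \<mu>" unfolding measurable_cong_sets[OF sets_base refl] .
  have "emeasure (p x) (space \<mu>) = 1"
    using in_space_prob_algebra[OF kernelD[OF p_kernel x]] sets_eq_imp_space_eq[OF sets_base] by simp
  then show ?thesis
    unfolding p_density[OF x] using m by (simp add: emeasure_density cong: nn_integral_cong)
qed

lemma cov_eq: "\<Sigma> = (1 / real H) *\<^sub>R (\<Sum>h<H. \<integral>x. (\<chi> i j. \<phi> x $ i * \<phi> x $ j) \<partial>(sadist S A p beh xib h))"
  by (simp add: cov_matrix_def)

lemmas D_prob = sadist_prob[OF beh_kernel p_kernel xib_prob]

lemma H_pos: "0 < H"
  by (rule covariance_H_pos[OF D_prob phi_meas cov_eq Sigma_inv C1_bound])

lemma q_eq: "q w = 1 / real H * (\<Sum>h<H. \<integral>x. (\<phi> x \<bullet> w)\<^sup>2 \<partial>sadist S A p beh xib h)"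
  unfolding q_def by (rule covariance_form[OF D_prob phi_meas cov_eq Sigma_inv C1_bound])

lemma q_pos: "w \<noteq> 0 \<Longrightarrow> 0 < q w"
  unfolding q_def by (rule covariance_pos[OF D_prob phi_meas cov_eq Sigma_inv C1_bound])

lemma q_nonneg: "0 \<le> q w"
  using q_pos[of w] by (cases "w = 0") (auto simp: q_def)

lemma L_pos: "0 < L"
  using C1_pos by (simp add: L_def)

lemma feature_bound: "x \<in> space X \<Longrightarrow> \<bar>\<phi> x \<bullet> w\<bar> \<le> L * sqrt (q w)"
  using feature_bound_aux[OF D_prob phi_meas cov_eq Sigma_inv C1_bound, of x w]
  unfolding L_def q_def[symmetric] real_sqrt_mult[symmetric] by (intro real_le_rsqrt) simp

lemma feature_measurable: "(\<lambda>x. \<phi> x \<bullet> w) \<in> borel_measurable X"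
  using phi_meas by measurable

lemma abs_feature_measurable: "(\<lambda>x. \<bar>\<phi> x \<bullet> w\<bar>) \<in> borel_measurable X"
  using feature_measurable by measurable

lemma fb_measurable: "fb w \<in> borel_measurable S"
  unfolding fb_def[abs_def] by (rule integral_kernel_measurable[OF _ pol_kernel]) (use abs_feature_measurable in simp)

lemma fb_range:
  assumes s: "s \<in> space S"
  shows "0 \<le> fb w s \<and> fb w s \<le> L * sqrt (q w)"
proof -
  have m: "(\<lambda>a. \<bar>\<phi> (s, a) \<bullet> w\<bar>) \<in> borel_measurable A"
    using measurable_compose[OF measurable_Pair1'[OF s] abs_feature_measurable] .
  have b: "\<bar>\<phi> (s, a) \<bullet> w\<bar> \<le> L * sqrt (q w)" if "a \<in> space A" for a
    using feature_bound[of "(s, a)"] s that by (simp add: space_pair_measure)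
  show ?thesis
    unfolding fb_def
    by (intro conjI integral_prob_ge[OF kernelD[OF pol_kernel s] m] integral_prob_le[OF kernelD[OF pol_kernel s] m])
      (auto intro: b)
qed

lemma integral_abs_feature:
  assumes "p' \<in> X \<rightarrow>\<^sub>M prob_algebra S"
  shows "(\<integral>x. \<bar>\<phi> x \<bullet> w\<bar> \<partial>sadist S A p' pol xi0 h) = integral\<^sup>L (kchain (pstep p' pol) xi0 h) (fb w)"
  using integral_sadist[OF pol_kernel assms xi0_prob abs_feature_measurable, of w "L * sqrt (q w)" h] feature_bound
  unfolding fb_def[symmetric] sdist_eq_kchain by simp

lemma numerator_le:
  assumes "p' \<in> X \<rightarrow>\<^sub>M prob_algebra S"
  shows "(\<Sum>h<H. real (H - h) * (\<integral>x. \<phi> x \<bullet> w \<partial>sadist S A p' pol xi0 h))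
    \<le> (\<Sum>h<H. real (H - h) * integral\<^sup>L (kchain (pstep p' pol) xi0 h) (fb w))"
  unfolding integral_abs_feature[OF assms, symmetric]
  using feature_bound
  by (intro sum_mono mult_left_mono integral_prob_mono[OF sadist_prob[OF pol_kernel assms xi0_prob] feature_measurable _ abs_feature_measurable,
        of w "L * sqrt (q w)" w "L * sqrt (q w)"]) auto

lemma kchain_fb_nonneg:
  assumes "p' \<in> X \<rightarrow>\<^sub>M prob_algebra S"
  shows "0 \<le> integral\<^sup>L (kchain (pstep p' pol) xi0 h) (fb w)"
  unfolding integral_abs_feature[OF assms, symmetric] by simp

lemma Num_nonneg: "0 \<le> Num w"
  unfolding Num_def by (intro sum_nonneg mult_nonneg_nonneg kchain_fb_nonneg p_kernel) auto

lemma Num_le: "Num w \<le> (real H)\<^sup>2 * L * sqrt (q w)"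
proof -
  note P = kchain_prob[OF pstep_kernel[OF pol_kernel p_kernel] xi0_prob]
  have "Num w \<le> (\<Sum>h<H. real H * (L * sqrt (q w)))"
    unfolding Num_def
  proof (intro sum_mono mult_mono)
    fix h
    show "integral\<^sup>L (kchain (pstep p pol) xi0 h) (fb w) \<le> L * sqrt (q w)"
      using fb_range by (intro integral_prob_le[OF P fb_measurable, of _ "L * sqrt (q w)"]) auto
  qed (auto simp: kchain_fb_nonneg p_kernel)
  then show ?thesis by (simp add: power2_eq_square mult_ac)
qed

lemma rb_measurable: "rb \<in> borel_measurable S"
  unfolding rb_def[abs_def]
  by (rule integral_kernel_measurable[OF _ pol_kernel]) (use mean_reward_measurable[OF R_kernel] in simp)

lemma mean_reward_bounds: "x \<in> space X \<Longrightarrow> 0 \<le> mean_reward R x \<and> mean_reward R x \<le> 1"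
  using mean_reward_range[OF R_kernel _ R_range] by auto

lemma rb_range:
  assumes s: "s \<in> space S"
  shows "0 \<le> rb s \<and> rb s \<le> 1"
proof -
  have m: "(\<lambda>a. mean_reward R (s, a)) \<in> borel_measurable A"
    using measurable_compose[OF measurable_Pair1'[OF s] mean_reward_measurable[OF R_kernel]] .
  have b: "0 \<le> mean_reward R (s, a) \<and> mean_reward R (s, a) \<le> 1" if "a \<in> space A" for a
    using mean_reward_bounds[of "(s, a)"] s that by (simp add: space_pair_measure)
  show ?thesis
    unfolding rb_def using b
    by (intro conjI integral_prob_ge[OF kernelD[OF pol_kernel s] m, of 1] integral_prob_le[OF kernelD[OF pol_kernel s] m, of 1]) auto
qed

lemma pvalue_eq:
  assumes "p' \<in> X \<rightarrow>\<^sub>M prob_algebra S" "xi \<in> space (prob_algebra S)"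
  shows "pvalue S A p' R pol xi n = (\<Sum>j\<le>n. integral\<^sup>L (kchain (pstep p' pol) xi j) rb)"
  unfolding pvalue_def
proof (rule sum.cong[OF refl])
  fix j
  show "(\<integral>x. mean_reward R x \<partial>sadist S A p' pol xi j) = integral\<^sup>L (kchain (pstep p' pol) xi j) rb"
    using integral_sadist[OF pol_kernel assms mean_reward_measurable[OF R_kernel], of 1 j] mean_reward_bounds
    unfolding rb_def[symmetric] sdist_eq_kchain by simp
qed

lemma Vfun_eq:
  assumes "h \<le> H" "s \<in> space S"
  shows "Vfun S A p R pol H h s = value_fun (pstep p pol) rb (H - h) s"
proof -
  have r: "return S s \<in> space (prob_algebra S)"
    using measurable_space[OF measurable_return_prob_space assms(2)] .
  show ?thesis
    using assms sum_kchain_eq_vf[OF pstep_kernel[OF pol_kernel p_kernel] rb_measurable rb_range r, of "H - h"]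
    by (simp add: Vfun_def pvalue_eq[OF p_kernel r]
        integral_return[OF assms(2) value_fun_measurable[OF pstep_kernel[OF pol_kernel p_kernel] rb_measurable rb_range]])
qed

lemma space_S_nonempty: "space S \<noteq> {}"
  using prob_space.not_empty[OF prob_algebraD(1)[OF xi0_prob]] prob_algebraD(3)[OF xi0_prob] by simp

lemma obtain_densities:
  obtains u d where
    "u \<in> borel_measurable S" "\<And>s. s \<in> space S \<Longrightarrow> 0 \<le> u s" "(\<integral>\<^sup>+s. ennreal (u s) \<partial>\<mu>) = 1"
    "\<And>s t. s \<in> space S \<Longrightarrow> t \<in> space S \<Longrightarrow> c / 2 * u t \<le> pd (s, pb s) t" "\<And>s. s \<in> space S \<Longrightarrow> s \<notin> Sup_set \<Longrightarrow> u s = 0"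
    "d \<in> borel_measurable S" "\<And>s. s \<in> space S \<Longrightarrow> 0 \<le> d s" "(\<integral>\<^sup>+s. ennreal (d s) \<partial>\<mu>) = 1"
    "\<And>s t. s \<in> space S \<Longrightarrow> t \<in> space S \<Longrightarrow> c / 2 * d t \<le> pd (s, pb s) t" "\<And>s. s \<in> space S \<Longrightarrow> s \<notin> Sdown \<Longrightarrow> d s = 0"
proof -
  obtain s0 where s0: "s0 \<in> space S" using space_S_nonempty by auto
  note nn = pd_nonneg[OF beh_space] and int = pd_int[OF beh_space[OF s0]]
  obtain u where u: "u \<in> borel_measurable S" "\<And>s. s \<in> space S \<Longrightarrow> 0 \<le> u s" "(\<integral>\<^sup>+s. ennreal (u s) \<partial>\<mu>) = 1"
    "\<And>s t. s \<in> space S \<Longrightarrow> t \<in> space S \<Longrightarrow> c / 2 * u t \<le> pd (s, pb s) t" "\<And>s. s \<in> space S \<Longrightarrow> s \<notin> Sup_set \<Longrightarrow> u s = 0"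
    using density_below_infimum[OF sets_base sets_meas(1) c_pos pbar nn s0 int] by metis
  obtain d where d: "d \<in> borel_measurable S" "\<And>s. s \<in> space S \<Longrightarrow> 0 \<le> d s" "(\<integral>\<^sup>+s. ennreal (d s) \<partial>\<mu>) = 1"
    "\<And>s t. s \<in> space S \<Longrightarrow> t \<in> space S \<Longrightarrow> c / 2 * d t \<le> pd (s, pb s) t" "\<And>s. s \<in> space S \<Longrightarrow> s \<notin> Sdown \<Longrightarrow> d s = 0"
    using density_below_infimum[OF sets_base sets_meas(2) c_pos pbar' nn s0 int] by metis
  show thesis by (rule that[OF u d])
qed

end

section \<open>The two perturbed instances\<close>

locale perturbed_instance = ope_instance S A \<mu> p pd R pol pb xi0 xib H \<phi> C1 Sup_set Sdown c
  for S :: "'s measure" and A :: "'a measure" and \<mu> :: "'s measure"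
    and p :: "'s \<times> 'a \<Rightarrow> 's measure" and pd :: "'s \<times> 'a \<Rightarrow> 's \<Rightarrow> real"
    and R :: "'s \<times> 'a \<Rightarrow> real measure"
    and pol :: "'s \<Rightarrow> 'a measure" and pb :: "'s \<Rightarrow> 'a"
    and xi0 xib :: "'s measure" and H :: nat
    and \<phi> :: "'s \<times> 'a \<Rightarrow> real^'d" and C1 :: real
    and Sup_set Sdown :: "'s set" and c :: real +
  fixes u d :: "'s \<Rightarrow> real" and w0 :: "real^'d" and K :: nat and \<alpha> e :: real and k :: "'s \<times> 'a \<Rightarrow> real"
  assumes u: "u \<in> borel_measurable S" "\<And>s. s \<in> space S \<Longrightarrow> 0 \<le> u s" "(\<integral>\<^sup>+s. ennreal (u s) \<partial>\<mu>) = 1"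
    "\<And>s t. s \<in> space S \<Longrightarrow> t \<in> space S \<Longrightarrow> c / 2 * u t \<le> pd (s, pb s) t" "\<And>s. s \<in> space S \<Longrightarrow> s \<notin> Sup_set \<Longrightarrow> u s = 0"
    and d: "d \<in> borel_measurable S" "\<And>s. s \<in> space S \<Longrightarrow> 0 \<le> d s" "(\<integral>\<^sup>+s. ennreal (d s) \<partial>\<mu>) = 1"
    "\<And>s t. s \<in> space S \<Longrightarrow> t \<in> space S \<Longrightarrow> c / 2 * d t \<le> pd (s, pb s) t" "\<And>s. s \<in> space S \<Longrightarrow> s \<notin> Sdown \<Longrightarrow> d s = 0"
    and w0: "q w0 = 1" and K: "0 < K"
    and \<alpha>: "\<alpha> = sqrt (c / (32 * real (K * H)))" and e: "e = \<alpha> * L" "e \<le> 1/2"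
    and k: "k = (\<lambda>x. \<alpha> * \<bar>\<phi> x \<bullet> w0\<bar>)"
begin

lemma \<alpha>_nonneg: "0 \<le> \<alpha>" and \<alpha>_sq: "\<alpha>\<^sup>2 = c / (32 * real (K * H))"
  using c_pos by (auto simp: \<alpha>)

lemma e_nonneg: "0 \<le> e"
  using \<alpha>_nonneg L_pos by (simp add: e)

lemma k_measurable: "k \<in> borel_measurable X"
  unfolding k using abs_feature_measurable by measurable

text \<open>The normalisation \<open>q w0 = 1\<close> turns the feature bound into |\<phi> . w0|
  \<le> L, so the weight never exceeds \<alpha> L = e.\<close>

lemma k_range: "x \<in> space X \<Longrightarrow> 0 \<le> k x \<and> k x \<le> e"
  using mult_left_mono[OF feature_bound[of x w0] \<alpha>_nonneg] \<alpha>_nonneg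
  unfolding k e(1) w0 by simp

lemma e_le_1: "e \<le> 1"
  using e(2) by simp

text \<open>\<open>T\<close> follows the target policy. \<open>B\<close>, below, follows the
  behavior policy with the same transitions and yields the lower bound for the denominator of the
  ratio.\<close>

sublocale T: mixture_mdp S A \<mu> p pd pol k e
  by unfold_locales
    (rule sets_base p_kernel pd_meas pd_nonneg p_density pol_kernel k_measurable k_range e_nonneg e_le_1 | assumption)+

sublocale B: mixture_mdp S A \<mu> p pd beh k e
  by unfold_locales
    (rule sets_base p_kernel pd_meas pd_nonneg p_density beh_kernel k_measurable k_range e_nonneg e_le_1 | assumption)+

lemma u_density: "T.is_density u" and d_density: "T.is_density d"
  unfolding T.is_density_def using u d by auto

lemma integral_V_up:
  assumes j: "j < H"
  shows "3/4 * real (Suc j) \<le> integral\<^sup>L (T.dens u) (value_fun (pstep p pol) rb j)"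
proof -
  note U = T.is_densityD(4)[OF u_density]
  note V = T.V_measurable[OF rb_measurable rb_range xi0_prob, of j] T.V_range[OF rb_measurable rb_range xi0_prob, of _ j]
  interpret U: prob_space "T.dens u" by (rule prob_algebraD(1)[OF U])
  have [measurable]: "u \<in> borel_measurable \<mu>" unfolding measurable_cong_sets[OF sets_base refl] by (rule u)
  have sp: "space \<mu> = space S" by (rule sets_eq_imp_space_eq[OF sets_base])
  have "AE s in T.dens u. 3/4 * real (Suc j) \<le> value_fun (pstep p pol) rb j s"
  proof (subst AE_density)
    show "AE s in \<mu>. 0 < ennreal (u s) \<longrightarrow> 3/4 * real (Suc j) \<le> value_fun (pstep p pol) rb j s"
    proof (intro AE_I2 impI)
      fix s assume s: "s \<in> space \<mu>" "0 < ennreal (u s)"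
      then have "s \<in> Sup_set" using u(5)[of s] sp by auto
      then show "3/4 * real (Suc j) \<le> value_fun (pstep p pol) rb j s"
        \<comment> \<open>j steps to go correspond to time H - j, where the assumed bound reads 3/4
          (j + 1).\<close>
        using V_up[of "H - j" s] Vfun_eq[of "H - j" s] s sp j by simp
    qed
  qed measurable
  then show ?thesis
    using V by (intro U.integral_ge_const integrable_prob_bounded[OF U, of _ "real (Suc j)"]) auto
qed

lemma integral_V_down:
  assumes j: "j < H"
  shows "integral\<^sup>L (T.dens d) (value_fun (pstep p pol) rb j) \<le> 1/4 * real (Suc j)"
proof -
  note U = T.is_densityD(4)[OF d_density]
  note V = T.V_measurable[OF rb_measurable rb_range xi0_prob, of j] T.V_range[OF rb_measurable rb_range xi0_prob, of _ j]
  interpret U: prob_space "T.dens d" by (rule prob_algebraD(1)[OF U])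
  have [measurable]: "d \<in> borel_measurable \<mu>" unfolding measurable_cong_sets[OF sets_base refl] by (rule d)
  have sp: "space \<mu> = space S" by (rule sets_eq_imp_space_eq[OF sets_base])
  have "AE s in T.dens d. value_fun (pstep p pol) rb j s \<le> 1/4 * real (Suc j)"
  proof (subst AE_density)
    show "AE s in \<mu>. 0 < ennreal (d s) \<longrightarrow> value_fun (pstep p pol) rb j s \<le> 1/4 * real (Suc j)"
    proof (intro AE_I2 impI)
      fix s assume s: "s \<in> space \<mu>" "0 < ennreal (d s)"
      then have "s \<in> Sdown" using d(5)[of s] sp by auto
      then show "value_fun (pstep p pol) rb j s \<le> 1/4 * real (Suc j)"
        using V_down[of "H - j" s] Vfun_eq[of "H - j" s] s sp j by simp
    qed
  qed measurable
  then show ?thesis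
    using V by (intro U.integral_le_const integrable_prob_bounded[OF U, of _ "real (Suc j)"]) auto
qed

text \<open>The weight k is \<alpha> |\<phi> . w0|, so its average over target actions is \<alpha>
  times \<open>fb w0\<close>, and the leading sum of \<open>value_gap\<close> becomes \<alpha>
  \<open>Num w0\<close>.\<close>

lemma pvalue_gap:
  "\<alpha> * Num w0 / 2 - 3 * real H ^ 3 * e\<^sup>2
    \<le> pvalue S A (T.mix u) R pol xi0 H - pvalue S A (T.mix d) R pol xi0 H"
proof -
  have kb: "T.kb = (\<lambda>s. \<alpha> * fb w0 s)"
    unfolding T.kb_def[abs_def] fb_def by (subst k) simp
  have "(\<Sum>h<H. real (H - h) * integral\<^sup>L (kchain (pstep p pol) xi0 h) T.kb) = \<alpha> * Num w0"
    unfolding kb Num_def sum_distrib_left by (simp add: mult_ac)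
  then show ?thesis
    using T.value_gap[OF rb_measurable rb_range xi0_prob u_density d_density integral_V_up integral_V_down, where n=H]
    unfolding pvalue_eq[OF T.mix_kernel[OF u_density] xi0_prob] pvalue_eq[OF T.mix_kernel[OF d_density] xi0_prob]
    by simp
qed

text \<open>Uniformity in \<open>w\<close> holds because both perturbation bounds are proportional
  to the norm: the numerator grows by at most H^3 e L sqrt(q w), and the squared denominator keeps
  the share (1 - e)^H of \<open>q w\<close>. The norm cancels in the quotient.\<close>

lemma ratio_mix_le:
  assumes uu: "T.is_density uu" and \<rho>: "\<And>w. Num w \<le> \<rho> * sqrt (q w)" and w: "w \<noteq> 0"
  shows "ratio S A (T.mix uu) pol pb xi0 xib H \<phi> w \<le> ereal ((\<rho> + real H ^ 3 * e * L) / sqrt ((1 - e) ^ H))"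
proof -
  note mk = T.mix_kernel[OF uu]
  define num where "num = (\<Sum>h<H. real (H - h) * (\<integral>x. \<phi> x \<bullet> w \<partial>sadist S A (T.mix uu) pol xi0 h))"
  define den where "den = 1 / real H * (\<Sum>h<H. \<integral>x. (\<phi> x \<bullet> w)\<^sup>2 \<partial>sadist S A (T.mix uu) beh xib h)"
  have e1: "0 < (1 - e) ^ H" using e by (intro zero_less_power) auto
  have qw: "0 < sqrt (q w)" using q_pos[OF w] by simp
  have "num \<le> (\<Sum>h<H. real (H - h) * integral\<^sup>L (kchain (pstep (T.mix uu) pol) xi0 h) (fb w))"
    unfolding num_def by (rule numerator_le[OF mk])
  also have "\<dots> \<le> (\<Sum>h<H. real (H - h) * integral\<^sup>L (kchain (pstep p pol) xi0 h) (fb w) + real H ^ 2 * e * L * sqrt (q w))"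
  proof (rule sum_mono)
    fix h assume h: "h \<in> {..<H}"
    have "\<bar>integral\<^sup>L (kchain (pstep (T.mix uu) pol) xi0 h) (fb w) - integral\<^sup>L (kchain (pstep p pol) xi0 h) (fb w)\<bar>
        \<le> real h * (e * (L * sqrt (q w)))"
      by (rule T.kchain_mix_close[OF fb_measurable fb_range uu xi0_prob])
    then have "integral\<^sup>L (kchain (pstep (T.mix uu) pol) xi0 h) (fb w)
        \<le> integral\<^sup>L (kchain (pstep p pol) xi0 h) (fb w) + real h * (e * (L * sqrt (q w)))"
      by linarith
    then have "real (H - h) * integral\<^sup>L (kchain (pstep (T.mix uu) pol) xi0 h) (fb w)
        \<le> real (H - h) * integral\<^sup>L (kchain (pstep p pol) xi0 h) (fb w) + real (H - h) * (real h * (e * (L * sqrt (q w))))"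
      unfolding distrib_left[symmetric] by (rule mult_left_mono) simp
    moreover have "real (H - h) * (real h * (e * (L * sqrt (q w)))) \<le> real H * (real H * (e * (L * sqrt (q w))))"
      using h e_nonneg L_pos qw by (intro mult_mono mult_nonneg_nonneg) auto
    ultimately show "real (H - h) * integral\<^sup>L (kchain (pstep (T.mix uu) pol) xi0 h) (fb w)
      \<le> real (H - h) * integral\<^sup>L (kchain (pstep p pol) xi0 h) (fb w) + real H ^ 2 * e * L * sqrt (q w)"
      by (simp add: power2_eq_square mult.assoc)
  qed
  also have "\<dots> = Num w + real H ^ 3 * e * L * sqrt (q w)"
    by (simp add: Num_def sum.distrib power3_eq_cube power2_eq_square)
  also have "\<dots> \<le> (\<rho> + real H ^ 3 * e * L) * sqrt (q w)"
    using \<rho>[of w] by (simp add: algebra_simps)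
  finally have num: "num \<le> (\<rho> + real H ^ 3 * e * L) * sqrt (q w)" .
  have "(1 - e) ^ H * q w \<le> den"
  proof -
    have "(1 - e) ^ H * (\<integral>x. (\<phi> x \<bullet> w)\<^sup>2 \<partial>sadist S A p beh xib h) \<le> (\<integral>x. (\<phi> x \<bullet> w)\<^sup>2 \<partial>sadist S A (T.mix uu) beh xib h)"
      if h: "h < H" for h
    proof -
      have sqm: "(\<lambda>x. (\<phi> x \<bullet> w)\<^sup>2) \<in> borel_measurable X" using feature_measurable by measurable
      have sqb: "\<bar>(\<phi> x \<bullet> w)\<^sup>2\<bar> \<le> (L * sqrt (q w))\<^sup>2" if "x \<in> space X" for x
        using power_mono[OF feature_bound[OF that, of w] abs_ge_zero, of 2] by simp
      have en: "(\<integral>\<^sup>+x. ennreal ((\<phi> x \<bullet> w)\<^sup>2) \<partial>M) = ennreal (\<integral>x. (\<phi> x \<bullet> w)\<^sup>2 \<partial>M)" if "M \<in> space (prob_algebra X)" for M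
        by (intro nn_integral_eq_integral integrable_prob_bounded[OF that sqm sqb]) auto
      define G where "G s = (\<integral>\<^sup>+a. ennreal ((\<phi> (s, a) \<bullet> w)\<^sup>2) \<partial>return A (pb s))" for s
      have Gm: "G \<in> borel_measurable S"
        unfolding G_def[abs_def] by (rule nn_integral_kernel_measurable[OF _ beh_kernel]) (use sqm in simp)
      have sd: "ennreal (\<integral>x. (\<phi> x \<bullet> w)\<^sup>2 \<partial>sadist S A p' beh xib h) = integral\<^sup>N (kchain (pstep p' beh) xib h) G"
        if p': "p' \<in> X \<rightarrow>\<^sub>M prob_algebra S" for p'
        unfolding en[OF sadist_prob[OF beh_kernel p' xib_prob], symmetric]
        using nn_integral_sadist[OF beh_kernel p' xib_prob, of "\<lambda>x. ennreal ((\<phi> x \<bullet> w)\<^sup>2)" h] sqm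
        by (simp add: G_def[abs_def] sdist_eq_kchain)
      have "ennreal ((1 - e) ^ H) * integral\<^sup>N (kchain (pstep p beh) xib h) G \<le> ennreal (1 - e) ^ h * integral\<^sup>N (kchain (pstep p beh) xib h) G"
        using h e e_nonneg by (intro mult_right_mono) (auto simp: ennreal_power intro!: ennreal_leI power_decreasing)
      also have "\<dots> \<le> integral\<^sup>N (kchain (pstep (T.mix uu) beh) xib h) G"
        by (rule B.nn_integral_kchain_mix_ge[OF uu xib_prob Gm])
      finally have "ennreal ((1 - e) ^ H * (\<integral>x. (\<phi> x \<bullet> w)\<^sup>2 \<partial>sadist S A p beh xib h)) \<le> ennreal (\<integral>x. (\<phi> x \<bullet> w)\<^sup>2 \<partial>sadist S A (T.mix uu) beh xib h)"
        unfolding sd[OF p_kernel, symmetric] sd[OF mk, symmetric] using e1 by (simp add: ennreal_mult)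
      then show ?thesis by (subst (asm) ennreal_le_iff) auto
    qed
    then have "1 / real H * (\<Sum>h<H. (1 - e) ^ H * (\<integral>x. (\<phi> x \<bullet> w)\<^sup>2 \<partial>sadist S A p beh xib h)) \<le> den"
      unfolding den_def by (intro mult_left_mono sum_mono) auto
    then show ?thesis unfolding q_eq sum_distrib_left[symmetric] by (simp add: mult_ac)
  qed
  then have den: "sqrt ((1 - e) ^ H) * sqrt (q w) \<le> sqrt den"
    unfolding real_sqrt_mult[symmetric] by (rule real_sqrt_le_mono)
  have \<rho>0: "0 \<le> \<rho> + real H ^ 3 * e * L"
  proof -
    have "0 \<le> \<rho> * sqrt (q w)" using Num_nonneg \<rho> by (rule order_trans)
    then have "0 \<le> \<rho>" using qw by (simp add: zero_le_mult_iff)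
    then show ?thesis using e_nonneg L_pos by simp
  qed
  have dpos: "0 < sqrt ((1 - e) ^ H) * sqrt (q w)" using e1 qw by simp
  then have "num / sqrt den \<le> ((\<rho> + real H ^ 3 * e * L) * sqrt (q w)) / (sqrt ((1 - e) ^ H) * sqrt (q w))"
    using num den \<rho>0 qw by (intro frac_le) auto
  also have "\<dots> = (\<rho> + real H ^ 3 * e * L) / sqrt ((1 - e) ^ H)" using qw by simp
  finally have "num / sqrt den \<le> (\<rho> + real H ^ 3 * e * L) / sqrt ((1 - e) ^ H)" .
  moreover have "ratio S A (T.mix uu) pol pb xi0 xib H \<phi> w = ereal (num / sqrt den)"
  proof -
    \<comment> \<open>A nonzero denominator keeps the extended-real quotient in the finite
      case.\<close>
    have "sqrt den \<noteq> 0" using dpos den by linarith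
    then show ?thesis unfolding ratio_def num_def[symmetric] den_def[symmetric] by simp
  qed
  ultimately show ?thesis by simp
qed

definition "lr s t = ennreal (mix_ratio pd k u d (s, pb s) t)"
text \<open>A bound on the conditional variance of the likelihood factor. The constant is 4 / (c /
  2), as \<open>u\<close> and \<open>d\<close> satisfy their domination only with c / 2.\<close>

definition "var s = ennreal (8 / c * (k (s, pb s))\<^sup>2)"

lemma half_c_pos: "0 < c / 2"
  using c_pos by simp

lemma k_range_beh: "s \<in> space S \<Longrightarrow> 0 \<le> k (s, pb s)" "s \<in> space S \<Longrightarrow> k (s, pb s) \<le> 1/2"
  using k_range[OF beh_space] e(2) by force+

lemma lr_measurable: "case_prod lr \<in> borel_measurable (S \<Otimes>\<^sub>M S)"
proof -
  have m: "(\<lambda>z. ((fst z, pb (fst z)), snd z)) \<in> S \<Otimes>\<^sub>M S \<rightarrow>\<^sub>M X \<Otimes>\<^sub>M S"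
    by (intro measurable_Pair measurable_compose[OF measurable_fst pb_meas]) auto
  have [measurable]: "(\<lambda>z. pd (fst z, pb (fst z)) (snd z)) \<in> borel_measurable (S \<Otimes>\<^sub>M S)"
    using measurable_compose[OF m pd_meas] by simp
  have [measurable]: "(\<lambda>s. k (s, pb s)) \<in> borel_measurable S"
    by (rule measurable_compose[OF beh_measurable k_measurable])
  have [measurable]: "(\<lambda>z. k (fst z, pb (fst z))) \<in> borel_measurable (S \<Otimes>\<^sub>M S)" by measurable
  note [measurable] = u(1) d(1)
  show ?thesis unfolding lr_def split_beta mix_ratio_def by measurable
qed

lemma var_measurable: "var \<in> borel_measurable S"
proof -
  have [measurable]: "(\<lambda>s. k (s, pb s)) \<in> borel_measurable S"
    by (rule measurable_compose[OF beh_measurable k_measurable])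
  show ?thesis unfolding var_def[abs_def] by measurable
qed

context
  fixes s assumes s: "s \<in> space S"
begin

lemmas ratio_facts = sets_base pd_meas beh_space[OF s] pd_nonneg[OF beh_space[OF s]] pd_int[OF beh_space[OF s]]
  k_range_beh[OF s] u(1,2) d(1,2) u(3) d(3) half_c_pos u(4)[OF s] d(4)[OF s]

lemma lr_le: "t \<in> space S \<Longrightarrow> lr s t \<le> ennreal (1 + 4 * e / c)"
proof -
  assume t: "t \<in> space S"
  have "mix_ratio pd k u d (s, pb s) t \<le> 1 + 2 * k (s, pb s) / (c / 2)"
    by (rule mix_ratio_bounds(2)) (rule ratio_facts t | assumption)+
  also have "\<dots> \<le> 1 + 4 * e / c"
    using k_range[OF beh_space[OF s]] c_pos by (simp add: divide_right_mono)
  finally show ?thesis unfolding lr_def by (rule ennreal_leI)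
qed

lemma lr_ratio:
  "F \<in> borel_measurable S \<Longrightarrow> integral\<^sup>N (T.mix u (s, pb s)) F = (\<integral>\<^sup>+t. lr s t * F t \<partial>T.mix d (s, pb s))"
  unfolding lr_def by (rule nn_integral_mix_ratio) (rule ratio_facts | assumption)+

lemma lr_second_moment: "(\<integral>\<^sup>+t. (lr s t)\<^sup>2 \<partial>T.mix d (s, pb s)) \<le> 1 + var s"
proof -
  have "(\<integral>\<^sup>+t. (lr s t)\<^sup>2 \<partial>T.mix d (s, pb s)) \<le> 1 + ennreal (4 / (c / 2) * (k (s, pb s))\<^sup>2)"
    unfolding lr_def by (rule mix_ratio_second_moment) (rule ratio_facts | assumption)+
  then show ?thesis by (simp add: var_def)
qed

text \<open>Along behavior actions \<open>d\<close> is at most 2 / c times the density of p, so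
  mixing inflates p by at most 1 + 2 e / c. The reciprocal form is the one that iterates along the
  chain in \<open>nn_integral_kchain_mono\<close>.\<close>

lemma nn_integral_mix_beh_le:
  assumes F[measurable]: "F \<in> borel_measurable S"
  shows "ennreal (1 / (1 + 2 * e / c)) * integral\<^sup>N (pstep (T.mix d) beh s) F \<le> integral\<^sup>N (pstep p beh s) F"
proof -
  note x = beh_space[OF s]
  have sp: "space \<mu> = space S" by (rule sets_eq_imp_space_eq[OF sets_base])
  have pm: "pd (s, pb s) \<in> borel_measurable S"
    using measurable_compose[OF measurable_Pair1'[OF x] pd_meas] by simp
  have m[measurable]: "F \<in> borel_measurable \<mu>" "d \<in> borel_measurable \<mu>" "pd (s, pb s) \<in> borel_measurable \<mu>"
    unfolding measurable_cong_sets[OF sets_base refl] by (rule F d pm)+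
  let ?I = "integral\<^sup>N (p (s, pb s)) F"
  have "integral\<^sup>N (T.dens d) F = (\<integral>\<^sup>+t. ennreal (d t) * F t \<partial>\<mu>)"
    by (rule nn_integral_density) measurable
  also have "\<dots> \<le> (\<integral>\<^sup>+t. ennreal (2 / c) * (ennreal (pd (s, pb s) t) * F t) \<partial>\<mu>)"
  proof (rule nn_integral_mono)
    fix t assume "t \<in> space \<mu>"
    then have t: "t \<in> space S" using sp by simp
    have "d t \<le> 2 / c * pd (s, pb s) t" using d(4)[OF s t] c_pos by (simp add: field_simps)
    then have "ennreal (d t) \<le> ennreal (2 / c * pd (s, pb s) t)" by (rule ennreal_leI)
    also have "\<dots> = ennreal (2 / c) * ennreal (pd (s, pb s) t)"
      using c_pos pd_nonneg[OF x t] by (intro ennreal_mult) auto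
    finally show "ennreal (d t) * F t \<le> ennreal (2 / c) * (ennreal (pd (s, pb s) t) * F t)"
      unfolding mult.assoc[symmetric] by (rule mult_right_mono) simp
  qed
  also have "\<dots> = ennreal (2 / c) * (\<integral>\<^sup>+t. ennreal (pd (s, pb s) t) * F t \<partial>\<mu>)"
    by (rule nn_integral_cmult) measurable
  also have "(\<integral>\<^sup>+t. ennreal (pd (s, pb s) t) * F t \<partial>\<mu>) = ?I"
    unfolding p_density[OF x] by (rule nn_integral_density[symmetric]) measurable
  finally have dI: "integral\<^sup>N (T.dens d) F \<le> ennreal (2 / c) * ?I" .
  have "integral\<^sup>N (T.mix d (s, pb s)) F \<le> ennreal 1 * ?I + ennreal e * (ennreal (2 / c) * ?I)"
    unfolding T.nn_integral_mix[OF d_density x F]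
    using k_range[OF x] by (intro add_mono mult_mono ennreal_leI dI) auto
  also have "\<dots> = ennreal (1 + 2 * e / c) * ?I"
  proof -
    have "ennreal (1 + 2 * e / c) = ennreal 1 + ennreal (e * (2 / c))"
      using e_nonneg c_pos by (subst ennreal_plus[symmetric]) (auto simp: mult.commute)
    also have "ennreal (e * (2 / c)) = ennreal e * ennreal (2 / c)"
      using e_nonneg c_pos by (intro ennreal_mult) auto
    finally show ?thesis by (simp add: distrib_right mult.assoc)
  qed
  finally have "ennreal (1 / (1 + 2 * e / c)) * integral\<^sup>N (T.mix d (s, pb s)) F
      \<le> ennreal (1 / (1 + 2 * e / c)) * (ennreal (1 + 2 * e / c) * ?I)"
    by (rule mult_left_mono) simp
  also have "\<dots> = ?I"
  proof -
    have "0 < 1 + 2 * e / c" using e_nonneg c_pos by (simp add: add_pos_nonneg)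
    then show ?thesis by (simp add: mult.assoc[symmetric] ennreal_mult[symmetric])
  qed
  finally show ?thesis
    unfolding pstep_behavior[OF pb_meas T.mix_kernel[OF d_density] s]
      pstep_behavior[OF pb_meas p_kernel s] .
qed

end

text \<open>Two costs build up over h steps: the squared likelihood bound (1 + 4 e / c)^(2 h), and
  (1 + 2 e / c)^h for moving the expectation of \<open>var\<close> from the perturbed chain to the
  original one. Their product is at most 4. Under the original chain the squares of \<phi> . w0 sum
  to H because \<open>q w0 = 1\<close>, and 4 * (8 / c) * H * \<alpha>^2 = 1 / K by the choice of
  \<alpha>.\<close>

lemma sum_var_le:
  assumes b: "(1 + 4 * e / c) ^ (3 * H) \<le> 4"
  shows "1 + (\<Sum>h<H. (ennreal (1 + 4 * e / c) ^ h)\<^sup>2 * integral\<^sup>N (kchain (pstep (T.mix d) beh) xib h) var)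
    \<le> ennreal (1 + 1 / real K)"
proof -
  define b0 b1 where "b0 = 1 + 4 * e / c" and "b1 = 1 + 2 * e / c"
  have b1: "1 \<le> b1" "b1 \<le> b0" using e_nonneg c_pos by (auto simp: b0_def b1_def divide_right_mono)
  let ?I = "\<lambda>h. \<integral>x. (\<phi> x \<bullet> w0)\<^sup>2 \<partial>sadist S A p beh xib h"
  define C where "C = 8 / c * \<alpha>\<^sup>2"
  have C: "0 \<le> C" using c_pos by (simp add: C_def)
  have var_eq: "integral\<^sup>N (kchain (pstep p beh) xib h) var = ennreal (C * ?I h)" for h
  proof -
    have sqm: "(\<lambda>x. C * (\<phi> x \<bullet> w0)\<^sup>2) \<in> borel_measurable X" using feature_measurable by measurable
    have sqb: "\<bar>C * (\<phi> x \<bullet> w0)\<^sup>2\<bar> \<le> C * (L * sqrt (q w0))\<^sup>2" if "x \<in> space X" for x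
      using power_mono[OF feature_bound[OF that, of w0] abs_ge_zero, of 2] C by (simp add: abs_mult mult_left_mono)
    have "integral\<^sup>N (kchain (pstep p beh) xib h) var
        = (\<integral>\<^sup>+s. (\<integral>\<^sup>+a. ennreal (C * (\<phi> (s, a) \<bullet> w0)\<^sup>2) \<partial>return A (pb s)) \<partial>sdist S A p beh xib h)"
      unfolding sdist_eq_kchain
    proof (rule nn_integral_cong)
      fix s assume "s \<in> space (kchain (pstep p beh) xib h)"
      then have s: "s \<in> space S"
        using prob_algebraD(3)[OF kchain_prob[OF pstep_kernel[OF beh_kernel p_kernel] xib_prob]] by simp
      have "(\<lambda>a. ennreal (C * (\<phi> (s, a) \<bullet> w0)\<^sup>2)) \<in> borel_measurable A"
        using measurable_compose[OF measurable_Pair1'[OF s] sqm] by measurable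
      then show "var s = (\<integral>\<^sup>+a. ennreal (C * (\<phi> (s, a) \<bullet> w0)\<^sup>2) \<partial>return A (pb s))"
        using measurable_space[OF pb_meas s] unfolding var_def C_def
        by (subst k, subst nn_integral_return) (simp_all add: power_mult_distrib mult.assoc)
    qed
    also have "\<dots> = (\<integral>\<^sup>+x. ennreal (C * (\<phi> x \<bullet> w0)\<^sup>2) \<partial>sadist S A p beh xib h)"
      using measurable_compose[OF sqm measurable_ennreal]
      by (rule nn_integral_sadist[OF beh_kernel p_kernel xib_prob, symmetric])
    also have "\<dots> = ennreal (\<integral>x. C * (\<phi> x \<bullet> w0)\<^sup>2 \<partial>sadist S A p beh xib h)"
      using C by (intro nn_integral_eq_integral integrable_prob_bounded[OF D_prob sqm sqb]) auto
    finally show ?thesis by simp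
  qed
  have "(ennreal (1 + 4 * e / c) ^ h)\<^sup>2 * integral\<^sup>N (kchain (pstep (T.mix d) beh) xib h) var \<le> ennreal (4 * (C * ?I h))"
    if h: "h < H" for h
  proof -
    let ?J = "integral\<^sup>N (kchain (pstep (T.mix d) beh) xib h) var"
    have "ennreal (1 / b1) ^ h * ?J \<le> ennreal (C * ?I h)"
      unfolding var_eq[symmetric] b1_def
      by (rule nn_integral_kchain_mono[OF pstep_kernel[OF beh_kernel T.mix_kernel[OF d_density]] pstep_kernel[OF beh_kernel p_kernel]
            nn_integral_mix_beh_le xib_prob var_measurable])
    then have "ennreal (b1 ^ h) * (ennreal (1 / b1) ^ h * ?J) \<le> ennreal (b1 ^ h) * ennreal (C * ?I h)"
      by (rule mult_left_mono) simp
    moreover have "ennreal (b1 ^ h) * ennreal (1 / b1) ^ h = 1"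
      using b1 by (simp add: ennreal_power ennreal_mult[symmetric] power_mult_distrib[symmetric])
    ultimately have J: "?J \<le> ennreal (b1 ^ h) * ennreal (C * ?I h)"
      by (simp add: mult.assoc[symmetric])
    have "(ennreal b0 ^ h)\<^sup>2 * ?J \<le> ennreal ((b0 ^ h)\<^sup>2) * (ennreal (b1 ^ h) * ennreal (C * ?I h))"
      using J b1 by (simp add: ennreal_power mult_left_mono)
    also have "\<dots> = ennreal ((b0 ^ h)\<^sup>2 * b1 ^ h * (C * ?I h))"
      using b1 C by (simp add: ennreal_mult mult.assoc)
    also have "\<dots> \<le> ennreal (4 * (C * ?I h))"
    proof (rule ennreal_leI, rule mult_right_mono)
      have "(b0 ^ h)\<^sup>2 * b1 ^ h \<le> (b0 ^ h)\<^sup>2 * b0 ^ h"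
        using b1 by (intro mult_left_mono power_mono) auto
      also have "\<dots> = b0 ^ (3 * h)" by (simp add: power_mult[symmetric] power_add[symmetric] algebra_simps)
      also have "\<dots> \<le> b0 ^ (3 * H)" using b1 h by (intro power_increasing) auto
      also have "\<dots> \<le> 4" using b by (simp add: b0_def)
      finally show "(b0 ^ h)\<^sup>2 * b1 ^ h \<le> 4" .
      show "0 \<le> C * ?I h" using C by simp
    qed
    finally show ?thesis by (simp add: b0_def)
  qed
  then have "(\<Sum>h<H. (ennreal (1 + 4 * e / c) ^ h)\<^sup>2 * integral\<^sup>N (kchain (pstep (T.mix d) beh) xib h) var) \<le> (\<Sum>h<H. ennreal (4 * (C * ?I h)))"
    by (intro sum_mono) simp
  also have "\<dots> = ennreal (\<Sum>h<H. 4 * (C * ?I h))"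
    using C by (intro sum_ennreal) simp
  also have "(\<Sum>h<H. 4 * (C * ?I h)) = 4 * C * (real H * q w0)"
    unfolding q_eq using H_pos by (simp add: sum_distrib_left mult.assoc)
  also have "\<dots> = 1 / real K"
    using c_pos H_pos K unfolding w0 C_def \<alpha>_sq by (simp add: field_simps)
  finally have "1 + (\<Sum>h<H. (ennreal (1 + 4 * e / c) ^ h)\<^sup>2 * integral\<^sup>N (kchain (pstep (T.mix d) beh) xib h) var) \<le> ennreal 1 + ennreal (1 / real K)"
    by (simp add: add_left_mono)
  also have "\<dots> = ennreal (1 + 1 / real K)" by (rule ennreal_plus[symmetric]) auto
  finally show ?thesis .
qed

text \<open>An indicator is its own square, so the second-moment inequality turns into one between
  probabilities of events. Its constant (1 + 1/K)^K is bounded independently of \<open>K\<close>,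
  which is why one episode may cost exactly 1/K.\<close>

lemma data_law_domination:
  assumes b: "(1 + 4 * e / c) ^ (3 * H) \<le> 4" and E: "E \<in> sets (data_space S A K H)"
  shows "(emeasure (data_law S A (T.mix u) R pb xib K H) E)\<^sup>2 \<le> 3 * emeasure (data_law S A (T.mix d) R pb xib K H) E"
proof -
  let ?P = "episode S A (T.mix u) R pb xib H" and ?Q = "episode S A (T.mix d) R pb xib H"
  note P = prob_algebraD[OF episode_prob[OF R_kernel pb_meas xib_prob T.mix_kernel[OF u_density], of H]]
  note Q = prob_algebraD[OF episode_prob[OF R_kernel pb_meas xib_prob T.mix_kernel[OF d_density], of H]]
  have dom: "(integral\<^sup>N ?P g)\<^sup>2 \<le> ennreal (1 + 1 / real K) * (\<integral>\<^sup>+\<omega>. (g \<omega>)\<^sup>2 \<partial>?Q)" if g: "g \<in> borel_measurable ?Q" for g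
    by (rule episode_second_moment_bound[OF R_kernel pb_meas xib_prob T.mix_kernel[OF u_density] T.mix_kernel[OF d_density]
          lr_measurable var_measurable lr_le lr_ratio lr_second_moment g[unfolded Q(4)] sum_var_le[OF b]])
  have sP: "sets (PiM {..<K} (\<lambda>_. ?P)) = sets (data_space S A K H)" and sQ: "sets (PiM {..<K} (\<lambda>_. ?Q)) = sets (data_space S A K H)"
    unfolding data_space_def by (rule sets_PiM_cong[OF refl P(2)], rule sets_PiM_cong[OF refl Q(2)])
  have iE: "(indicator E :: _ \<Rightarrow> ennreal) \<in> borel_measurable (PiM {..<K} (\<lambda>_. ?Q))"
    using E unfolding sQ[symmetric] by (rule borel_measurable_indicator)
  have sq: "(indicator E x)\<^sup>2 = (indicator E x :: ennreal)" for x by (simp split: split_indicator)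
  have "(emeasure (PiM {..<K} (\<lambda>_. ?P)) E)\<^sup>2 \<le> ennreal (1 + 1 / real K) ^ K * emeasure (PiM {..<K} (\<lambda>_. ?Q)) E"
    using PiM_second_moment_bound[OF P(1) Q(1) _ dom iE] E sP sQ P(2) Q(2) by (simp add: sq)
  also have "\<dots> \<le> 3 * emeasure (PiM {..<K} (\<lambda>_. ?Q)) E"
  proof (rule mult_right_mono)
    have "(1 + 1 / real K) ^ K \<le> exp (1 / real K) ^ K"
      by (intro power_mono exp_ge_add_one_self) auto
    also have "\<dots> = exp 1" using K by (simp add: exp_of_nat_mult[symmetric])
    also have "\<dots> \<le> 3" by (rule exp_le)
    finally have "ennreal ((1 + 1 / real K) ^ K) \<le> ennreal 3" by (rule ennreal_leI)
    then show "ennreal (1 + 1 / real K) ^ K \<le> 3" by (subst ennreal_power) simp_all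
  qed simp
  finally show ?thesis unfolding data_law_def .
qed

end

section \<open>Choice of the direction and conclusion\<close>

context ope_instance
begin

lemma q_scaleR: "q (r *\<^sub>R w) = r\<^sup>2 * q w"
  by (simp add: q_def matrix_vector_mult_scaleR power2_eq_square)

lemma Num_scaleR: "Num (r *\<^sub>R w) = \<bar>r\<bar> * Num w"
proof -
  have fb: "fb (r *\<^sub>R w) = (\<lambda>s. \<bar>r\<bar> * fb w s)"
    by (simp add: fun_eq_iff fb_def abs_mult)
  show ?thesis unfolding Num_def fb by (simp add: sum_distrib_left mult_ac)
qed

text \<open>The supremum \<rho> of the homogeneous quotient \<open>Num w / sqrt (q w)\<close> is
  finite by the feature bound. Rather than showing that it is attained, a vector reaching 99/100 of
  it is rescaled to \<open>q w0 = 1\<close>; such a vector exists only if \<rho> > 0, hence the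
  separate case.\<close>

lemma Num_dichotomy:
  obtains (null) "\<And>w. Num w = 0"
  | (nontrivial) \<rho> w0 where "0 < \<rho>" "\<And>w. Num w \<le> \<rho> * sqrt (q w)" "q w0 = 1" "99/100 * \<rho> \<le> Num w0"
proof -
  let ?f = "\<lambda>w. Num w / sqrt (q w)" and ?W = "{w::real^'d. w \<noteq> 0}"
  define \<rho> where "\<rho> = (SUP w\<in>?W. ?f w)"
  have sq: "0 < sqrt (q w)" if "w \<noteq> 0" for w using q_pos[OF that] by simp
  have ne: "?W \<noteq> {}" using axis_eq_0_iff[of undefined "1::real"] by auto
  have bdd: "bdd_above (?f ` ?W)"
    using Num_le sq by (intro bdd_aboveI2[where M="(real H)\<^sup>2 * L"]) (simp add: pos_divide_le_eq)
  have le: "Num w \<le> \<rho> * sqrt (q w)" for w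
  proof (cases "w = 0")
    case True
    have "Num (0 *\<^sub>R w) = 0" unfolding Num_scaleR by simp
    then show ?thesis using True by (simp add: q_def)
  next
    case False
    have "?f w \<le> \<rho>" unfolding \<rho>_def using False by (intro cSUP_upper bdd) simp
    then show ?thesis using sq[OF False] by (simp add: pos_divide_le_eq)
  qed
  show thesis
  proof (cases "0 < \<rho>")
    case False
    have "Num w = 0" for w
    proof -
      have "\<rho> * sqrt (q w) \<le> 0" using False q_nonneg by (simp add: mult_nonpos_nonneg)
      then show ?thesis using le[of w] Num_nonneg[of w] by linarith
    qed
    then show thesis by (rule null)
  next
    case True
    then have "99/100 * \<rho> < \<rho>" by simp
    then obtain w1 where w1: "w1 \<noteq> 0" "99/100 * \<rho> < ?f w1"
      unfolding \<rho>_def less_cSUP_iff[OF ne bdd] by auto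
    define w0 where "w0 = (1 / sqrt (q w1)) *\<^sub>R w1"
    have "q w0 = 1" using q_pos[OF w1(1)] by (simp add: w0_def q_scaleR power_divide)
    moreover have "Num w0 = ?f w1" using sq[OF w1(1)] by (simp add: w0_def Num_scaleR)
    ultimately show thesis using nontrivial[OF True le] w1(2) by simp
  qed
qed

abbreviation "err p' K vhat \<equiv> emeasure (data_law S A p' R pb xib K H)
  {D \<in> space (data_space S A K H).
    ereal \<bar>pvalue S A p' R pol xi0 H - vhat D\<bar> \<ge>
    ereal (sqrt c / (24 * sqrt (real (K * H)))) *
      (SUP w \<in> {w. \<exists>x\<in>space X. \<phi> x \<bullet> w \<noteq> 0}. ratio S A p' pol pb xi0 xib H \<phi> w)}"

lemma data_law_prob:
  assumes p': "p' \<in> X \<rightarrow>\<^sub>M prob_algebra S"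
  shows "prob_space (data_law S A p' R pb xib K H)" "sets (data_law S A p' R pb xib K H) = sets (data_space S A K H)"
proof -
  note E = prob_algebraD[OF episode_prob[OF R_kernel pb_meas xib_prob p', of H]]
  show "prob_space (data_law S A p' R pb xib K H)" unfolding data_law_def by (rule prob_space_PiM) (rule E)
  show "sets (data_law S A p' R pb xib K H) = sets (data_space S A K H)"
    unfolding data_law_def data_space_def by (rule sets_PiM_cong[OF refl E(2)])
qed

text \<open>Raising the threshold shrinks the event, so a real upper bound \<open>T\<close> on the
  ratios may replace their extended-real supremum. Every \<open>w\<close> that enters the supremum
  is nonzero, so the bound applies to it.\<close>

lemma err_ge:
  assumes p': "p' \<in> X \<rightarrow>\<^sub>M prob_algebra S" and v[measurable]: "vhat \<in> borel_measurable (data_space S A K H)"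
    and T: "\<And>w. w \<noteq> 0 \<Longrightarrow> ratio S A p' pol pb xi0 xib H \<phi> w \<le> ereal T"
  shows "emeasure (data_law S A p' R pb xib K H)
      {D \<in> space (data_space S A K H). sqrt c / (24 * sqrt (real (K * H))) * T \<le> \<bar>pvalue S A p' R pol xi0 H - vhat D\<bar>}
    \<le> err p' K vhat"
proof (rule emeasure_mono)
  let ?\<kappa> = "sqrt c / (24 * sqrt (real (K * H)))"
  let ?s = "SUP w \<in> {w. \<exists>x\<in>space X. \<phi> x \<bullet> w \<noteq> 0}. ratio S A p' pol pb xi0 xib H \<phi> w"
  have "?s \<le> ereal T" by (rule SUP_least) (auto intro!: T)
  then have "ereal ?\<kappa> * ?s \<le> ereal ?\<kappa> * ereal T"
    using c_pos by (intro ereal_mult_left_mono) auto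
  then have "ereal ?\<kappa> * ?s \<le> ereal (?\<kappa> * T)" by simp
  then show "{D \<in> space (data_space S A K H). ?\<kappa> * T \<le> \<bar>pvalue S A p' R pol xi0 H - vhat D\<bar>}
    \<subseteq> {D \<in> space (data_space S A K H). ereal ?\<kappa> * ?s \<le> ereal \<bar>pvalue S A p' R pol xi0 H - vhat D\<bar>}"
    by (auto elim: order_trans)
  show "{D \<in> space (data_space S A K H). ereal ?\<kappa> * ?s \<le> ereal \<bar>pvalue S A p' R pol xi0 H - vhat D\<bar>}
    \<in> sets (data_law S A p' R pb xib K H)"
    unfolding data_law_prob(2)[OF p'] by measurable
qed

text \<open>The signed numerator is at most the absolute one, which is zero. All ratios are then at
  most 0, the threshold is not positive, and the event is the whole data space.\<close>

lemma err_null: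
  assumes null: "\<And>w. Num w = 0" and v: "vhat \<in> borel_measurable (data_space S A K H)"
  shows "err p K vhat \<ge> 1"
proof -
  have r: "ratio S A p pol pb xi0 xib H \<phi> w \<le> ereal 0" if "w \<noteq> 0" for w
  proof -
    have "(\<Sum>h<H. real (H - h) * (\<integral>x. \<phi> x \<bullet> w \<partial>sadist S A p pol xi0 h)) \<le> 0"
      using numerator_le[OF p_kernel, of w] null[of w] unfolding Num_def by simp
    then show ?thesis
      using q_pos[OF that] unfolding ratio_def q_eq[symmetric] by (simp add: divide_nonpos_nonneg)
  qed
  have "emeasure (data_law S A p R pb xib K H) (space (data_space S A K H)) = 1"
    using prob_space.emeasure_space_1[OF data_law_prob(1)[OF p_kernel]]
      sets_eq_imp_space_eq[OF data_law_prob(2)[OF p_kernel]] by metis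
  then show ?thesis using err_ge[OF p_kernel v r] by simp
qed

lemma tv_dist_self: "tv_dist P P = 0"
proof -
  have "{\<bar>measure P B - measure P B\<bar> | B. B \<in> sets P} = {0}" by auto
  then show ?thesis unfolding tv_dist_def by simp
qed

lemma minimax_lower_bound:
  "\<exists>N0::nat. \<forall>K::nat. K * H \<ge> N0 \<longrightarrow>
    (\<forall>\<epsilon>::real. \<epsilon> \<ge> sqrt (c * C1 * real CARD('d) / (32 * real (K * H))) \<longrightarrow>
      (\<forall>vhat. vhat \<in> borel_measurable (data_space S A K H) \<longrightarrow>
        (SUP p' \<in> {p'. p' \<in> X \<rightarrow>\<^sub>M prob_algebra S \<and> (\<forall>x\<in>space X. tv_dist (p' x) (p x) \<le> \<epsilon>)}. err p' K vhat)
        \<ge> 1 / 6))"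
proof (cases rule: Num_dichotomy)
    case null
    show ?thesis
    proof (intro exI[of _ 0] allI impI)
      fix K :: nat and \<epsilon> :: real and vhat :: "_ \<Rightarrow> real"
      assume \<epsilon>: "sqrt (c * C1 * real CARD('d) / (32 * real (K * H))) \<le> \<epsilon>" and v: "vhat \<in> borel_measurable (data_space S A K H)"
      have "0 \<le> \<epsilon>" using c_pos C1_pos by (intro order_trans[OF _ \<epsilon>]) simp
      have "1 / 6 \<le> (1::ennreal)" by (simp add: divide_le_posI_ennreal)
      also have "\<dots> \<le> err p K vhat" by (rule err_null[OF null v])
      finally show "1 / 6 \<le> (SUP p' \<in> {p'. p' \<in> X \<rightarrow>\<^sub>M prob_algebra S \<and> (\<forall>x\<in>space X. tv_dist (p' x) (p x) \<le> \<epsilon>)}. err p' K vhat)"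
        using p_kernel \<open>0 \<le> \<epsilon>\<close> by (intro SUP_upper2[of p]) (simp_all add: tv_dist_self)
    qed
  next
    case (nontrivial \<rho> w0)
    obtain e0 where e0: "0 < e0" and small: "\<And>e. 0 \<le> e \<Longrightarrow> e \<le> e0 \<Longrightarrow> e \<le> 1/2 \<and> (1 + 4 * e / c) ^ (3 * H) \<le> 4
      \<and> (\<rho> + real H ^ 3 * e * L) / sqrt ((1 - e) ^ H) / 12 \<le> 495/1000 * \<rho> / sqrt 32 - 3 * real H ^ 3 * e * L / sqrt 32"
      using small_perturbation[OF nontrivial(1) c_pos, of H L] by blast
    obtain u d where ud:
      "u \<in> borel_measurable S" "\<And>s. s \<in> space S \<Longrightarrow> 0 \<le> u s" "(\<integral>\<^sup>+s. ennreal (u s) \<partial>\<mu>) = 1"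
      "\<And>s t. s \<in> space S \<Longrightarrow> t \<in> space S \<Longrightarrow> c / 2 * u t \<le> pd (s, pb s) t" "\<And>s. s \<in> space S \<Longrightarrow> s \<notin> Sup_set \<Longrightarrow> u s = 0"
      "d \<in> borel_measurable S" "\<And>s. s \<in> space S \<Longrightarrow> 0 \<le> d s" "(\<integral>\<^sup>+s. ennreal (d s) \<partial>\<mu>) = 1"
      "\<And>s t. s \<in> space S \<Longrightarrow> t \<in> space S \<Longrightarrow> c / 2 * d t \<le> pd (s, pb s) t" "\<And>s. s \<in> space S \<Longrightarrow> s \<notin> Sdown \<Longrightarrow> d s = 0"
      using obtain_densities by blast
    \<comment> \<open>Chosen so that e^2 = c L^2 / (32 N) is at most e0^2; the successor also forces
      K H > 0.\<close>
    define N0 where "N0 = Suc (nat \<lceil>c * L\<^sup>2 / (32 * e0\<^sup>2)\<rceil>)"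
    show ?thesis
    proof (intro exI[of _ N0] allI impI)
      fix K :: nat and \<epsilon> :: real and vhat :: "_ \<Rightarrow> real"
      assume N: "N0 \<le> K * H" and \<epsilon>: "sqrt (c * C1 * real CARD('d) / (32 * real (K * H))) \<le> \<epsilon>"
        and v: "vhat \<in> borel_measurable (data_space S A K H)"
      define n where "n = real (K * H)"
      have "c * L\<^sup>2 / (32 * e0\<^sup>2) \<le> n" and KH: "0 < K * H" using N unfolding N0_def n_def by linarith+
      then have n: "c * L\<^sup>2 / (32 * e0\<^sup>2) \<le> n" "0 < n" "0 < K" by (auto simp: n_def)
      define \<alpha> where "\<alpha> = sqrt (c / (32 * n))"
      define e where "e = \<alpha> * L"
      have \<alpha>: "0 \<le> \<alpha>" "\<alpha> = sqrt c / sqrt n / sqrt 32"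
        using c_pos n by (simp_all add: \<alpha>_def real_sqrt_divide real_sqrt_mult field_simps)
      have e: "0 \<le> e" using \<alpha>(1) L_pos by (simp add: e_def)
      have e2: "e\<^sup>2 = c * L\<^sup>2 / (32 * n)"
        using c_pos n by (simp add: e_def \<alpha>_def power_mult_distrib)
      also have "\<dots> \<le> e0\<^sup>2" using n e0 by (simp add: field_simps)
      finally have "e \<le> e0" using e0 by (simp add: power2_le_iff_abs_le e)
      note small = small[OF e this]
      have e\<epsilon>: "e \<le> \<epsilon>"
      proof -
        have "e = sqrt (e\<^sup>2)" using e by simp
        \<comment> \<open>So \<open>e\<close> is exactly the smallest admissible radius, and both
          mixtures lie in the neighbourhood.\<close>
        also have "\<dots> = sqrt (c * C1 * real CARD('d) / (32 * n))"
          using C1_pos unfolding e2 L_def by (simp add: mult.assoc)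
        finally show ?thesis using \<epsilon> by (simp add: n_def)
      qed
      interpret P: perturbed_instance S A \<mu> p pd R pol pb xi0 xib H \<phi> C1 Sup_set Sdown c
        u d w0 K \<alpha> e "\<lambda>x. \<alpha> * \<bar>\<phi> x \<bullet> w0\<bar>"
        by unfold_locales
          (rule ud nontrivial(3) n(3) e_def refl \<alpha>_def[unfolded n_def] conjunct1[OF small] | assumption)+
      define T where "T = (\<rho> + real H ^ 3 * e * L) / sqrt ((1 - e) ^ H)"
      define t where "t = sqrt c / (24 * sqrt (real (K * H))) * T"
      have gap: "2 * t \<le> pvalue S A (P.T.mix u) R pol xi0 H - pvalue S A (P.T.mix d) R pol xi0 H"
      proof -
        \<comment> \<open>2 / 24 = 1 / 12, which brings the claim into the form provided by
          \<open>small_perturbation\<close>, up to the factor sqrt c / sqrt n.\<close>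
        have "2 * t = sqrt c / sqrt n * (T / 12)" by (simp add: t_def n_def mult.commute)
        also have "\<dots> \<le> sqrt c / sqrt n * (495/1000 * \<rho> / sqrt 32 - 3 * real H ^ 3 * e * L / sqrt 32)"
          using small c_pos n unfolding T_def by (intro mult_left_mono) auto
        \<comment> \<open>Each division by sqrt 32 is absorbed into \<alpha> = sqrt c / sqrt n /
          sqrt 32; in the error term \<alpha> combines with L into a second factor e.\<close>
        also have "\<dots> = \<alpha> * (99/100 * \<rho>) / 2 - 3 * real H ^ 3 * (e * (\<alpha> * L))"
          unfolding \<alpha>(2) by (simp add: algebra_simps)
        also have "\<dots> \<le> \<alpha> * Num w0 / 2 - 3 * real H ^ 3 * e\<^sup>2"
          using mult_left_mono[OF nontrivial(4) \<alpha>(1)] unfolding e_def[symmetric] power2_eq_square by simp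
        also note P.pvalue_gap
        finally show ?thesis .
      qed
      note ku = P.T.mix_kernel[OF P.u_density] and kd = P.T.mix_kernel[OF P.d_density]
      have "1/6 \<le> err (P.T.mix u) K vhat \<or> 1/6 \<le> err (P.T.mix d) K vhat"
        using two_point_lower_bound[OF data_law_prob(1)[OF ku] data_law_prob(1)[OF kd] data_law_prob(2)[OF ku] data_law_prob(2)[OF kd]
            v P.data_law_domination[OF conjunct1[OF conjunct2[OF small]]] gap]
          order_trans[OF _ err_ge[OF ku v P.ratio_mix_le[OF P.u_density nontrivial(2)], folded T_def t_def]]
          order_trans[OF _ err_ge[OF kd v P.ratio_mix_le[OF P.d_density nontrivial(2)], folded T_def t_def]]
        by blast
      moreover have "tv_dist (P.T.mix u x) (p x) \<le> \<epsilon>" "tv_dist (P.T.mix d x) (p x) \<le> \<epsilon>" if "x \<in> space X" for x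
        using P.T.mix_tv[OF P.u_density that] P.T.mix_tv[OF P.d_density that] e\<epsilon> by linarith+
      ultimately show "1 / 6 \<le> (SUP p' \<in> {p'. p' \<in> X \<rightarrow>\<^sub>M prob_algebra S \<and> (\<forall>x\<in>space X. tv_dist (p' x) (p x) \<le> \<epsilon>)}. err p' K vhat)"
        using ku kd by (auto intro: SUP_upper2)
    qed
qed

end

theorem theorem3:
  fixes S :: "'s measure" and A :: "'a measure" and \<mu> :: "'s measure"
    and p :: "'s \<times> 'a \<Rightarrow> 's measure" and pd :: "'s \<times> 'a \<Rightarrow> 's \<Rightarrow> real"
    and R :: "'s \<times> 'a \<Rightarrow> real measure"
    and pol :: "'s \<Rightarrow> 'a measure" and pb :: "'s \<Rightarrow> 'a"
    and xi0 xib :: "'s measure" and H :: nat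
    and \<phi> :: "'s \<times> 'a \<Rightarrow> real^'d" and C1 :: real
    and Sup_set Sdown :: "'s set" and c :: real
  assumes base: "sigma_finite_measure \<mu>" "sets \<mu> = sets S"
    and p_kernel: "p \<in> S \<Otimes>\<^sub>M A \<rightarrow>\<^sub>M prob_algebra S"
    and pd_meas: "(\<lambda>(x, s'). pd x s') \<in> borel_measurable ((S \<Otimes>\<^sub>M A) \<Otimes>\<^sub>M S)"
    and pd_nonneg: "\<And>x s'. x \<in> space (S \<Otimes>\<^sub>M A) \<Longrightarrow> s' \<in> space S \<Longrightarrow> 0 \<le> pd x s'"
    and p_density: "\<And>x. x \<in> space (S \<Otimes>\<^sub>M A) \<Longrightarrow> p x = density \<mu> (\<lambda>s'. ennreal (pd x s'))"
    and R_kernel: "R \<in> S \<Otimes>\<^sub>M A \<rightarrow>\<^sub>M prob_algebra borel"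
    and R_range: "\<And>x. x \<in> space (S \<Otimes>\<^sub>M A) \<Longrightarrow> measure (R x) {0..1} = 1"
    and pol_kernel: "pol \<in> S \<rightarrow>\<^sub>M prob_algebra A"
    and pb_meas: "pb \<in> S \<rightarrow>\<^sub>M A"
    and xi0_prob: "xi0 \<in> space (prob_algebra S)"
    and xib_prob: "xib \<in> space (prob_algebra S)"
    and phi_meas: "\<phi> \<in> borel_measurable (S \<Otimes>\<^sub>M A)"
    and Sigma_inv: "invertible (cov_matrix S A p pb xib H \<phi>)"
    and C1_pos: "C1 > 0"
    and C1_bound: "\<And>x. x \<in> space (S \<Otimes>\<^sub>M A) \<Longrightarrow>
        \<phi> x \<bullet> (matrix_inv (cov_matrix S A p pb xib H \<phi>) *v \<phi> x) \<le> C1 * real CARD('d)"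
    and sets_meas: "Sup_set \<in> sets S" "Sdown \<in> sets S"
    and V_up: "\<And>h s. h \<le> H \<Longrightarrow> s \<in> Sup_set \<Longrightarrow>
        Vfun S A p R pol H h s \<ge> 3 / 4 * real (H - h + 1)"
    and V_down: "\<And>h s. h \<le> H \<Longrightarrow> s \<in> Sdown \<Longrightarrow>
        Vfun S A p R pol H h s \<le> 1 / 4 * real (H - h + 1)"
    and c_pos: "c > 0"
    and pbar: "(\<integral>\<^sup>+ s'\<in>Sup_set. ennreal (INF s\<in>space S. pd (s, pb s) s') \<partial>\<mu>) \<ge> ennreal c"
    and pbar': "(\<integral>\<^sup>+ s'\<in>Sdown. ennreal (INF s\<in>space S. pd (s, pb s) s') \<partial>\<mu>) \<ge> ennreal c"
  shows "\<exists>N0::nat. \<forall>K::nat. K * H \<ge> N0 \<longrightarrow>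
    (\<forall>\<epsilon>::real. \<epsilon> \<ge> sqrt (c * C1 * real CARD('d) / (32 * real (K * H))) \<longrightarrow>
      (\<forall>vhat. vhat \<in> borel_measurable (data_space S A K H) \<longrightarrow>
        (SUP p' \<in> {p'. p' \<in> S \<Otimes>\<^sub>M A \<rightarrow>\<^sub>M prob_algebra S \<and>
                    (\<forall>x\<in>space (S \<Otimes>\<^sub>M A). tv_dist (p' x) (p x) \<le> \<epsilon>)}.
           emeasure (data_law S A p' R pb xib K H)
             {D \<in> space (data_space S A K H).
                ereal \<bar>pvalue S A p' R pol xi0 H - vhat D\<bar> \<ge>
                ereal (sqrt c / (24 * sqrt (real (K * H)))) *
                  (SUP w \<in> {w. \<exists>x\<in>space (S \<Otimes>\<^sub>M A). \<phi> x \<bullet> w \<noteq> 0}. ratio S A p' pol pb xi0 xib H \<phi> w)})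
        \<ge> 1 / 6))"
proof -
  interpret ope_instance S A \<mu> p pd R pol pb xi0 xib H \<phi> C1 Sup_set Sdown c
    by unfold_locales (fact assms)+
  show ?thesis by (rule minimax_lower_bound)
qed

end
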